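(* Let $\mathcal{L}$ be a divergence form second-order uniformly elliptic operator on $\mathbb{R}^n$ with ellipticity constant $\Lambda\ge1$, and let $\mu$ denote Lebesgue measure on $\mathbb{R}^n$. (1) Suppose $n=2$. Let $V\subseteq\mathbb{R}^2$ be a bounded $(C_0,c_0)$-inner uniform domain with respect to the Euclidean distance and let $\{V_c:c\ge1\}$ be a family of bounded $(C_0,c_0)$-inner uniform domains all containing $V$, with associated functions $f,g$, as defined in the context. Suppose $U$ is a domain satisfying an $\alpha$-exterior ball condition with $V\subseteq U\subseteq V_c$. Suppose $x_U\in U$ is a point with $\varphi_U(x_U)\ge\beta/\sqrt{\mu(U)}$ for some $\beta>0$. Then $$d(x_U,\partial U)\gtrsim\frac1{\sqrt{\lambda_U}},$$ where the implied constant depends only on $c_0,\alpha,\beta,\Lambda$ and an upper bound on $f(c)$, $c\ge1$. (2) Suppose $n=1$. Let $U=(u_1,u_2)\subseteq\mathbb{R}$ be a bounded interval. For any point $x_U\in U$ with $\varphi_U(x_U)\ge\beta/\sqrt{\mu(U)}$ for some $\beta>0$, $$d(x_U,\partial U)\gtrsim u_2-u_1,$$ where the implied constant depends only on $\beta$ and $\Lambda$.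
   Context: Operator: $\mathcal{L}u=\sum_{i,j=1}^n\frac{\partial}{\partial x_i}\big(a_{ij}\frac{\partial u}{\partial x_j}\big)$, where $(a_{ij})$ is a symmetric matrix-valued measurable function on $\mathbb{R}^n$ with $\Lambda^{-1}|\xi|^2\le\sum_{i,j}a_{ij}(x)\xi_i\xi_j\le\Lambda|\xi|^2$ for all $x,\xi\in\mathbb{R}^n$. For a bounded domain (nonempty connected open set) $U$, $\lambda_U$ is the smallest Dirichlet eigenvalue of $-\mathcal{L}$ on $U$ (the infimum of $\int_U\sum a_{ij}\partial_if\partial_jf\,dx/\|f\|_{L^2(U)}^2$ over $0\ne f\in W_0^{1,2}(U)$), and $\varphi_U>0$ is the corresponding principal Dirichlet eigenfunction (taken continuous), with $\|\varphi_U\|_{L^2(U)}=1$. Distances $d$ and balls are Euclidean. $d_U(x,y)$ is the infimum of lengths of continuous curves in $U$ joining $x$ to $y$, and $\mathrm{diam}_U=\sup_{x,y\in U}d_U(x,y)$. $U$ is $(C_0,c_0)$-inner uniform ($C_0\in[1,\infty)$, $c_0\in(0,1]$) if any $x,y\in U$ can be joined by a continuous curve in $U$ of length at most $C_0d_U(x,y)$ such that every $z$ on it satisfies $d(z,\partial U)\ge c_0\,d_U(x,z)d_U(y,z)/d_U(x,y)$. A bounded domain $U$ satisfies an $\alpha$-exterior ball condition, $\alpha\in(0,1]$, if for every $x\in U$ there is a ball $B\subseteq B(x,2d(x,\partial U))\setminus U$ with radius $\alpha\,d(x,\partial U)$. Family $V_c$. Let $f,g:[1,\infty)\to[1,\infty)$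 be continuous with $f(1)=g(1)=1$. $\{V_c:c\ge1\}$ denotes any one-parameter family of bounded $(C_0,c_0)$-inner uniform domains with $V_c\supseteq V$, $\mu(V_c)=f(c)\mu(V)$ and $\mathrm{diam}_{V_c}=g(c)\,\mathrm{diam}_V$ for all $c\ge1$. $A\gtrsim B$ means $A\ge C'B$ for a constant $C'>0$ depending only on the indicated parameters. *)

theory Defs
  imports "HOL-Analysis.Analysis"
begin

section \<open>Inner uniform domains and the exterior ball condition\<close>

definition bounded_domain :: "'a::euclidean_space set \<Rightarrow> bool" where
  "bounded_domain U \<longleftrightarrow> U \<noteq> {} \<and> open U \<and> connected U \<and> bounded U"

text \<open>The length of a continuous curve, as the supremum of the lengths of inscribed polygons;
  it is infinite for curves that are not rectifiable.\<close>

definition curve_length :: "(real \<Rightarrow> 'a::metric_space) \<Rightarrow> ennreal" where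
  "curve_length \<gamma> =
    (SUP ts\<in>{ts. sorted ts \<and> set ts \<subseteq> {0..1}}.
       \<Sum>k<length ts - 1. ennreal (dist (\<gamma> (ts ! k)) (\<gamma> (ts ! Suc k))))"

definition curves_in :: "'a::euclidean_space set \<Rightarrow> 'a \<Rightarrow> 'a \<Rightarrow> (real \<Rightarrow> 'a) set" where
  "curves_in U x y =
    {\<gamma>. path \<gamma> \<and> path_image \<gamma> \<subseteq> U \<and> pathstart \<gamma> = x \<and> pathfinish \<gamma> = y}"

definition inner_dist :: "'a::euclidean_space set \<Rightarrow> 'a \<Rightarrow> 'a \<Rightarrow> ennreal" where
  "inner_dist U x y = (INF \<gamma>\<in>curves_in U x y. curve_length \<gamma>)"

definition inner_diam :: "'a::euclidean_space set \<Rightarrow> ennreal" where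
  "inner_diam U = (SUP x\<in>U. SUP y\<in>U. inner_dist U x y)"

abbreviation boundary_dist :: "'a::euclidean_space set \<Rightarrow> 'a \<Rightarrow> real" where
  "boundary_dist U x \<equiv> infdist x (frontier U)"

text \<open>If \<open>x = y\<close>, the quotient below is \<open>0 / 0 = 0\<close> in \<^typ>\<open>ennreal\<close>, so the second
  requirement is void. In a domain, \<^const>\<open>inner_dist\<close> is never infinite.\<close>

definition inner_uniform :: "real \<Rightarrow> real \<Rightarrow> 'a::euclidean_space set \<Rightarrow> bool" where
  "inner_uniform C0 c0 U \<longleftrightarrow>
    1 \<le> C0 \<and> 0 < c0 \<and> c0 \<le> 1 \<and>
    (\<forall>x\<in>U. \<forall>y\<in>U. \<exists>\<gamma>\<in>curves_in U x y.
       curve_length \<gamma> \<le> ennreal C0 * inner_dist U x y \<and>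
       (\<forall>z\<in>path_image \<gamma>.
          ennreal c0 * inner_dist U x z * inner_dist U y z / inner_dist U x y
            \<le> ennreal (boundary_dist U z)))"

definition exterior_ball_condition :: "real \<Rightarrow> 'a::euclidean_space set \<Rightarrow> bool" where
  "exterior_ball_condition \<alpha> U \<longleftrightarrow>
    0 < \<alpha> \<and> \<alpha> \<le> 1 \<and>
    (\<forall>x\<in>U. \<exists>w. ball w (\<alpha> * boundary_dist U x) \<subseteq> ball x (2 * boundary_dist U x) - U)"

definition inner_uniform_family ::
  "real \<Rightarrow> real \<Rightarrow> (real \<Rightarrow> real) \<Rightarrow> (real \<Rightarrow> real) \<Rightarrow>
     'a::euclidean_space set \<Rightarrow> (real \<Rightarrow> 'a set) \<Rightarrow> bool" where
  "inner_uniform_family C0 c0 f g V Vc \<longleftrightarrow>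
    continuous_on {1..} f \<and> continuous_on {1..} g \<and>
    (\<forall>c\<ge>1. 1 \<le> f c \<and> 1 \<le> g c) \<and> f 1 = 1 \<and> g 1 = 1 \<and>
    (\<forall>c\<ge>1. bounded_domain (Vc c) \<and> inner_uniform C0 c0 (Vc c) \<and> V \<subseteq> Vc c \<and>
       measure lebesgue (Vc c) = f c * measure lebesgue V \<and>
       inner_diam (Vc c) = ennreal (g c) * inner_diam V)"


section \<open>The Sobolev space of functions vanishing on the boundary\<close>

primrec continuously_differentiable :: "nat \<Rightarrow> ('a::euclidean_space \<Rightarrow> real) \<Rightarrow> bool" where
  "continuously_differentiable 0 h \<longleftrightarrow> continuous_on UNIV h"
| "continuously_differentiable (Suc k) h \<longleftrightarrow>
     (\<forall>x. h differentiable at x) \<and>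
     (\<forall>i\<in>Basis. continuously_differentiable k (\<lambda>x. frechet_derivative h (at x) i))"

definition test_functions :: "'a::euclidean_space set \<Rightarrow> ('a \<Rightarrow> real) set" where
  "test_functions U =
    {h. (\<forall>k. continuously_differentiable k h) \<and>
        compact (closure {x. h x \<noteq> 0}) \<and> closure {x. h x \<noteq> 0} \<subseteq> U}"

definition gradient :: "('a::euclidean_space \<Rightarrow> real) \<Rightarrow> 'a \<Rightarrow> 'a" where
  "gradient h x = (\<Sum>i\<in>Basis. frechet_derivative h (at x) i *\<^sub>R i)"

definition square_integrable ::
  "'a::euclidean_space set \<Rightarrow> ('a \<Rightarrow> 'b::euclidean_space) \<Rightarrow> bool" where
  "square_integrable U u \<longleftrightarrow>
    u \<in> borel_measurable (lebesgue_on U) \<and>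
    integrable (lebesgue_on U) (\<lambda>x. (norm (u x))\<^sup>2)"

text \<open>\<open>W12 U u G\<close>: the function \<open>u\<close> belongs to \<open>W\<^sup>1\<^sup>,\<^sup>2(U)\<close> and \<open>G\<close> is (a representative of)
  its weak gradient. Functions live on the whole space, but only their values on \<open>U\<close> matter.\<close>

definition W12 :: "'a::euclidean_space set \<Rightarrow> ('a \<Rightarrow> real) \<Rightarrow> ('a \<Rightarrow> 'a) \<Rightarrow> bool" where
  "W12 U u G \<longleftrightarrow>
    square_integrable U u \<and> square_integrable U G \<and>
    (\<forall>h\<in>test_functions U. \<forall>i\<in>Basis.
       (LINT x|lebesgue_on U. (u x * (gradient h x \<bullet> i))) =
       - (LINT x|lebesgue_on U. ((G x \<bullet> i) * h x)))"

definition weak_gradient :: "'a::euclidean_space set \<Rightarrow> ('a \<Rightarrow> real) \<Rightarrow> 'a \<Rightarrow> 'a" where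
  "weak_gradient U u = (SOME G. W12 U u G)"

text \<open>The closure of the test functions in the norm of \<open>W\<^sup>1\<^sup>,\<^sup>2(U)\<close>.\<close>

definition W012 :: "'a::euclidean_space set \<Rightarrow> ('a \<Rightarrow> real) set" where
  "W012 U =
    {u. (\<exists>G. W12 U u G) \<and>
        (\<exists>h. (\<forall>k::nat. h k \<in> test_functions U) \<and>
          (\<lambda>k. LINT x|lebesgue_on U.
             ((u x - h k x)\<^sup>2 + (norm (weak_gradient U u x - gradient (h k) x))\<^sup>2))
            \<longlonglongrightarrow> 0)}"


section \<open>The principal Dirichlet eigenvalue and eigenfunction\<close>

text \<open>A coefficient matrix is given by its entries \<open>a x i j\<close> with \<open>i\<close> and \<open>j\<close> ranging over
  \<^const>\<open>Basis\<close>; the values at other indices are irrelevant.\<close>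

definition uniformly_elliptic ::
  "real \<Rightarrow> ('a::euclidean_space \<Rightarrow> 'a \<Rightarrow> 'a \<Rightarrow> real) \<Rightarrow> bool" where
  "uniformly_elliptic \<Lambda> a \<longleftrightarrow>
    (\<forall>i\<in>Basis. \<forall>j\<in>Basis. (\<lambda>x. a x i j) \<in> borel_measurable lebesgue) \<and>
    (\<forall>x. \<forall>i\<in>Basis. \<forall>j\<in>Basis. a x i j = a x j i) \<and>
    (\<forall>x \<xi>. inverse \<Lambda> * (norm \<xi>)\<^sup>2 \<le> (\<Sum>i\<in>Basis. \<Sum>j\<in>Basis. a x i j * (\<xi> \<bullet> i) * (\<xi> \<bullet> j)) \<and>
            (\<Sum>i\<in>Basis. \<Sum>j\<in>Basis. a x i j * (\<xi> \<bullet> i) * (\<xi> \<bullet> j)) \<le> \<Lambda> * (norm \<xi>)\<^sup>2)"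

definition dirichlet_form ::
  "('a::euclidean_space \<Rightarrow> 'a \<Rightarrow> 'a \<Rightarrow> real) \<Rightarrow> 'a set \<Rightarrow> ('a \<Rightarrow> real) \<Rightarrow> ('a \<Rightarrow> real) \<Rightarrow> real" where
  "dirichlet_form a U u v =
    (LINT x|lebesgue_on U. (\<Sum>i\<in>Basis. \<Sum>j\<in>Basis.
       a x i j * (weak_gradient U u x \<bullet> i) * (weak_gradient U v x \<bullet> j)))"

definition dirichlet_eigenvalue ::
  "('a::euclidean_space \<Rightarrow> 'a \<Rightarrow> 'a \<Rightarrow> real) \<Rightarrow> 'a set \<Rightarrow> real" where
  "dirichlet_eigenvalue a U =
    (INF u\<in>{u \<in> W012 U. \<not> (AE x in lebesgue_on U. u x = 0)}.
       dirichlet_form a U u u / (LINT x|lebesgue_on U. ((u x)\<^sup>2)))"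

text \<open>The last clause is the weak form of \<open>- L \<phi> = \<lambda> \<phi>\<close> for the operator \<open>L\<close> in divergence form
  with coefficients \<open>a\<close> and the principal Dirichlet eigenvalue \<open>\<lambda>\<close>.\<close>

definition principal_eigenfunction ::
  "('a::euclidean_space \<Rightarrow> 'a \<Rightarrow> 'a \<Rightarrow> real) \<Rightarrow> 'a set \<Rightarrow> ('a \<Rightarrow> real) \<Rightarrow> bool" where
  "principal_eigenfunction a U \<phi> \<longleftrightarrow>
    \<phi> \<in> W012 U \<and> continuous_on U \<phi> \<and> (\<forall>x\<in>U. 0 < \<phi> x) \<and>
    (LINT x|lebesgue_on U. ((\<phi> x)\<^sup>2)) = 1 \<and>
    (\<forall>v\<in>W012 U. dirichlet_form a U \<phi> v =
       dirichlet_eigenvalue a U * (LINT x|lebesgue_on U. (\<phi> x * v x)))"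

end

theory Submission
  imports Defs
begin

text \<open>In the interval, \<open>\<phi> x\<^sup>2\<close> is at most the distance to the boundary times the energy of \<open>\<phi>\<close>, and
  the energy is at most a multiple of the inverse square of the length.

  In the plane, write \<open>\<lambda>\<close> for the eigenvalue and \<open>d\<close> for the distance of \<open>x\<close> to the boundary. The inner
  uniform domain \<open>V\<close> contains a ball of radius comparable to the square root of its area, so
  \<open>\<lambda> \<mu>(U)\<close> is bounded and it suffices to show that \<open>\<phi> x\<^sup>2 / \<lambda>\<close> is small when \<open>\<lambda> d\<^sup>2\<close> is.
  De Giorgi iteration bounds \<open>\<phi> x\<^sup>2\<close> by the mean of \<open>\<phi>\<^sup>2\<close> on a disc of radius \<open>r\<close> with \<open>\<lambda> r\<^sup>2 \<le> 1\<close>.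
  The radius \<open>1 / \<surd>\<lambda>\<close> gives \<open>\<phi>\<^sup>2 \<le> C \<lambda>\<close> everywhere; for the radius \<open>2 d\<close> the exterior ball at
  \<open>x\<close> provides a Poincare inequality, so \<open>\<phi> x\<^sup>2\<close> is at most a multiple of the energy of \<open>\<phi>\<close> near
  \<open>x\<close>. Since points have zero capacity in the plane, testing the equation with \<open>\<eta>\<^sup>2 \<phi>\<close> for a
  logarithmic cutoff \<open>\<eta>\<close> shows that this energy is at most
  \<open>C \<lambda> (4\<^sup>N \<lambda> d\<^sup>2 + 1 / N)\<close> for every \<open>N\<close>.\<close>

section \<open>Smooth functions and cutoffs\<close>

text \<open>The obstacle is scale invariance. In the plane the mean over a disc of radius 2d costs
  1/d^2, the Poincare inequality at that scale returns d^2, and the energy of an ordinary cutoff at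
  scale d does not depend on d. With the global bound these only reproduce \<phi>(x)^2 <= C
  \<lambda>, which is no contradiction, because the hypothesis on x says precisely that \<phi>(x)^2
  is at least a multiple of \<lambda>. The whole gain must come from the cutoff: spreading it over N
  dyadic scales lowers its energy to order 1/N, at the price of a disc of radius 2^N * 8d, whose
  area is the source of the factor 4^N. The number N is fixed from the parameters alone and only
  then is \<lambda> d^2 compared with a constant. The exterior ball is used at the single point x,
  so no decay along the boundary is iterated. All inequalities are proved for test functions and
  carried over by L^2 limits; pointwise statements return through the continuity of \<phi>. Because
  the final constant has to be uniform, each auxiliary lemma obtains its constant before operators,
  domains, centres and radii are quantified.\<close>

definition smooth :: "('a::euclidean_space \<Rightarrow> real) \<Rightarrow> bool" where
  "smooth h \<longleftrightarrow> (\<forall>k. continuously_differentiable k h)"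

lemma gradient_eqI:
  assumes "GDERIV h x :> D"
  shows "gradient h x = D"
proof -
  have "frechet_derivative h (at x) = (\<lambda>y. y \<bullet> D)"
    using assms frechet_derivative_at unfolding gderiv_def by metis
  then show ?thesis
    unfolding gradient_def by (simp add: inner_commute[of _ D] euclidean_representation)
qed

lemma frechet_derivative_GDERIV:
  assumes "GDERIV h x :> D"
  shows "frechet_derivative h (at x) i = D \<bullet> i"
proof -
  have "frechet_derivative h (at x) = (\<lambda>y. y \<bullet> D)"
    using assms frechet_derivative_at unfolding gderiv_def by metis
  then show ?thesis by (simp add: inner_commute)
qed

lemma GDERIV_gradient:
  assumes "h differentiable at x"
  shows "GDERIV h x :> gradient h x"
proof -
  have d: "(h has_derivative frechet_derivative h (at x)) (at x)"
    using assms frechet_derivative_works by blast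
  then have "linear (frechet_derivative h (at x))"
    using has_derivative_linear by blast
  then have "frechet_derivative h (at x) y = y \<bullet> gradient h x" for y
    unfolding gradient_def inner_sum_right
    by (subst euclidean_representation[of y, symmetric])
      (simp add: linear_sum linear_scale mult.commute)
  then have "frechet_derivative h (at x) = (\<lambda>y. y \<bullet> gradient h x)" by blast
  with d show ?thesis unfolding gderiv_def by simp
qed

text \<open>The definition speaks of \<open>frechet_derivative\<close>. This rule and the next one
  trade it for an explicit gradient field, so that the inductions on the order can use the calculus
  of \<open>GDERIV\<close>.\<close>

lemma continuously_differentiable_SucI:
  assumes "\<And>x. GDERIV h x :> D x"
    and "\<And>i. i \<in> Basis \<Longrightarrow> continuously_differentiable k (\<lambda>x. D x \<bullet> i)"
  shows "continuously_differentiable (Suc k) h"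
proof -
  have "frechet_derivative h (at x) i = D x \<bullet> i" for x i
    using assms(1) by (rule frechet_derivative_GDERIV)
  moreover have "h differentiable at x" for x
    using assms(1)[of x] unfolding gderiv_def differentiable_def by blast
  ultimately show ?thesis using assms(2) by simp
qed

lemma continuously_differentiable_SucD:
  assumes "continuously_differentiable (Suc k) h"
  shows "GDERIV h x :> gradient h x"
    and "i \<in> Basis \<Longrightarrow> continuously_differentiable k (\<lambda>x. gradient h x \<bullet> i)"
proof -
  show "GDERIV h x :> gradient h x" for x
    using assms by (intro GDERIV_gradient) simp
  then have "frechet_derivative h (at x) i = gradient h x \<bullet> i" for x i
    using frechet_derivative_GDERIV by blast
  then show "i \<in> Basis \<Longrightarrow> continuously_differentiable k (\<lambda>x. gradient h x \<bullet> i)"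
    using assms by auto
qed

lemma continuously_differentiable_continuous:
  "continuously_differentiable k h \<Longrightarrow> continuous_on UNIV h"
  by (cases k) (auto intro!: differentiable_imp_continuous_on simp: differentiable_on_def
      differentiable_at_imp_differentiable_on)

lemma continuously_differentiable_mono:
  "continuously_differentiable (Suc k) h \<Longrightarrow> continuously_differentiable k h"
proof (induction k arbitrary: h)
  case 0
  then show ?case using continuously_differentiable_continuous by (metis continuously_differentiable.simps(1))
next
  case (Suc k)
  then show ?case by simp
qed

lemma continuously_differentiable_const: "continuously_differentiable k (\<lambda>x. c)"
proof (induction k arbitrary: c)
  case (Suc k)
  show ?case by (rule continuously_differentiable_SucI[OF GDERIV_const]) (simp add: Suc)
qed simp

lemma continuously_differentiable_add:
  "continuously_differentiable k f \<Longrightarrow> continuously_differentiable k g \<Longrightarrow>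
    continuously_differentiable k (\<lambda>x. f x + g x)"
proof (induction k arbitrary: f g)
  case 0
  then show ?case by (auto intro: continuous_intros)
next
  case (Suc k)
  show ?case
    by (rule continuously_differentiable_SucI
        [OF GDERIV_add[OF continuously_differentiable_SucD(1)[OF Suc.prems(1)]
            continuously_differentiable_SucD(1)[OF Suc.prems(2)]]])
      (use Suc.IH continuously_differentiable_SucD(2)[OF Suc.prems(1)]
         continuously_differentiable_SucD(2)[OF Suc.prems(2)] in \<open>simp add: inner_add_left\<close>)
qed

lemma continuously_differentiable_mult:
  "continuously_differentiable k f \<Longrightarrow> continuously_differentiable k g \<Longrightarrow>
    continuously_differentiable k (\<lambda>x. f x * g x)"
proof (induction k arbitrary: f g)
  case 0
  then show ?case by (auto intro: continuous_intros)
next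
  case (Suc k)
  note d = continuously_differentiable_SucD[OF Suc.prems(1)]
    continuously_differentiable_SucD[OF Suc.prems(2)]
  show ?case
    by (rule continuously_differentiable_SucI[OF GDERIV_mult[OF d(1) d(3)]])
      (use d(2,4) Suc.IH Suc.prems[THEN continuously_differentiable_mono] in
        \<open>simp add: inner_add_left continuously_differentiable_add\<close>)
qed

text \<open>The gradient is \<open>gradient F (h x)\<close> times the gradient of \<open>h\<close>,
  and its first factor is again a composition, of one order less. Hence the induction leaves both
  \<open>F\<close> and \<open>h\<close> arbitrary.\<close>

lemma continuously_differentiable_compose:
  fixes F :: "real \<Rightarrow> real"
  shows "continuously_differentiable k F \<Longrightarrow> continuously_differentiable k h \<Longrightarrow>
    continuously_differentiable k (\<lambda>x. F (h x))"
proof (induction k arbitrary: F h)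
  case 0
  then show ?case using continuous_on_compose2[of UNIV F UNIV h] by auto
next
  case (Suc k)
  note d = continuously_differentiable_SucD[OF Suc.prems(1)]
    continuously_differentiable_SucD[OF Suc.prems(2)]
  have "continuously_differentiable k (gradient F)"
    using d(2)[of 1] by simp
  then have F': "continuously_differentiable k (\<lambda>x. gradient F (h x))"
    by (rule Suc.IH[OF _ Suc.prems(2)[THEN continuously_differentiable_mono]])
  have "DERIV F t :> gradient F t" for t
    using d(1)[of t] by simp
  from GDERIV_DERIV_compose[OF d(3) this]
  have "GDERIV (\<lambda>x. F (h x)) x :> gradient F (h x) *\<^sub>R gradient h x" for x .
  then show ?case
    by (rule continuously_differentiable_SucI)
      (use continuously_differentiable_mult[OF F' d(4)] in simp)
qed

lemma smooth_const: "smooth (\<lambda>x. c)"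
  by (simp add: smooth_def continuously_differentiable_const)

lemma smooth_add: "smooth f \<Longrightarrow> smooth g \<Longrightarrow> smooth (\<lambda>x. f x + g x)"
  by (simp add: smooth_def continuously_differentiable_add)

lemma smooth_mult: "smooth f \<Longrightarrow> smooth g \<Longrightarrow> smooth (\<lambda>x. f x * g x)"
  by (simp add: smooth_def continuously_differentiable_mult)

lemma smooth_compose: "smooth F \<Longrightarrow> smooth h \<Longrightarrow> smooth (\<lambda>x. F (h x))" for F :: "real \<Rightarrow> real"
  by (simp add: smooth_def continuously_differentiable_compose)

lemma smooth_sum: "(\<And>i. i \<in> A \<Longrightarrow> smooth (f i)) \<Longrightarrow> smooth (\<lambda>x. \<Sum>i\<in>A. f i x)"
  by (induction A rule: infinite_finite_induct) (auto intro: smooth_add smooth_const)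

lemma smooth_prod: "(\<And>i. i \<in> A \<Longrightarrow> smooth (f i)) \<Longrightarrow> smooth (\<lambda>x. \<Prod>i\<in>A. f i x)"
  by (induction A rule: infinite_finite_induct) (auto intro: smooth_mult smooth_const)

lemma smooth_inner: "smooth (\<lambda>x. x \<bullet> v)"
  unfolding smooth_def
proof
  fix k show "continuously_differentiable k (\<lambda>x. x \<bullet> v)"
  proof (cases k)
    case (Suc m)
    have "GDERIV (\<lambda>x. x \<bullet> v) x :> v" for x
      unfolding gderiv_def by (auto intro!: derivative_eq_intros)
    then show ?thesis
      unfolding Suc by (rule continuously_differentiable_SucI) (rule continuously_differentiable_const)
  qed (auto intro!: continuous_intros)
qed

lemma smooth_diff: "smooth f \<Longrightarrow> smooth g \<Longrightarrow> smooth (\<lambda>x. f x - g x)"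
  using smooth_add[of f "\<lambda>x. - 1 * g x"] smooth_mult[OF smooth_const[of "- 1"], of g] by simp

lemma smooth_norm_square: "smooth (\<lambda>x. (norm (x - z))\<^sup>2)"
proof -
  have "(norm (x - z))\<^sup>2 = (\<Sum>i\<in>Basis. (x \<bullet> i - z \<bullet> i) * (x \<bullet> i - z \<bullet> i))" for x
    by (subst power2_norm_eq_inner, subst euclidean_inner, simp add: inner_diff_left)
  then show ?thesis
    by (auto intro!: smooth_sum smooth_mult smooth_diff smooth_inner smooth_const)
qed

lemma smooth_GDERIV: "smooth h \<Longrightarrow> GDERIV h x :> gradient h x"
  using continuously_differentiable_SucD(1)[of 0] smooth_def by blast

lemma smooth_gradient: "smooth h \<Longrightarrow> i \<in> Basis \<Longrightarrow> smooth (\<lambda>x. gradient h x \<bullet> i)"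
  using continuously_differentiable_SucD(2) smooth_def by blast

lemma smooth_continuous: "smooth h \<Longrightarrow> continuous_on A h"
  using continuously_differentiable_continuous[of 0 h] smooth_def continuous_on_subset by blast

lemma smooth_gradient_continuous: "smooth h \<Longrightarrow> continuous_on A (gradient h)"
  by (subst continuous_on_componentwise) (auto intro: smooth_continuous smooth_gradient)

lemma smooth_deriv:
  assumes "smooth F" shows "smooth (deriv F)" and "DERIV F t :> deriv F t"
proof -
  have "DERIV F s :> gradient F s" for s
    using smooth_GDERIV[OF assms, of s] by simp
  moreover then have "gradient F = deriv F"
    by (metis DERIV_imp_deriv ext)
  ultimately show "smooth (deriv F)" "DERIV F t :> deriv F t"
    using smooth_gradient[OF assms, of 1] by auto
qed

lemma smooth_compose_GDERIV:
  "smooth F \<Longrightarrow> smooth h \<Longrightarrow> GDERIV (\<lambda>x. F (h x)) x :> deriv F (h x) *\<^sub>R gradient h x"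
  by (rule GDERIV_DERIV_compose[OF smooth_GDERIV smooth_deriv(2)])

section \<open>Flat functions, plateaus and annular cutoffs\<close>

definition flat_exp_pow :: "nat \<Rightarrow> real \<Rightarrow> real" where
  "flat_exp_pow n t = (if t \<le> 0 then 0 else exp (- 1 / t) / t ^ n)"

lemma flat_exp_pow_tendsto: "(flat_exp_pow n \<longlongrightarrow> 0) (at 0)"
proof -
  have "((\<lambda>s. s ^ n / exp s) \<longlongrightarrow> (0::real)) at_top"
    by (rule tendsto_power_div_exp_0)
  then have "((\<lambda>t. (inverse t) ^ n / exp (inverse t)) \<longlongrightarrow> (0::real)) (at_right 0)"
    by (rule filterlim_compose) (rule filterlim_inverse_at_top_right)
  moreover have "\<forall>\<^sub>F t in at_right 0. (inverse t) ^ n / exp (inverse t) = flat_exp_pow n t"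
    by (auto simp: eventually_at_filter flat_exp_pow_def field_simps exp_minus)
  ultimately have "(flat_exp_pow n \<longlongrightarrow> 0) (at_right 0)"
    by (rule Lim_transform_eventually)
  moreover have "(flat_exp_pow n \<longlongrightarrow> 0) (at_left 0)"
    by (rule Lim_transform_eventually[OF tendsto_const])
      (auto simp: eventually_at_filter flat_exp_pow_def)
  ultimately show ?thesis by (simp add: filterlim_split_at)
qed

text \<open>The derivative is a combination of two members of the same family. This is why the power
  of t is carried along: smoothness of all members follows from one induction over the order with
  \<open>n\<close> arbitrary.\<close>

lemma flat_exp_pow_DERIV:
  "DERIV (flat_exp_pow n) t :> flat_exp_pow (n + 2) t - of_nat n * flat_exp_pow (n + 1) t"
proof (cases t "0::real" rule: linorder_cases)
  case less
  have "DERIV (\<lambda>_. 0) t :> 0" by simp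
  then have "DERIV (flat_exp_pow n) t :> 0"
    by (rule has_field_derivative_transform_within_open[where S = "{..<0}"])
      (use less in \<open>auto simp: flat_exp_pow_def\<close>)
  then show ?thesis using less by (simp add: flat_exp_pow_def)
next
  case equal
  \<comment> \<open>Off the origin the difference quotient at 0 is the next member of the family,
    whose limit at 0 is already known.\<close>
  have "((\<lambda>h. flat_exp_pow n h / h) \<longlongrightarrow> 0) (at 0)"
    by (rule Lim_transform_eventually[OF flat_exp_pow_tendsto[of "Suc n"]])
      (auto simp: eventually_at_filter flat_exp_pow_def)
  then show ?thesis using equal by (simp add: DERIV_def flat_exp_pow_def)
next
  case greater
  have "DERIV (\<lambda>s. exp (- 1 / s) / s ^ n) t :>
      ((exp (- 1 / t) * (1 / t\<^sup>2)) * t ^ n - exp (- 1 / t) * (of_nat n * t ^ (n - 1))) / (t ^ n * t ^ n)"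
    (is "(_ has_field_derivative ?E) _") using greater by (auto intro!: derivative_eq_intros simp: power2_eq_square field_simps)
  moreover have "?E = exp (- 1 / t) / t ^ (n + 2) - of_nat n * (exp (- 1 / t) / t ^ (n + 1))"
    (is "_ = ?D") using greater by (cases n) (auto simp: power2_eq_square field_simps)
  ultimately have "DERIV (\<lambda>s. exp (- 1 / s) / s ^ n) t :> ?D" by simp
  then have "DERIV (flat_exp_pow n) t :> ?D"
    by (rule has_field_derivative_transform_within_open[where S = "{0<..}"])
      (use greater in \<open>auto simp: flat_exp_pow_def\<close>)
  then show ?thesis using greater by (simp add: flat_exp_pow_def)
qed

lemma smooth_flat_exp_pow: "smooth (flat_exp_pow n)"
proof -
  have "continuously_differentiable k (flat_exp_pow n)" for k
  proof (induction k arbitrary: n)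
    case 0
    then show ?case
      using flat_exp_pow_DERIV DERIV_isCont continuous_at_imp_continuous_on
      by (metis continuously_differentiable.simps(1))
  next
    case (Suc k)
    have "continuously_differentiable k
       (\<lambda>t. flat_exp_pow (n + 2) t + (- of_nat n) * flat_exp_pow (n + 1) t)"
      by (intro continuously_differentiable_add continuously_differentiable_mult
          continuously_differentiable_const Suc)
    then show ?case
      by (intro continuously_differentiable_SucI[where
          D = "\<lambda>t. flat_exp_pow (n + 2) t - of_nat n * flat_exp_pow (n + 1) t"])
        (use flat_exp_pow_DERIV in auto)
  qed
  then show ?thesis by (simp add: smooth_def)
qed

definition flat_exp :: "real \<Rightarrow> real" where
  "flat_exp t = (if t \<le> 0 then 0 else exp (- 1 / t))"

lemma flat_exp_eq: "flat_exp = flat_exp_pow 0"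
  by (auto simp: flat_exp_def flat_exp_pow_def fun_eq_iff)

lemma smooth_flat_exp: "smooth flat_exp"
  by (simp add: flat_exp_eq smooth_flat_exp_pow)

lemma flat_exp_nonneg: "0 \<le> flat_exp t"
  by (simp add: flat_exp_def)

lemma flat_exp_mono: "s \<le> t \<Longrightarrow> flat_exp s \<le> flat_exp t"
  by (auto simp: flat_exp_def frac_le)

text \<open>At t = 0 the quotient is 0 / 0 = 0, which is the true derivative there, so one formula
  serves all t.\<close>

lemma flat_exp_DERIV: "DERIV flat_exp t :> flat_exp t / t\<^sup>2"
  using flat_exp_pow_DERIV[of 0 t] unfolding flat_exp_eq
  by (simp add: flat_exp_pow_def power2_eq_square split: if_splits)

text \<open>Composing \<open>flat_exp\<close> with itself produces plateaus, without integrating a bump function.\<close>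

definition smooth_step :: "real \<Rightarrow> real" where
  "smooth_step t = flat_exp (flat_exp 1 - flat_exp t) / flat_exp (flat_exp 1)"

lemma smooth_smooth_step: "smooth smooth_step"
proof -
  have "smooth (\<lambda>t. flat_exp (flat_exp 1 - flat_exp t) * (1 / flat_exp (flat_exp 1)))"
    by (intro smooth_mult smooth_const smooth_compose[OF smooth_flat_exp] smooth_diff smooth_flat_exp)
  then show ?thesis by (simp add: smooth_step_def[abs_def])
qed

lemma smooth_step_simps:
  "t \<le> 0 \<Longrightarrow> smooth_step t = 1" "1 \<le> t \<Longrightarrow> smooth_step t = 0"
  "0 \<le> smooth_step t" "smooth_step t \<le> 1"
proof -
  have pos: "0 < flat_exp (flat_exp 1)" by (simp add: flat_exp_def)
  show "t \<le> 0 \<Longrightarrow> smooth_step t = 1" using pos by (simp add: smooth_step_def flat_exp_def)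
  show "1 \<le> t \<Longrightarrow> smooth_step t = 0"
    using flat_exp_mono[of 1 t] by (simp add: smooth_step_def flat_exp_def)
  show "0 \<le> smooth_step t" using pos by (simp add: smooth_step_def flat_exp_nonneg)
  show "smooth_step t \<le> 1"
    using flat_exp_mono[of "flat_exp 1 - flat_exp t" "flat_exp 1"] flat_exp_nonneg[of t] pos
    by (simp add: smooth_step_def)
qed

text \<open>On the plateaus the values 1 and 0 are global extrema, so the derivative vanishes by the
  extremum criterion, also at the end points 0 and 1.\<close>

lemma smooth_step_deriv_zero:
  assumes "t \<le> 0 \<or> 1 \<le> t"
  shows "deriv smooth_step t = 0"
  using assms
proof
  assume "t \<le> 0"
  then have "\<forall>s. \<bar>t - s\<bar> < 1 \<longrightarrow> smooth_step s \<le> smooth_step t"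
    by (simp add: smooth_step_simps)
  then show ?thesis
    by (rule DERIV_local_max[OF smooth_deriv(2)[OF smooth_smooth_step] zero_less_one])
next
  assume "1 \<le> t"
  then have "\<forall>s. \<bar>t - s\<bar> < 1 \<longrightarrow> smooth_step t \<le> smooth_step s"
    by (simp add: smooth_step_simps)
  then show ?thesis
    by (rule DERIV_local_min[OF smooth_deriv(2)[OF smooth_smooth_step] zero_less_one])
qed

lemma smooth_step_deriv_bounded:
  obtains C where "C > 0" "\<And>t. \<bar>deriv smooth_step t\<bar> \<le> C"
proof -
  have "compact (deriv smooth_step ` {0..1})"
    by (intro compact_continuous_image smooth_continuous smooth_deriv(1) smooth_smooth_step compact_Icc)
  then obtain C where C: "\<And>t. t \<in> {0..1} \<Longrightarrow> \<bar>deriv smooth_step t\<bar> \<le> C"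
    using compact_imp_bounded bounded_iff by (metis image_eqI real_norm_def)
  have "\<bar>deriv smooth_step t\<bar> \<le> max C 1" for t
    using C[of t] smooth_step_deriv_zero[of t] by (cases "t \<in> {0..1}") (auto simp: le_max_iff_disj)
  then show ?thesis by (intro that[of "max C 1"]) auto
qed

text \<open>The squared distance is interpolated instead of the distance: it is a polynomial, so
  smoothness at the centre \<open>z\<close> needs no separate argument.\<close>

definition annulus_cutoff :: "'a::euclidean_space \<Rightarrow> real \<Rightarrow> real \<Rightarrow> 'a \<Rightarrow> real" where
  "annulus_cutoff z s t x = smooth_step (((norm (x - z))\<^sup>2 - s\<^sup>2) / (t\<^sup>2 - s\<^sup>2))"

lemma annulus_cutoff_GDERIV:
  "GDERIV (annulus_cutoff z s t) x :>
    (deriv smooth_step (((norm (x - z))\<^sup>2 - s\<^sup>2) / (t\<^sup>2 - s\<^sup>2)) * (2 / (t\<^sup>2 - s\<^sup>2))) *\<^sub>R (x - z)"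
proof -
  have "GDERIV (\<lambda>x. ((norm (x - z))\<^sup>2 - s\<^sup>2) / (t\<^sup>2 - s\<^sup>2)) x :> (2 / (t\<^sup>2 - s\<^sup>2)) *\<^sub>R (x - z)"
    unfolding gderiv_def power2_norm_eq_inner divide_inverse
    by (auto intro!: derivative_eq_intros simp: inner_commute fun_eq_iff)
  from GDERIV_DERIV_compose[OF this smooth_deriv(2)[OF smooth_smooth_step]]
  show ?thesis by (simp add: annulus_cutoff_def[abs_def])
qed

lemma annulus_cutoff:
  assumes "0 < s" "s < t"
  shows "smooth (annulus_cutoff z s t)"
    and "0 \<le> annulus_cutoff z s t x" and "annulus_cutoff z s t x \<le> 1"
    and "dist z x \<le> s \<Longrightarrow> annulus_cutoff z s t x = 1"
    and "t \<le> dist z x \<Longrightarrow> annulus_cutoff z s t x = 0"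
    and "dist z x \<le> s \<Longrightarrow> gradient (annulus_cutoff z s t) x = 0"
    and "t \<le> dist z x \<Longrightarrow> gradient (annulus_cutoff z s t) x = 0"
proof -
  have pos: "0 < t\<^sup>2 - s\<^sup>2" using assms by (simp add: power_strict_mono)
  have "smooth (\<lambda>x. smooth_step (((norm (x - z))\<^sup>2 - s\<^sup>2) * (1 / (t\<^sup>2 - s\<^sup>2))))"
    by (intro smooth_compose[OF smooth_smooth_step] smooth_mult smooth_diff smooth_norm_square smooth_const)
  then show "smooth (annulus_cutoff z s t)" by (simp add: annulus_cutoff_def[abs_def])
  show "0 \<le> annulus_cutoff z s t x" "annulus_cutoff z s t x \<le> 1"
    by (simp_all add: annulus_cutoff_def smooth_step_simps)
  have inner: "((norm (x - z))\<^sup>2 - s\<^sup>2) / (t\<^sup>2 - s\<^sup>2) \<le> 0" if "dist z x \<le> s"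
  proof -
    have "(norm (x - z))\<^sup>2 \<le> s\<^sup>2"
      using that by (intro power_mono) (auto simp: dist_norm norm_minus_commute)
    then show ?thesis using pos by (auto simp: divide_nonpos_pos)
  qed
  have outer: "1 \<le> ((norm (x - z))\<^sup>2 - s\<^sup>2) / (t\<^sup>2 - s\<^sup>2)" if "t \<le> dist z x"
  proof -
    have "t\<^sup>2 \<le> (norm (x - z))\<^sup>2"
      using that assms by (intro power_mono) (auto simp: dist_norm norm_minus_commute)
    then show ?thesis using pos by auto
  qed
  show "dist z x \<le> s \<Longrightarrow> annulus_cutoff z s t x = 1" "t \<le> dist z x \<Longrightarrow> annulus_cutoff z s t x = 0"
    using inner outer by (simp_all add: annulus_cutoff_def smooth_step_simps)
  show "dist z x \<le> s \<Longrightarrow> gradient (annulus_cutoff z s t) x = 0"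
    "t \<le> dist z x \<Longrightarrow> gradient (annulus_cutoff z s t) x = 0"
    unfolding gradient_eqI[OF annulus_cutoff_GDERIV] using inner outer by (simp_all add: smooth_step_deriv_zero)
qed

text \<open>The chain rule produces the factor 2 |x - z| / (t^2 - s^2). Inside the outer ball |x -
  z| <= t, and 2 t / ((t - s) (t + s)) <= 2 / (t - s); outside it the gradient is zero.\<close>

lemma annulus_cutoff_gradient_bound:
  obtains C where "C > 0"
    "\<And>(z::'a::euclidean_space) s t x. 0 < s \<Longrightarrow> s < t \<Longrightarrow>
      norm (gradient (annulus_cutoff z s t) x) \<le> C / (t - s)"
proof -
  obtain C where C: "C > 0" "\<And>t. \<bar>deriv smooth_step t\<bar> \<le> C"
    using smooth_step_deriv_bounded by blast
  have "norm (gradient (annulus_cutoff z s t) x) \<le> 2 * C / (t - s)"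
    if st: "0 < s" "s < t" for z :: 'a and s t x
  proof (cases "t < dist z x")
    case True
    then show ?thesis using annulus_cutoff(7)[OF st less_imp_le[OF True]] C st by simp
  next
    case False
    have pos: "0 < t\<^sup>2 - s\<^sup>2" using st by (simp add: power_strict_mono)
    have "norm (x - z) \<le> t" using False by (simp add: dist_norm norm_minus_commute)
    moreover have "\<bar>2 / (t\<^sup>2 - s\<^sup>2)\<bar> = 2 / (t\<^sup>2 - s\<^sup>2)" using pos by simp
    moreover have "0 \<le> 2 / (t\<^sup>2 - s\<^sup>2)" using pos by simp
    ultimately have "norm (gradient (annulus_cutoff z s t) x) \<le> (C * (2 / (t\<^sup>2 - s\<^sup>2))) * t"
      unfolding gradient_eqI[OF annulus_cutoff_GDERIV] norm_scaleR abs_mult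
      using C by (intro mult_mono) (simp_all add: less_imp_le)
    also have "\<dots> = (2 * C / (t - s)) * (t / (t + s))"
    proof -
      have "t\<^sup>2 - s\<^sup>2 = (t - s) * (t + s)" by (simp add: power2_eq_square algebra_simps)
      then show ?thesis by simp
    qed
    also have "\<dots> \<le> (2 * C / (t - s)) * 1"
      using st C by (intro mult_left_mono) auto
    finally show ?thesis by simp
  qed
  then show ?thesis using C(1) that[of "2 * C"] by simp
qed

section \<open>Test functions and the weak gradient\<close>

lemma test_functionsI:
  assumes "smooth h" "compact K" "K \<subseteq> U" "\<And>x. x \<notin> K \<Longrightarrow> h x = 0"
  shows "h \<in> test_functions U"
proof -
  have "closure {x. h x \<noteq> 0} \<subseteq> K"
    using assms by (intro closure_minimal) (auto intro: compact_imp_closed)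
  moreover then have "compact (closure {x. h x \<noteq> 0})"
    using assms(2) compact_closure by (metis bounded_subset closure_closure compact_imp_bounded)
  ultimately show ?thesis using assms unfolding test_functions_def smooth_def by blast
qed

lemma test_functionsE:
  assumes "h \<in> test_functions U"
  obtains K where "compact K" "K \<subseteq> U" "\<And>x. x \<notin> K \<Longrightarrow> h x = 0" "\<And>x. x \<notin> K \<Longrightarrow> gradient h x = 0"
proof -
  define K where "K = closure {x. h x \<noteq> 0}"
  have K: "compact K" "K \<subseteq> U" using assms unfolding test_functions_def K_def by blast+
  have z: "h x = 0" if "x \<notin> K" for x 
    using that closure_subset[of "{x. h x \<noteq> 0}"] unfolding K_def by auto
  have "gradient h x = 0" if "x \<notin> K" for x
  proof (rule gradient_eqI)
    have "((\<lambda>_. 0) has_derivative (\<lambda>_. 0)) (at x)" by simp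
    then have "(h has_derivative (\<lambda>_. 0)) (at x)"
      by (rule has_derivative_transform_within_open[where s = "- K"])
        (use that K(1) z in \<open>auto simp: compact_imp_closed open_Compl\<close>)
    then show "GDERIV h x :> 0" by (simp add: gderiv_def)
  qed
  with K z show thesis by (rule that)
qed

lemma test_functions_smooth: "h \<in> test_functions U \<Longrightarrow> smooth h"
  by (simp add: test_functions_def smooth_def)

lemma test_functions_outside:
  assumes "h \<in> test_functions U" "x \<notin> U"
  shows "h x = 0" "gradient h x = 0"
proof -
  obtain K where "K \<subseteq> U" "\<And>x. x \<notin> K \<Longrightarrow> h x = 0" "\<And>x. x \<notin> K \<Longrightarrow> gradient h x = 0"
    by (rule test_functionsE[OF assms(1)]) blast
  with assms(2) show "h x = 0" "gradient h x = 0" by blast+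
qed

lemma test_functions_mult:
  assumes "smooth f" "h \<in> test_functions U"
  shows "(\<lambda>x. f x * h x) \<in> test_functions U"
proof (rule test_functionsE[OF assms(2)])
  fix K assume K: "compact K" "K \<subseteq> U" "\<And>x. x \<notin> K \<Longrightarrow> h x = 0"
  show ?thesis
    by (rule test_functionsI[OF smooth_mult[OF assms(1) test_functions_smooth[OF assms(2)]] K(1,2)])
      (simp add: K(3))
qed

lemma test_functions_compose:
  fixes F :: "real \<Rightarrow> real"
  assumes "smooth F" "F 0 = 0" "h \<in> test_functions U"
  shows "(\<lambda>x. F (h x)) \<in> test_functions U"
proof (rule test_functionsE[OF assms(3)])
  fix K assume K: "compact K" "K \<subseteq> U" "\<And>x. x \<notin> K \<Longrightarrow> h x = 0"
  show ?thesis
    by (rule test_functionsI[OF smooth_compose[OF assms(1) test_functions_smooth[OF assms(3)]] K(1,2)])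
      (simp add: K(3) assms(2))
qed

lemma test_functions_bounded:
  assumes "h \<in> test_functions U"
  obtains B where "B > 0" "\<And>x. \<bar>h x\<bar> \<le> B" "\<And>x. norm (gradient h x) \<le> B"
proof (rule test_functionsE[OF assms])
  fix K assume K: "compact K" "\<And>x. x \<notin> K \<Longrightarrow> h x = 0" "\<And>x. x \<notin> K \<Longrightarrow> gradient h x = 0"
  have "compact (h ` K)" "compact (gradient h ` K)"
    using K(1) test_functions_smooth[OF assms]
    by (auto intro!: compact_continuous_image smooth_continuous smooth_gradient_continuous)
  then have "bounded (h ` K)" "bounded (gradient h ` K)"
    using compact_imp_bounded by blast+
  then obtain b c where "\<And>x. x \<in> K \<Longrightarrow> \<bar>h x\<bar> \<le> b" "\<And>x. x \<in> K \<Longrightarrow> norm (gradient h x) \<le> c"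
    unfolding bounded_iff by auto
  then have "\<bar>h x\<bar> \<le> max 1 (max b c)" "norm (gradient h x) \<le> max 1 (max b c)" for x
    using K(2,3)[of x] by (cases "x \<in> K"; force simp: le_max_iff_disj)+
  then show thesis by (intro that[of "max 1 (max b c)"]) auto
qed

section \<open>From integrals over the domain to Borel integrals, and integration by parts\<close>

lemma integrable_continuous_compact_support:
  fixes f :: "'a::euclidean_space \<Rightarrow> real"
  assumes "continuous_on UNIV f" "compact K" "\<And>x. x \<notin> K \<Longrightarrow> f x = 0"
  shows "integrable lborel f"
proof -
  have "integrable lborel (\<lambda>x. indicator K x *\<^sub>R f x)"
    using assms by (intro borel_integrable_compact) (auto intro: continuous_on_subset)
  also have "(\<lambda>x. indicator K x *\<^sub>R f x) = f"
    using assms(3) by (auto simp: indicator_def fun_eq_iff)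
  finally show ?thesis .
qed

text \<open>Sobolev spaces live on \<open>lebesgue_on U\<close>, whereas translation invariance and
  Tonelli are used on \<open>lborel\<close>. For Borel functions vanishing off \<open>U\<close>,
  test functions in particular, this is the bridge.\<close>

lemma integral_lebesgue_on_eq_lborel:
  fixes f :: "'a::euclidean_space \<Rightarrow> real"
  assumes "f \<in> borel_measurable borel" "open U" "\<And>x. x \<notin> U \<Longrightarrow> f x = 0"
  shows "integral\<^sup>L (lebesgue_on U) f = integral\<^sup>L lborel f"
    and "integrable (lebesgue_on U) f \<longleftrightarrow> integrable lborel f"
proof -
  have eq: "(\<lambda>x. indicator U x *\<^sub>R f x) = f"
    using assms(3) by (auto simp: indicator_def fun_eq_iff)
  have U: "U \<inter> space lebesgue \<in> sets lebesgue" and f: "f \<in> borel_measurable lborel"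
    using assms(1,2) by auto
  show "integral\<^sup>L (lebesgue_on U) f = integral\<^sup>L lborel f"
    unfolding integral_restrict_space[OF U] eq by (rule integral_completion[OF f])
  show "integrable (lebesgue_on U) f \<longleftrightarrow> integrable lborel f"
    unfolding integrable_restrict_space[OF U] eq by (rule integrable_completion[OF f])
qed

lemma test_functions_measurable:
  assumes "h \<in> test_functions U"
  shows "h \<in> borel_measurable borel" "gradient h \<in> borel_measurable borel"
    and "h \<in> borel_measurable (lebesgue_on U)" "gradient h \<in> borel_measurable (lebesgue_on U)"
proof -
  have c: "continuous_on UNIV h" "continuous_on UNIV (gradient h)"
    using test_functions_smooth[OF assms] smooth_continuous smooth_gradient_continuous by blast+
  then show b: "h \<in> borel_measurable borel" "gradient h \<in> borel_measurable borel"
    by (auto intro: borel_measurable_continuous_onI)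
  then have "h \<in> borel_measurable lebesgue" "gradient h \<in> borel_measurable lebesgue"
    by (auto intro: measurable_completion)
  then show "h \<in> borel_measurable (lebesgue_on U)" "gradient h \<in> borel_measurable (lebesgue_on U)"
    by (auto intro: measurable_restrict_space1)
qed

lemma test_functions_square_integrable:
  assumes "h \<in> test_functions U" "open U"
  shows "square_integrable U h" "square_integrable U (gradient h)"
proof -
  obtain K where K: "compact K" "\<And>x. x \<notin> K \<Longrightarrow> h x = 0" "\<And>x. x \<notin> K \<Longrightarrow> gradient h x = 0"
    by (rule test_functionsE[OF assms(1)]) blast
  have c: "continuous_on UNIV (\<lambda>x. (norm (h x))\<^sup>2)" "continuous_on UNIV (\<lambda>x. (norm (gradient h x))\<^sup>2)"
    using test_functions_smooth[OF assms(1)]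
    by (intro continuous_on_power continuous_on_norm smooth_continuous smooth_gradient_continuous;
        assumption)+
  have "integrable lborel (\<lambda>x. (norm (h x))\<^sup>2)" "integrable lborel (\<lambda>x. (norm (gradient h x))\<^sup>2)"
    using K c by (auto intro: integrable_continuous_compact_support)
  then have "integrable (lebesgue_on U) (\<lambda>x. (norm (h x))\<^sup>2)"
    "integrable (lebesgue_on U) (\<lambda>x. (norm (gradient h x))\<^sup>2)"
    using c test_functions_outside[OF assms(1)] assms(2)
    by (simp_all add: integral_lebesgue_on_eq_lborel(2) borel_measurable_continuous_onI)
  then show "square_integrable U h" "square_integrable U (gradient h)"
    using test_functions_measurable[OF assms(1)] by (auto simp: square_integrable_def)
qed

lemma GDERIV_lipschitz:
  assumes "\<And>x. GDERIV h x :> D x" "\<And>x. norm (D x) \<le> B"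
  shows "\<bar>h x - h y\<bar> \<le> B * norm (x - y)"
proof -
  have "norm (h x - h y) \<le> B * norm (x - y)"
  proof (rule differentiable_bound[of UNIV])
    show "(h has_derivative (\<lambda>v. v \<bullet> D x)) (at x within UNIV)" for x
      using assms(1)[of x] by (simp add: gderiv_def)
    show "onorm (\<lambda>v. v \<bullet> D x) \<le> B" for x
    proof (rule onorm_bound)
      show "0 \<le> B" using assms(2)[of x] norm_ge_zero order_trans by blast
      fix v
      have "norm (v \<bullet> D x) \<le> norm v * norm (D x)" using Cauchy_Schwarz_ineq2[of v "D x"] by simp
      also have "\<dots> \<le> norm v * B" using assms(2) by (intro mult_left_mono) auto
      finally show "norm (v \<bullet> D x) \<le> B * norm v" by (simp add: mult.commute)
    qed
  qed auto
  then show ?thesis by simp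
qed

text \<open>Translation invariance makes the integral of every difference quotient vanish.\<close>

lemma integral_gradient_eq_0:
  assumes h: "h \<in> test_functions U" and i: "i \<in> Basis"
  shows "(\<integral>x. gradient h x \<bullet> i \<partial>lborel) = 0"
proof -
  obtain K where K: "compact K" "\<And>x. x \<notin> K \<Longrightarrow> h x = 0"
    by (rule test_functionsE[OF h]) blast
  obtain R where R: "\<And>x. x \<in> K \<Longrightarrow> norm x \<le> R"
    using compact_imp_bounded[OF K(1)] bounded_iff by blast
  obtain B where B: "B > 0" "\<And>x. norm (gradient h x) \<le> B"
    using test_functions_bounded[OF h] by metis
  have sm: "smooth h" by (rule test_functions_smooth[OF h])
  have cont: "continuous_on UNIV h" by (rule smooth_continuous[OF sm])
  have hm [measurable]: "h \<in> borel_measurable borel" by (rule test_functions_measurable[OF h])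
  have int: "integrable lborel h"
    using integrable_continuous_compact_support[OF cont K] .
  define t where "t n = inverse (real (Suc n))" for n
  have t: "t n > 0" "t n \<le> 1" for n by (auto simp: t_def divide_simps)
  define Q where "Q n x = (h (t n *\<^sub>R i + x) - h x) / t n" for n x
  have dist: "distr lborel borel ((+) (t n *\<^sub>R i)) = lborel" for n by (rule lborel_distr_plus)
  have shift: "integrable lborel (\<lambda>x. h (t n *\<^sub>R i + x))"
      "(\<integral>x. h (t n *\<^sub>R i + x) \<partial>lborel) = (\<integral>x. h x \<partial>lborel)" for n
    using integrable_distr_eq[of "(+) (t n *\<^sub>R i)" lborel borel h]
      integral_distr[of "(+) (t n *\<^sub>R i)" lborel borel h] int
    unfolding dist by simp_all
  then have Q0: "(\<integral>x. Q n x \<partial>lborel) = 0" for n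
    unfolding Q_def by (simp add: int)
  have "(\<lambda>n. \<integral>x. Q n x \<partial>lborel) \<longlonglongrightarrow> (\<integral>x. gradient h x \<bullet> i \<partial>lborel)"
  proof (rule integral_dominated_convergence)
    show "(\<lambda>x. gradient h x \<bullet> i) \<in> borel_measurable lborel"
      using test_functions_measurable(2)[OF h] by simp
    show "Q n \<in> borel_measurable lborel" for n unfolding Q_def by measurable
    \<comment> \<open>The step \<open>t n\<close> is at most 1, so every difference quotient
      vanishes outside the ball of radius R + 1; inside it the Lipschitz constant B
      dominates.\<close>
    show "integrable lborel (\<lambda>x. B * indicator (cball 0 (R + 1)) x)"
      by (intro integrable_mult_right integrable_real_indicator emeasure_bounded_finite) auto
    show "AE x in lborel. norm (Q n x) \<le> B * indicator (cball 0 (R + 1)) x" for n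
    proof (intro AE_I2)
      fix x
      show "norm (Q n x) \<le> B * indicator (cball 0 (R + 1)) x"
      proof (cases "norm x \<le> R + 1")
        case True
        have "\<bar>h (t n *\<^sub>R i + x) - h x\<bar> \<le> B * norm ((t n *\<^sub>R i + x) - x)"
          by (rule GDERIV_lipschitz[OF smooth_GDERIV[OF sm] B(2)])
        also have "\<dots> = B * t n" using t(1)[of n] i by simp
        finally show ?thesis using t(1)[of n] True by (simp add: Q_def divide_simps)
      next
        case False
        have "norm x \<le> norm (t n *\<^sub>R i + x) + norm (t n *\<^sub>R i)"
          using norm_triangle_ineq4[of "t n *\<^sub>R i + x" "t n *\<^sub>R i"] by simp
        moreover have "norm (t n *\<^sub>R i) \<le> 1" using t[of n] i by simp
        ultimately have "norm (t n *\<^sub>R i + x) > R" "norm x > R" using False by linarith+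
        then have "h (t n *\<^sub>R i + x) = 0" "h x = 0" using R K(2) by (meson leD)+
        then show ?thesis using False by (simp add: Q_def)
      qed
    qed
    show "AE x in lborel. (\<lambda>n. Q n x) \<longlonglongrightarrow> gradient h x \<bullet> i"
    proof (intro AE_I2)
      fix x
      have "((\<lambda>s. h (x + s *\<^sub>R i)) has_derivative (\<lambda>s. (s *\<^sub>R i) \<bullet> gradient h x)) (at 0)"
        using smooth_GDERIV[OF sm, of "x + 0 *\<^sub>R i"] unfolding gderiv_def
        by (intro has_derivative_compose[where g = h and f = "\<lambda>s. x + s *\<^sub>R i"])
          (auto intro!: derivative_eq_intros)
      then have "DERIV (\<lambda>s. h (x + s *\<^sub>R i)) 0 :> gradient h x \<bullet> i"
        by (simp add: has_field_derivative_def inner_commute mult.commute[of _ "_ \<bullet> _"] mult_commute_abs)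
      then have "((\<lambda>s. (h (x + s *\<^sub>R i) - h x) / s) \<longlongrightarrow> gradient h x \<bullet> i) (at 0)"
        by (simp add: DERIV_def)
      moreover have "filterlim t (at 0) sequentially"
        unfolding filterlim_at t_def using LIMSEQ_inverse_real_of_nat by auto
      ultimately have "((\<lambda>n. (h (x + t n *\<^sub>R i) - h x) / t n) \<longlonglongrightarrow> gradient h x \<bullet> i)"
        by (rule filterlim_compose)
      then show "(\<lambda>n. Q n x) \<longlonglongrightarrow> gradient h x \<bullet> i" by (simp add: Q_def add.commute)
    qed
  qed
  then show ?thesis by (simp add: Q0 LIMSEQ_const_iff)
qed

lemma square_integrable_inner:
  assumes "square_integrable U f" "square_integrable U g"
  shows "integrable (lebesgue_on U) (\<lambda>x. f x \<bullet> g x)"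
proof (rule Bochner_Integration.integrable_bound)
  show "integrable (lebesgue_on U) (\<lambda>x. (norm (f x))\<^sup>2 + (norm (g x))\<^sup>2)"
    using assms by (simp add: square_integrable_def)
  show "(\<lambda>x. f x \<bullet> g x) \<in> borel_measurable (lebesgue_on U)"
    using assms by (auto simp: square_integrable_def)
  have "norm (f x \<bullet> g x) \<le> norm ((norm (f x))\<^sup>2 + (norm (g x))\<^sup>2)" for x
  proof -
    have "\<bar>f x \<bullet> g x\<bar> \<le> norm (f x) * norm (g x)" by (rule Cauchy_Schwarz_ineq2)
    also have "\<dots> \<le> (norm (f x))\<^sup>2 + (norm (g x))\<^sup>2"
      using sum_squares_bound[of "norm (f x)" "norm (g x)"] by (auto intro: order_trans[rotated])
    finally show ?thesis by simp
  qed
  then show "AE x in lebesgue_on U. norm (f x \<bullet> g x) \<le> norm ((norm (f x))\<^sup>2 + (norm (g x))\<^sup>2)" by simp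
qed

lemma square_integrable_mult:
  fixes f g :: "'a::euclidean_space \<Rightarrow> real"
  shows "square_integrable U f \<Longrightarrow> square_integrable U g \<Longrightarrow>
    integrable (lebesgue_on U) (\<lambda>x. f x * g x)"
  using square_integrable_inner[of U f g] by simp

lemma square_integrable_component:
  assumes "square_integrable U G"
  shows "square_integrable U (\<lambda>x. G x \<bullet> i)"
  unfolding square_integrable_def
proof
  show m: "(\<lambda>x. G x \<bullet> i) \<in> borel_measurable (lebesgue_on U)"
    using assms by (auto simp: square_integrable_def)
  show "integrable (lebesgue_on U) (\<lambda>x. (norm (G x \<bullet> i))\<^sup>2)"
  proof (rule Bochner_Integration.integrable_bound)
    show "integrable (lebesgue_on U) (\<lambda>x. (norm (G x))\<^sup>2 * (norm i)\<^sup>2)"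
      using assms by (simp add: square_integrable_def)
    show "(\<lambda>x. (norm (G x \<bullet> i))\<^sup>2) \<in> borel_measurable (lebesgue_on U)" using m by simp
    have "(norm (G x \<bullet> i))\<^sup>2 \<le> (norm (G x))\<^sup>2 * (norm i)\<^sup>2" for x
      using Cauchy_Schwarz_ineq2[of "G x" i] by (simp add: abs_le_square_iff[symmetric] power_mult_distrib[symmetric] power_mono)
    then show "AE x in lebesgue_on U. norm ((norm (G x \<bullet> i))\<^sup>2) \<le> norm ((norm (G x))\<^sup>2 * (norm i)\<^sup>2)"
      by simp
  qed
qed

text \<open>The product of the two functions is again a test function, and the integral of each
  component of its gradient vanishes.\<close>

lemma integration_by_parts_test:
  assumes "open U" "f \<in> test_functions U" "h \<in> test_functions U" "i \<in> Basis"
  shows "(LINT x|lebesgue_on U. f x * (gradient h x \<bullet> i)) = - (LINT x|lebesgue_on U. (gradient f x \<bullet> i) * h x)"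
proof -
  have sm: "smooth f" "smooth h" using assms test_functions_smooth by auto
  have p: "(\<lambda>x. f x * h x) \<in> test_functions U"
    using test_functions_mult[OF sm(1) assms(3)] .
  have g: "gradient (\<lambda>x. f x * h x) x \<bullet> i = f x * (gradient h x \<bullet> i) + (gradient f x \<bullet> i) * h x" for x
    using gradient_eqI[OF GDERIV_mult[OF smooth_GDERIV[OF sm(1)] smooth_GDERIV[OF sm(2)]]]
    by (simp add: inner_add_left)
  have "0 = (\<integral>x. gradient (\<lambda>x. f x * h x) x \<bullet> i \<partial>lborel)"
    using integral_gradient_eq_0[OF p assms(4)] by simp
  also have "\<dots> = (LINT x|lebesgue_on U. gradient (\<lambda>x. f x * h x) x \<bullet> i)"
    by (rule integral_lebesgue_on_eq_lborel(1)[symmetric])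
      (use test_functions_measurable(2)[OF p] test_functions_outside[OF p] assms(1) in auto)
  also have "\<dots> = (LINT x|lebesgue_on U. f x * (gradient h x \<bullet> i)) + (LINT x|lebesgue_on U. (gradient f x \<bullet> i) * h x)"
    unfolding g
    by (intro Bochner_Integration.integral_add square_integrable_mult square_integrable_component
        test_functions_square_integrable assms)
  finally show ?thesis by simp
qed

text \<open>Test functions approximate the indicators of boxes, and boxes generate the Borel sets.\<close>

lemma flat_exp_tendsto_indicator: "(\<lambda>n. flat_exp (real n * s - 1)) \<longlonglongrightarrow> (if 0 < s then 1 else 0)"
proof (cases "0 < s")
  case True
  have "filterlim (\<lambda>n. real n * s - 1) at_top sequentially"
  proof -
    have "filterlim (\<lambda>n. s * real n) at_top sequentially"
      by (rule filterlim_tendsto_pos_mult_at_top[OF tendsto_const True filterlim_real_sequentially])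
    from filterlim_tendsto_add_at_top[OF tendsto_const[of "- 1"] this]
    show ?thesis by (simp add: algebra_simps)
  qed
  then have lim: "(\<lambda>n. exp (- inverse (real n * s - 1))) \<longlonglongrightarrow> exp (- 0)"
    by (rule tendsto_exp[OF tendsto_minus[OF tendsto_inverse_0_at_top]])
  have "\<forall>\<^sub>F n in sequentially. real n * s - 1 > 0"
    using \<open>filterlim (\<lambda>n. real n * s - 1) at_top sequentially\<close> by (rule filterlim_at_top_dense[THEN iffD1, rule_format])
  then have "\<forall>\<^sub>F n in sequentially. exp (- inverse (real n * s - 1)) = flat_exp (real n * s - 1)"
    by eventually_elim (simp add: flat_exp_def divide_inverse)
  from Lim_transform_eventually[OF lim this] True show ?thesis by simp
next
  case False
  then have "flat_exp (real n * s - 1) = 0" for n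
    using mult_nonneg_nonpos[of "real n" s] by (simp add: flat_exp_def)
  with False show ?thesis by simp
qed

lemma flat_exp_le_1: "flat_exp t \<le> 1"
  by (simp add: flat_exp_def)

lemma du_Bois_Reymond_box:
  fixes D :: "'a::euclidean_space \<Rightarrow> real"
  assumes U: "open U" "D \<in> borel_measurable (lebesgue_on U)"
    and zero: "\<And>h. h \<in> test_functions U \<Longrightarrow> (LINT x|lebesgue_on U. D x * h x) = 0"
    and box: "box p q \<subseteq> U" "integrable (lebesgue_on U) (\<lambda>x. D x * indicator (box p q) x)"
  shows "(LINT x|lebesgue_on U. D x * indicator (box p q) x) = 0"
proof (cases "box p q = {}")
  case False
  then have pq: "\<And>i. i \<in> Basis \<Longrightarrow> p \<bullet> i < q \<bullet> i" by (simp add: box_ne_empty)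
  \<comment> \<open>The product of the two coordinate differences is positive exactly when the
    coordinate lies strictly between the faces. Subtracting 1 confines the support to a compact
    subset of the open box, and scaling by n pushes the values to 1 inside it, since
    \<open>flat_exp\<close> tends to 1 at infinity.\<close>
  define h where "h n x = (\<Prod>i\<in>Basis. flat_exp (real n * ((x \<bullet> i - p \<bullet> i) * (q \<bullet> i - x \<bullet> i)) - 1))"
    for n x
  have sgn: "0 < (x \<bullet> i - p \<bullet> i) * (q \<bullet> i - x \<bullet> i) \<longleftrightarrow> p \<bullet> i < x \<bullet> i \<and> x \<bullet> i < q \<bullet> i"
    if "i \<in> Basis" for i x
    using pq[OF that] by (auto simp: zero_less_mult_iff)
  have lim: "(\<lambda>n. h n x) \<longlonglongrightarrow> indicator (box p q) x" for x
  proof -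
    have "(\<lambda>n. h n x) \<longlonglongrightarrow>
        (\<Prod>i\<in>Basis. if 0 < (x \<bullet> i - p \<bullet> i) * (q \<bullet> i - x \<bullet> i) then 1 else 0)"
      unfolding h_def by (intro tendsto_prod flat_exp_tendsto_indicator)
    also have "(\<Prod>i\<in>Basis. if 0 < (x \<bullet> i - p \<bullet> i) * (q \<bullet> i - x \<bullet> i) then 1 else 0)
        = (indicator (box p q) x :: real)"
    proof (cases "x \<in> box p q")
      case True
      then show ?thesis by (auto simp: sgn mem_box intro!: prod.neutral)
    next
      case False
      then obtain i where "i \<in> Basis" "\<not> (p \<bullet> i < x \<bullet> i \<and> x \<bullet> i < q \<bullet> i)"
        by (auto simp: mem_box)
      then show ?thesis using False by (auto simp: sgn intro!: prod_zero bexI[of _ i])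
    qed
    finally show ?thesis .
  qed
  have nz: "x \<in> box p q" if "h n x \<noteq> 0" for n x
  proof -
    have "0 < real n * ((x \<bullet> i - p \<bullet> i) * (q \<bullet> i - x \<bullet> i)) - 1" if "i \<in> Basis" for i
      using \<open>h n x \<noteq> 0\<close> that by (auto simp: h_def flat_exp_def split: if_splits)
    then have "0 < real n * ((x \<bullet> i - p \<bullet> i) * (q \<bullet> i - x \<bullet> i))" if "i \<in> Basis" for i
      using that by force
    then have "0 < (x \<bullet> i - p \<bullet> i) * (q \<bullet> i - x \<bullet> i)" if "i \<in> Basis" for i
      using that by (simp add: zero_less_mult_iff)
    then show ?thesis by (simp add: sgn mem_box)
  qed
  have test: "h n \<in> test_functions U" for n
  proof (rule test_functionsI)
    let ?K = "cbox p q \<inter> (\<Inter>i\<in>Basis. {x. 1 \<le> real n * ((x \<bullet> i - p \<bullet> i) * (q \<bullet> i - x \<bullet> i))})"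
    show "smooth (h n)"
      unfolding h_def by (intro smooth_prod smooth_compose[OF smooth_flat_exp] smooth_diff smooth_mult
          smooth_inner smooth_const)
    show "compact ?K"
      by (intro compact_Int_closed compact_cbox closed_INT ballI closed_Collect_le continuous_intros)
    show "?K \<subseteq> U"
    proof
      fix x assume x: "x \<in> ?K"
      have "0 < (x \<bullet> i - p \<bullet> i) * (q \<bullet> i - x \<bullet> i)" if "i \<in> Basis" for i
      proof -
        have "0 < real n * ((x \<bullet> i - p \<bullet> i) * (q \<bullet> i - x \<bullet> i))" using x that by force
        then show ?thesis by (simp add: zero_less_mult_iff)
      qed
      then show "x \<in> U" using box(1) by (auto simp: sgn mem_box)
    qed
    fix x assume x: "x \<notin> ?K"
    show "h n x = 0"
    proof (cases "x \<in> box p q")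
      case True
      then obtain i where "i \<in> Basis" "\<not> 1 \<le> real n * ((x \<bullet> i - p \<bullet> i) * (q \<bullet> i - x \<bullet> i))"
        using x box_subset_cbox by auto
      then show ?thesis
        unfolding h_def by (intro prod_zero bexI[of _ i]) (auto simp: flat_exp_def)
    next
      case False
      then show ?thesis using nz by blast
    qed
  qed
  have bd: "0 \<le> h n x" "h n x \<le> 1" for n x
    unfolding h_def by (auto intro!: prod_nonneg prod_le_1 simp: flat_exp_nonneg flat_exp_le_1)
  have "(\<lambda>n. LINT x|lebesgue_on U. D x * h n x) \<longlonglongrightarrow> (LINT x|lebesgue_on U. D x * indicator (box p q) x)"
  proof (rule integral_dominated_convergence)
    show "(\<lambda>x. D x * indicator (box p q) x) \<in> borel_measurable (lebesgue_on U)"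
      using box(2) by simp
    show "(\<lambda>x. D x * h n x) \<in> borel_measurable (lebesgue_on U)" for n
      using U(2) test_functions_measurable(3)[OF test] by simp
    show "integrable (lebesgue_on U) (\<lambda>x. norm (D x * indicator (box p q) x))"
      using box(2) by (rule integrable_norm)
    show "AE x in lebesgue_on U. norm (D x * h n x) \<le> norm (D x * indicator (box p q) x)" for n
    proof (intro AE_I2)
      fix x
      have "\<bar>h n x\<bar> \<le> indicator (box p q) x"
        using nz[of n x] bd[of n x] by (cases "h n x = 0") (auto simp: indicator_def)
      then show "norm (D x * h n x) \<le> norm (D x * indicator (box p q) x)"
        by (auto simp: abs_mult intro: mult_left_mono)
    qed
    show "AE x in lebesgue_on U. (\<lambda>n. D x * h n x) \<longlonglongrightarrow> D x * indicator (box p q) x"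
      using lim by (auto intro!: tendsto_mult)
  qed
  then show ?thesis by (simp add: zero[OF test] LIMSEQ_const_iff)
qed simp

text \<open>Boxes are stable under intersection and generate the Borel sets, so by Dynkin's argument
  the integral of \<open>f\<close> over every Borel set is zero. Uniqueness of densities then
  identifies \<open>f\<close> with 0.\<close>

lemma AE_zero_if_box_integrals_zero:
  fixes f :: "'a::euclidean_space \<Rightarrow> real"
  assumes f: "integrable lborel f"
    and box: "\<And>p q. (\<integral>x. f x * indicator (box p q) x \<partial>lborel) = 0"
  shows "AE x in lborel. f x = 0"
proof -
  let ?G = "range (\<lambda>(a, b). box a b :: 'a set)"
  have sb: "sets borel = sigma_sets UNIV ?G"
    unfolding borel_eq_box by (simp add: sets_measure_of)
  have I: "integrable lborel (\<lambda>x. f x * indicator A x)" if "A \<in> sets borel" for A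
    using integrable_mult_indicator[of A lborel f] that f by (simp add: mult.commute)
  \<comment> \<open>Complements in the Dynkin argument need the integral over the whole space, which
    is a limit of integrals over growing boxes.\<close>
  have f0: "(\<integral>x. f x \<partial>lborel) = 0"
  proof -
    have "(\<lambda>n. \<integral>x. f x * indicator (box (- real n *\<^sub>R One) (real n *\<^sub>R One)) x \<partial>lborel)
        \<longlonglongrightarrow> (\<integral>x. f x \<partial>lborel)"
    proof (rule integral_dominated_convergence[where w = "\<lambda>x. norm (f x)"])
      show "AE x in lborel. (\<lambda>n. f x * indicator (box (- real n *\<^sub>R One) (real n *\<^sub>R One)) x) \<longlonglongrightarrow> f x"
      proof (intro AE_I2)
        fix x :: 'a
        have "x \<in> box (- real n *\<^sub>R One) (real n *\<^sub>R One)" if "n \<ge> nat \<lceil>norm x\<rceil> + 1" for n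
        proof -
          have "norm x < real n" using that by linarith
          then have "\<bar>x \<bullet> i\<bar> < real n" if "i \<in> Basis" for i
            using Basis_le_norm[OF that, of x] by linarith
          then show ?thesis by (auto simp: mem_box abs_less_iff minus_less_iff)
        qed
        then have "\<forall>\<^sub>F n in sequentially. f x * indicator (box (- real n *\<^sub>R One) (real n *\<^sub>R One)) x = f x"
          unfolding eventually_sequentially by (intro exI[of _ "nat \<lceil>norm x\<rceil> + 1"]) auto
        then show "(\<lambda>n. f x * indicator (box (- real n *\<^sub>R One) (real n *\<^sub>R One)) x) \<longlonglongrightarrow> f x"
          by (rule tendsto_eventually)
      qed
    qed (use f in \<open>auto simp: indicator_def\<close>)
    then show ?thesis by (simp add: box LIMSEQ_const_iff)
  qed
  have "(\<integral>x. f x * indicator A x \<partial>lborel) = 0" if "A \<in> sigma_sets UNIV ?G" for A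
  proof -
    have st: "Int_stable ?G"
    proof (clarsimp simp: Int_stable_def)
      fix a b c d :: 'a
      show "box a b \<inter> box c d \<in> ?G"
        unfolding box_Int_box by (rule range_eqI[of _ _ "(_, _)"]) simp
    qed
    have sub: "?G \<subseteq> Pow UNIV" by simp
    show ?thesis using st sub that
    proof (induction rule: sigma_sets_induct_disjoint)
      case (compl A)
      then have A: "A \<in> sets borel" using sb by simp
      have "(\<integral>x. f x * indicator (UNIV - A) x \<partial>lborel) = (\<integral>x. f x - f x * indicator A x \<partial>lborel)"
        by (rule Bochner_Integration.integral_cong) (auto simp: indicator_def)
      then show ?case using I[OF A] f by (simp add: f0 compl)
    next
      case (union A)
      then have A: "A i \<in> sets borel" for i using sb by auto
      have eq: "(\<integral>x. f x * indicator B x \<partial>lborel) = (\<integral>x\<in>B. f x \<partial>lborel)" for B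
        by (simp add: set_lebesgue_integral_def mult.commute)
      have "(\<integral>x\<in>(\<Union>i. A i). f x \<partial>lborel) = (\<Sum>i. \<integral>x\<in>A i. f x \<partial>lborel)"
      proof (rule lebesgue_integral_countable_add)
        show "A i \<inter> A j = {}" if "i \<noteq> j" for i j
          using union(1) that by (auto simp: disjoint_family_on_def)
        have "(\<Union>i. A i) \<in> sets borel" using A by auto
        then show "set_integrable lborel (\<Union>i. A i) f"
          unfolding set_integrable_def using f by (intro integrable_mult_indicator) auto
      qed (use A in simp)
      then show ?case using union(3) by (simp add: eq)
    qed (use box in auto)
  qed
  then have "AE x in lborel. f x = (\<lambda>_. 0) x"
    using f by (intro density_unique_real) (auto simp: sb set_lebesgue_integral_def mult.commute)
  then show ?thesis by simp
qed

text \<open>Square integrability gives integrability only locally, so the argument is carried out on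
  one box inside \<open>U\<close> at a time, after cutting \<open>D\<close> off to that box.
  Intersections with further boxes are boxes inside \<open>U\<close> again, and countably many boxes
  exhaust \<open>U\<close>.\<close>

lemma du_Bois_Reymond:
  fixes D :: "'a::euclidean_space \<Rightarrow> real"
  assumes U: "open U" and D: "square_integrable U D"
    and zero: "\<And>h. h \<in> test_functions U \<Longrightarrow> (LINT x|lebesgue_on U. D x * h x) = 0"
  shows "AE x in lebesgue_on U. D x = 0"
proof -
  have Dm: "D \<in> borel_measurable (lebesgue_on U)" using D by (simp add: square_integrable_def)
  have Us: "U \<in> sets lebesgue" using U by simp
  have intbox: "integrable (lebesgue_on U) (\<lambda>x. D x * indicator (box p q) x)" for p q
  proof (rule square_integrable_mult[OF D])
    have "emeasure (lebesgue_on U) (box p q \<inter> U) = emeasure lborel (box p q \<inter> U)"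
      using Us U by (subst emeasure_restrict_space) auto
    also have "\<dots> < \<infinity>"
      by (rule emeasure_bounded_finite) (simp add: bounded_Int)
    finally have fin: "emeasure (lebesgue_on U) (box p q \<inter> U) < \<infinity>" .
    have m: "box p q \<inter> U \<in> sets (lebesgue_on U)"
      using Us by (auto simp: sets_restrict_space)
    have i: "integrable (lebesgue_on U) (indicator (box p q \<inter> U) :: 'a \<Rightarrow> real)"
      using fin m by (intro integrable_real_indicator)
    have eq: "indicator (box p q \<inter> U) x = (indicator (box p q) x :: real)"
      "indicator (box p q \<inter> U) x = (norm (indicator (box p q) x :: real))\<^sup>2"
      if "x \<in> space (lebesgue_on U)" for x
      using that by (auto simp: indicator_def)
    show "square_integrable U (indicator (box p q) :: 'a \<Rightarrow> real)"
      unfolding square_integrable_def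
    proof
      show "indicator (box p q) \<in> borel_measurable (lebesgue_on U)"
        by (rule measurable_restrict_space1[OF borel_measurable_indicator]) simp
      show "integrable (lebesgue_on U) (\<lambda>x. (norm (indicator (box p q) x :: real))\<^sup>2)"
        by (rule Bochner_Integration.integrable_cong[OF refl eq(2), THEN iffD1, OF _ i])
    qed
  qed
  have box0: "AE x in lebesgue. x \<in> box p q \<longrightarrow> D x = 0" if pq: "box p q \<subseteq> U" for p q
  proof -
    define f where "f x = (if x \<in> U then D x * indicator (box p q) x else 0)" for x
    have fi: "integrable lebesgue f"
      unfolding f_def by (rule Lebesgue_Measure.integrable_restrict_UNIV[OF Us, THEN iffD2, OF intbox])
    \<comment> \<open>\<open>D\<close> is only Lebesgue measurable, while the criterion by boxes
      concerns Borel functions; a Borel representative mediates.\<close>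
    obtain f' where f': "f' \<in> borel_measurable lborel" "AE x in lborel. f x = f' x"
      using completion_ex_borel_measurable_real[of f lborel] fi by auto
    then have ae: "AE x in lebesgue. f x = f' x" by (intro AE_completion)
    have f'l: "f' \<in> borel_measurable lebesgue" using f'(1) by (simp add: measurable_completion)
    have f'i: "integrable lebesgue f'"
      using integrable_cong_AE_imp[OF fi f'l] ae by (simp add: eq_commute)
    then have f'ib: "integrable lborel f'" using f'(1) by (simp add: integrable_completion)
    have "AE x in lborel. f' x = 0"
    proof (rule AE_zero_if_box_integrals_zero[OF f'ib])
      fix c d
      have "(\<integral>x. f' x * indicator (box c d) x \<partial>lborel) = (\<integral>x. f' x * indicator (box c d) x \<partial>lebesgue)"
        using f'(1) by (intro integral_completion[symmetric]) auto
      also have "\<dots> = (\<integral>x. f x * indicator (box c d) x \<partial>lebesgue)"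
      proof (rule integral_cong_AE)
        show "(\<lambda>x. f' x * indicator (box c d) x) \<in> borel_measurable lebesgue"
          by (intro borel_measurable_times borel_measurable_indicator f'l) simp
        show "(\<lambda>x. f x * indicator (box c d) x) \<in> borel_measurable lebesgue"
          by (intro borel_measurable_times borel_measurable_indicator borel_measurable_integrable[OF fi]) simp
      qed (use ae in eventually_elim, simp)
      also have "\<dots> = (\<integral>x. (if x \<in> U then D x * indicator (box p q \<inter> box c d) x else 0) \<partial>lebesgue)"
        by (rule Bochner_Integration.integral_cong) (auto simp: f_def indicator_def)
      also have "\<dots> = (LINT x|lebesgue_on U. D x * indicator (box p q \<inter> box c d) x)"
        by (rule Lebesgue_Measure.integral_restrict_UNIV[OF Us])
      also have "\<dots> = 0"
      proof -
        obtain r s where rs: "box p q \<inter> box c d = box r s" using box_Int_box by blast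
        then have "box r s \<subseteq> U" using pq by blast
        show ?thesis unfolding rs
          by (rule du_Bois_Reymond_box[OF U Dm]) (fact zero, fact \<open>box r s \<subseteq> U\<close>, fact intbox)
      qed
      finally show "(\<integral>x. f' x * indicator (box c d) x \<partial>lborel) = 0" .
    qed
    then have "AE x in lebesgue. f' x = 0" by (rule AE_completion)
    with ae show ?thesis
      by eventually_elim (use pq in \<open>auto simp: f_def\<close>)
  qed
  obtain \<D> where \<D>: "countable \<D>" "\<D> \<subseteq> Pow U" "\<And>X. X \<in> \<D> \<Longrightarrow> \<exists>a b. X = box a b" "\<Union>\<D> = U"
    by (rule open_countable_Union_open_box[OF U]) blast
  have "AE x in lebesgue. x \<in> X \<longrightarrow> D x = 0" if X: "X \<in> \<D>" for X
  proof -
    obtain a b where ab: "X = box a b" using \<D>(3)[OF X] by blast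
    show ?thesis unfolding ab by (rule box0) (use ab X \<D>(2) in blast)
  qed
  then have "AE x in lebesgue. \<forall>X\<in>\<D>. x \<in> X \<longrightarrow> D x = 0"
    by (intro AE_ball_countable[OF \<D>(1), THEN iffD2] ballI)
  then have "AE x in lebesgue. x \<in> U \<longrightarrow> D x = 0"
    by eventually_elim (use \<D>(4) in blast)
  then show ?thesis using AE_restrict_space_iff[of U lebesgue] Us by simp
qed

section \<open>Algebra of square integrable fields and uniqueness of weak gradients\<close>

lemma square_integrable_add:
  assumes "square_integrable U f" "square_integrable U g"
  shows "square_integrable U (\<lambda>x. f x + g x)"
  unfolding square_integrable_def
proof
  have i: "integrable (lebesgue_on U) (\<lambda>x. (norm (f x))\<^sup>2 + 2 * (f x \<bullet> g x) + (norm (g x))\<^sup>2)"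
    using assms square_integrable_inner[OF assms] by (simp add: square_integrable_def)
  have "(norm (f x + g x))\<^sup>2 = (norm (f x))\<^sup>2 + 2 * (f x \<bullet> g x) + (norm (g x))\<^sup>2" for x
    unfolding power2_norm_eq_inner by (simp add: inner_add inner_commute algebra_simps)
  with i show "integrable (lebesgue_on U) (\<lambda>x. (norm (f x + g x))\<^sup>2)" by simp
qed (use assms in \<open>auto simp: square_integrable_def\<close>)

lemma square_integrable_bounded_mult:
  assumes "square_integrable U f" "\<psi> \<in> borel_measurable (lebesgue_on U)" "\<And>x. x \<in> U \<Longrightarrow> \<bar>\<psi> x\<bar> \<le> B"
  shows "square_integrable U (\<lambda>x. \<psi> x *\<^sub>R f x)"
  unfolding square_integrable_def
proof
  show m: "(\<lambda>x. \<psi> x *\<^sub>R f x) \<in> borel_measurable (lebesgue_on U)"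
    using assms by (auto simp: square_integrable_def)
  show "integrable (lebesgue_on U) (\<lambda>x. (norm (\<psi> x *\<^sub>R f x))\<^sup>2)"
  proof (rule Bochner_Integration.integrable_bound)
    show "integrable (lebesgue_on U) (\<lambda>x. B\<^sup>2 * (norm (f x))\<^sup>2)"
      using assms(1) by (simp add: square_integrable_def)
    show "(\<lambda>x. (norm (\<psi> x *\<^sub>R f x))\<^sup>2) \<in> borel_measurable (lebesgue_on U)"
      by (intro borel_measurable_power measurable_compose[OF m borel_measurable_norm])
    have "(norm (\<psi> x *\<^sub>R f x))\<^sup>2 \<le> B\<^sup>2 * (norm (f x))\<^sup>2" if "x \<in> U" for x
      using power_mono[OF assms(3)[OF that] abs_ge_zero, of 2]
      by (simp add: power_mult_distrib mult_right_mono)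
    then show "AE x in lebesgue_on U. norm ((norm (\<psi> x *\<^sub>R f x))\<^sup>2) \<le> norm (B\<^sup>2 * (norm (f x))\<^sup>2)"
      by (intro AE_I2) simp
  qed
qed

lemma square_integrable_scaleR:
  "square_integrable U f \<Longrightarrow> square_integrable U (\<lambda>x. c *\<^sub>R f x)"
  using square_integrable_bounded_mult[of U f "\<lambda>_. c" "\<bar>c\<bar>"] by simp

lemma square_integrable_diff:
  assumes "square_integrable U f" "square_integrable U g"
  shows "square_integrable U (\<lambda>x. f x - g x)"
  using square_integrable_add[OF assms(1) square_integrable_scaleR[OF assms(2), of "- 1"]] by simp

lemma square_integrable_scaled_vector:
  fixes u :: "'a::euclidean_space \<Rightarrow> real" and w :: "'a \<Rightarrow> 'a"
  assumes "square_integrable U u" "w \<in> borel_measurable (lebesgue_on U)" "\<And>x. x \<in> U \<Longrightarrow> norm (w x) \<le> B"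
  shows "square_integrable U (\<lambda>x. u x *\<^sub>R w x)"
proof -
  have "square_integrable U (\<lambda>x. norm (w x) *\<^sub>R u x)"
    using assms by (intro square_integrable_bounded_mult[where B = B]) auto
  moreover have "(norm (u x *\<^sub>R w x))\<^sup>2 = (norm (norm (w x) *\<^sub>R u x))\<^sup>2" for x
    by (simp add: power_mult_distrib)
  ultimately show ?thesis
    using assms(1,2) unfolding square_integrable_def by (simp add: borel_measurable_scaleR)
qed

lemma W12_unique:
  assumes U: "open U" and W: "W12 U u G" "W12 U u H"
  shows "AE x in lebesgue_on U. G x = H x"
proof -
  have sq: "square_integrable U G" "square_integrable U H" using W by (auto simp: W12_def)
  have "AE x in lebesgue_on U. (G x - H x) \<bullet> i = 0" if i: "i \<in> Basis" for i
  proof (rule du_Bois_Reymond[OF U])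
    show "square_integrable U (\<lambda>x. (G x - H x) \<bullet> i)"
      by (intro square_integrable_component square_integrable_diff sq)
    fix h assume h: "h \<in> test_functions U"
    have int: "integrable (lebesgue_on U) (\<lambda>x. (G x \<bullet> i) * h x)" "integrable (lebesgue_on U) (\<lambda>x. (H x \<bullet> i) * h x)"
      by (intro square_integrable_mult square_integrable_component sq
          test_functions_square_integrable[OF h U])+
    have "(LINT x|lebesgue_on U. (G x \<bullet> i) * h x) = (LINT x|lebesgue_on U. (H x \<bullet> i) * h x)"
    proof -
      have "(LINT x|lebesgue_on U. (u x * (gradient h x \<bullet> i))) = - (LINT x|lebesgue_on U. (G x \<bullet> i) * h x)"
        using W(1) h i unfolding W12_def by blast
      moreover have "(LINT x|lebesgue_on U. (u x * (gradient h x \<bullet> i))) = - (LINT x|lebesgue_on U. (H x \<bullet> i) * h x)"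
        using W(2) h i unfolding W12_def by blast
      ultimately show ?thesis by simp
    qed
    then show "(LINT x|lebesgue_on U. ((G x - H x) \<bullet> i) * h x) = 0"
      using int by (simp add: inner_diff_left left_diff_distrib)
  qed
  then have "AE x in lebesgue_on U. \<forall>i\<in>Basis. (G x - H x) \<bullet> i = 0"
    by (simp add: AE_finite_all)
  then show ?thesis
  proof eventually_elim
    case (elim x)
    then have "G x - H x = 0" by (subst euclidean_all_zero_iff[symmetric]) blast
    then show ?case by simp
  qed
qed

text \<open>The integral of (f + t g)^2 is a nonnegative quadratic in t, and the claim is the sign
  of its discriminant.\<close>

lemma integral_Cauchy_Schwarz:
  fixes f g :: "'a \<Rightarrow> real"
  assumes "integrable M (\<lambda>x. (f x)\<^sup>2)" "integrable M (\<lambda>x. (g x)\<^sup>2)" "integrable M (\<lambda>x. f x * g x)"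
  shows "(\<integral>x. f x * g x \<partial>M)\<^sup>2 \<le> (\<integral>x. (f x)\<^sup>2 \<partial>M) * (\<integral>x. (g x)\<^sup>2 \<partial>M)"
proof -
  define a b c where "a = (\<integral>x. (g x)\<^sup>2 \<partial>M)" and "b = (\<integral>x. f x * g x \<partial>M)" and "c = (\<integral>x. (f x)\<^sup>2 \<partial>M)"
  have q: "0 \<le> c + 2 * t * b + t\<^sup>2 * a" for t
  proof -
    have "0 \<le> (\<integral>x. (f x + t * g x)\<^sup>2 \<partial>M)" by simp
    also have "\<dots> = (\<integral>x. (f x)\<^sup>2 + 2 * t * (f x * g x) + t\<^sup>2 * (g x)\<^sup>2 \<partial>M)"
      by (rule Bochner_Integration.integral_cong) (auto simp: power2_eq_square algebra_simps)
    also have "\<dots> = c + 2 * t * b + t\<^sup>2 * a"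
      using assms by (simp add: a_def b_def c_def)
    finally show ?thesis .
  qed
  have a: "0 \<le> a" by (simp add: a_def)
  have "b\<^sup>2 \<le> c * a"
  proof (cases "a = 0")
    case True
    have "b = 0"
    proof (rule ccontr)
      assume "b \<noteq> 0"
      \<comment> \<open>If a = 0 the quadratic degenerates to the affine function c + 2 t b; for b
        nonzero this choice of t gives it the value -1.\<close>
      then have "c + 2 * (- (c + 1) / (2 * b)) * b = - 1" by (simp add: field_simps)
      then show False using q[of "- (c + 1) / (2 * b)"] True by simp
    qed
    then show ?thesis using True by simp
  next
    case False
    then have "0 < a" using a by simp
    then have "0 \<le> (c + 2 * (- b / a) * b + (- b / a)\<^sup>2 * a) * a"
      using q[of "- b / a"] by (intro mult_nonneg_nonneg) auto
    also have "\<dots> = c * a - b\<^sup>2" using \<open>0 < a\<close> by (simp add: power2_eq_square field_simps)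
    finally show ?thesis by simp
  qed
  then show ?thesis by (simp add: a_def b_def c_def)
qed

section \<open>Pairs of a function and its weak gradient\<close>

text \<open>\<^const>\<open>W012\<close> refers to the weak gradient selected by \<open>SOME\<close>. Carrying the gradient along as a
  second component makes the closure operations below explicit; uniqueness of weak gradients
  reconnects the two notions.\<close>

definition W012_with_gradient :: "'a::euclidean_space set \<Rightarrow> ('a \<Rightarrow> real) \<Rightarrow> ('a \<Rightarrow> 'a) \<Rightarrow> bool" where
  "W012_with_gradient U u g \<longleftrightarrow>
    square_integrable U u \<and> square_integrable U g \<and>
    (\<exists>h. (\<forall>k::nat. h k \<in> test_functions U) \<and>
      (\<lambda>k. LINT x|lebesgue_on U. ((u x - h k x)\<^sup>2 + (norm (g x - gradient (h k) x))\<^sup>2)) \<longlonglongrightarrow> 0)"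

lemma integrable_W12_distance:
  assumes "square_integrable U u" "square_integrable U g" "square_integrable U v" "square_integrable U w"
  shows "integrable (lebesgue_on U) (\<lambda>x. (u x - v x :: real)\<^sup>2)"
    and "integrable (lebesgue_on U) (\<lambda>x. (norm (g x - w x))\<^sup>2)"
  using square_integrable_diff[OF assms(1,3)] square_integrable_diff[OF assms(2,4)]
  by (auto simp: square_integrable_def)

text \<open>By Cauchy-Schwarz, strong convergence to zero implies that pairings with a fixed square
  integrable function tend to zero. Limits pass through the weak formulation in this way.\<close>

lemma tendsto_integral_mult_zero:
  fixes v :: "'a::euclidean_space \<Rightarrow> real"
  assumes "\<And>k. square_integrable U (f k)" "square_integrable U v"
    and lim: "(\<lambda>k. LINT x|lebesgue_on U. (f k x)\<^sup>2) \<longlonglongrightarrow> 0"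
  shows "(\<lambda>k. LINT x|lebesgue_on U. f k x * v x) \<longlonglongrightarrow> 0"
proof -
  let ?c = "LINT x|lebesgue_on U. (v x)\<^sup>2"
  have b: "\<bar>LINT x|lebesgue_on U. f k x * v x\<bar> \<le> sqrt ((LINT x|lebesgue_on U. (f k x)\<^sup>2) * ?c)" for k
    using integral_Cauchy_Schwarz[of "lebesgue_on U" "f k" v] assms(1)[of k] assms(2)
      square_integrable_mult[OF assms(1)[of k] assms(2)]
    by (intro real_le_rsqrt) (auto simp: square_integrable_def)
  have "(\<lambda>k. sqrt ((LINT x|lebesgue_on U. (f k x)\<^sup>2) * ?c)) \<longlonglongrightarrow> sqrt (0 * ?c)"
    by (intro tendsto_real_sqrt tendsto_mult lim tendsto_const)
  then have "(\<lambda>k. sqrt ((LINT x|lebesgue_on U. (f k x)\<^sup>2) * ?c)) \<longlonglongrightarrow> 0" by simp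
  then show ?thesis
    by (rule Lim_null_comparison[rotated]) (use b in auto)
qed

lemma W012_with_gradient_seq:
  assumes U: "open U" and W: "W012_with_gradient U u g"
  obtains h where "\<And>k::nat. h k \<in> test_functions U"
    "(\<lambda>k. LINT x|lebesgue_on U. (u x - h k x)\<^sup>2) \<longlonglongrightarrow> 0"
    "(\<lambda>k. LINT x|lebesgue_on U. (norm (g x - gradient (h k) x))\<^sup>2) \<longlonglongrightarrow> 0"
proof -
  obtain h where h: "\<And>k::nat. h k \<in> test_functions U" and
    lim: "(\<lambda>k. LINT x|lebesgue_on U. ((u x - h k x)\<^sup>2 + (norm (g x - gradient (h k) x))\<^sup>2)) \<longlonglongrightarrow> 0"
    using W unfolding W012_with_gradient_def by blast
  have sq: "square_integrable U u" "square_integrable U g" using W by (auto simp: W012_with_gradient_def)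
  note i = integrable_W12_distance[OF sq test_functions_square_integrable[OF h U]]
  have eq: "(LINT x|lebesgue_on U. ((u x - h k x)\<^sup>2 + (norm (g x - gradient (h k) x))\<^sup>2)) =
    (LINT x|lebesgue_on U. (u x - h k x)\<^sup>2) + (LINT x|lebesgue_on U. (norm (g x - gradient (h k) x))\<^sup>2)" for k
    using i by simp
  have "(\<lambda>k. LINT x|lebesgue_on U. (u x - h k x)\<^sup>2) \<longlonglongrightarrow> 0"
    by (rule Lim_null_comparison[OF _ lim]) (simp add: eq)
  moreover have "(\<lambda>k. LINT x|lebesgue_on U. (norm (g x - gradient (h k) x))\<^sup>2) \<longlonglongrightarrow> 0"
    by (rule Lim_null_comparison[OF _ lim]) (simp add: eq)
  ultimately show thesis using h that by blast
qed

text \<open>Integration by parts is exact for the approximating test functions, and each of its two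
  sides is a pairing that is continuous in the L^2 limit.\<close>

lemma W012_with_gradient_imp_W12:
  assumes U: "open U" and W: "W012_with_gradient U u g"
  shows "W12 U u g"
proof -
  have sq: "square_integrable U u" "square_integrable U g" using W by (auto simp: W012_with_gradient_def)
  obtain h where h: "\<And>k::nat. h k \<in> test_functions U"
    and l1: "(\<lambda>k. LINT x|lebesgue_on U. (u x - h k x)\<^sup>2) \<longlonglongrightarrow> 0"
    and l2: "(\<lambda>k. LINT x|lebesgue_on U. (norm (g x - gradient (h k) x))\<^sup>2) \<longlonglongrightarrow> 0"
    using W012_with_gradient_seq[OF U W] by blast
  note sqh = test_functions_square_integrable[OF h U]
  have "(LINT x|lebesgue_on U. (u x * (gradient \<eta> x \<bullet> i))) = - (LINT x|lebesgue_on U. ((g x \<bullet> i) * \<eta> x))"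
    if \<eta>: "\<eta> \<in> test_functions U" and i: "i \<in> Basis" for \<eta> i
  proof -
    note sqe = test_functions_square_integrable[OF \<eta> U]
    have 1: "(\<lambda>k. LINT x|lebesgue_on U. (u x - h k x) * (gradient \<eta> x \<bullet> i)) \<longlonglongrightarrow> 0"
      by (rule tendsto_integral_mult_zero[OF square_integrable_diff[OF sq(1) sqh(1)]
            square_integrable_component[OF sqe(2)] l1])
    have "(\<lambda>k. LINT x|lebesgue_on U. ((g x - gradient (h k) x) \<bullet> i)\<^sup>2) \<longlonglongrightarrow> 0"
    proof (rule Lim_null_comparison[OF _ l2], intro always_eventually allI)
      fix k
      have "((g x - gradient (h k) x) \<bullet> i)\<^sup>2 \<le> (norm (g x - gradient (h k) x))\<^sup>2" for x
        using Basis_le_norm[OF i, of "g x - gradient (h k) x"] by (simp add: abs_le_square_iff[symmetric])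
      then show "norm (LINT x|lebesgue_on U. ((g x - gradient (h k) x) \<bullet> i)\<^sup>2)
          \<le> (LINT x|lebesgue_on U. (norm (g x - gradient (h k) x))\<^sup>2)"
        using square_integrable_component[OF square_integrable_diff[OF sq(2) sqh(2)]]
          square_integrable_diff[OF sq(2) sqh(2)]
        by (auto intro!: integral_mono simp: square_integrable_def)
    qed
    then have 2: "(\<lambda>k. LINT x|lebesgue_on U. ((g x - gradient (h k) x) \<bullet> i) * \<eta> x) \<longlonglongrightarrow> 0"
      by (rule tendsto_integral_mult_zero[OF square_integrable_component[OF square_integrable_diff[OF sq(2) sqh(2)]]
            sqe(1)])
    have eq: "(LINT x|lebesgue_on U. (u x - h k x) * (gradient \<eta> x \<bullet> i)) +
        (LINT x|lebesgue_on U. ((g x - gradient (h k) x) \<bullet> i) * \<eta> x)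
      = (LINT x|lebesgue_on U. (u x * (gradient \<eta> x \<bullet> i))) + (LINT x|lebesgue_on U. ((g x \<bullet> i) * \<eta> x))" for k
      using integration_by_parts_test[OF U h[of k] \<eta> i]
        square_integrable_mult[OF sq(1) square_integrable_component[OF sqe(2), of i]]
        square_integrable_mult[OF sqh(1)[of k] square_integrable_component[OF sqe(2), of i]]
        square_integrable_mult[OF square_integrable_component[OF sq(2), of i] sqe(1)]
        square_integrable_mult[OF square_integrable_component[OF sqh(2)[of k], of i] sqe(1)]
      by (simp add: left_diff_distrib inner_diff_left)
    have "(\<lambda>k. (LINT x|lebesgue_on U. (u x * (gradient \<eta> x \<bullet> i))) + (LINT x|lebesgue_on U. ((g x \<bullet> i) * \<eta> x))) \<longlonglongrightarrow> 0 + 0"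
      using tendsto_add[OF 1 2] unfolding eq .
    then show ?thesis by (simp add: LIMSEQ_const_iff)
  qed
  with sq show ?thesis by (simp add: W12_def)
qed

lemma W012_imp_with_gradient:
  assumes "u \<in> W012 U"
  shows "W012_with_gradient U u (weak_gradient U u)"
proof -
  have "W12 U u (weak_gradient U u)"
    using assms unfolding W012_def weak_gradient_def by (auto intro: someI[of "W12 U u"])
  then show ?thesis
    using assms unfolding W012_def W012_with_gradient_def W12_def by blast
qed

lemma W012_with_gradient_imp_W012:
  assumes U: "open U" and W: "W012_with_gradient U u g"
  shows "u \<in> W012 U" and "AE x in lebesgue_on U. weak_gradient U u x = g x"
proof -
  have Wg: "W12 U u g" by (rule W012_with_gradient_imp_W12[OF U W])
  then have Ww: "W12 U u (weak_gradient U u)"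
    unfolding weak_gradient_def by (rule someI[of "W12 U u" g])
  show ae: "AE x in lebesgue_on U. weak_gradient U u x = g x"
    by (rule W12_unique[OF U Ww Wg])
  obtain h where h: "\<And>k::nat. h k \<in> test_functions U" and
    lim: "(\<lambda>k. LINT x|lebesgue_on U. ((u x - h k x)\<^sup>2 + (norm (g x - gradient (h k) x))\<^sup>2)) \<longlonglongrightarrow> 0"
    using W unfolding W012_with_gradient_def by blast
  have "(LINT x|lebesgue_on U. ((u x - h k x)\<^sup>2 + (norm (weak_gradient U u x - gradient (h k) x))\<^sup>2))
    = (LINT x|lebesgue_on U. ((u x - h k x)\<^sup>2 + (norm (g x - gradient (h k) x))\<^sup>2))" for k
    using ae Wg Ww test_functions_measurable(3,4)[OF h[of k]]
    by (intro integral_cong_AE) (auto simp: W12_def square_integrable_def)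
  then have "(\<lambda>k. LINT x|lebesgue_on U. ((u x - h k x)\<^sup>2 +
      (norm (weak_gradient U u x - gradient (h k) x))\<^sup>2)) \<longlonglongrightarrow> 0"
    using lim by simp
  with h Wg show "u \<in> W012 U" unfolding W012_def by blast
qed

text \<open>A diagonal argument: for each n a test function closer than 1 / (n + 1) to the pair
  \<open>(v n, w n)\<close> is selected. All closure properties below approximate by simpler pairs
  and then appeal to this lemma.\<close>

lemma W012_with_gradient_limit:
  assumes U: "open U" and W: "\<And>n::nat. W012_with_gradient U (v n) (w n)"
    and sq: "square_integrable U u" "square_integrable U g"
    and lim1: "(\<lambda>n. LINT x|lebesgue_on U. (u x - v n x)\<^sup>2) \<longlonglongrightarrow> 0"
    and lim2: "(\<lambda>n. LINT x|lebesgue_on U. (norm (g x - w n x))\<^sup>2) \<longlonglongrightarrow> 0"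
  shows "W012_with_gradient U u g"
proof -
  have sqn: "square_integrable U (v n)" "square_integrable U (w n)" for n
    using W[of n] by (auto simp: W012_with_gradient_def)
  have ex: "\<exists>h. h \<in> test_functions U \<and>
      (LINT x|lebesgue_on U. ((v n x - h x)\<^sup>2 + (norm (w n x - gradient h x))\<^sup>2)) < inverse (real (Suc n))" for n
  proof -
    obtain h where h: "\<And>k::nat. h k \<in> test_functions U" and
      lim: "(\<lambda>k. LINT x|lebesgue_on U. ((v n x - h k x)\<^sup>2 + (norm (w n x - gradient (h k) x))\<^sup>2)) \<longlonglongrightarrow> 0"
      using W[of n] unfolding W012_with_gradient_def by blast
    have "\<forall>\<^sub>F k in sequentially. (LINT x|lebesgue_on U. ((v n x - h k x)\<^sup>2 + (norm (w n x - gradient (h k) x))\<^sup>2)) < inverse (real (Suc n))"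
      by (rule order_tendstoD(2)[OF lim]) simp
    then obtain k where "(LINT x|lebesgue_on U. ((v n x - h k x)\<^sup>2 + (norm (w n x - gradient (h k) x))\<^sup>2)) < inverse (real (Suc n))"
      using eventually_happens by fastforce
    with h[of k] show ?thesis by (intro exI[of _ "h k"] conjI)
  qed
  have "\<exists>h. \<forall>n. h n \<in> test_functions U \<and>
      (LINT x|lebesgue_on U. ((v n x - h n x)\<^sup>2 + (norm (w n x - gradient (h n) x))\<^sup>2)) < inverse (real (Suc n))"
    by (intro choice allI ex)
  then obtain h where h: "\<And>n. h n \<in> test_functions U" and
    small: "\<And>n. (LINT x|lebesgue_on U. ((v n x - h n x)\<^sup>2 + (norm (w n x - gradient (h n) x))\<^sup>2)) < inverse (real (Suc n))"
    by blast
  note sqh = test_functions_square_integrable[OF h U]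
  let ?E = "\<lambda>n. LINT x|lebesgue_on U. ((u x - h n x)\<^sup>2 + (norm (g x - gradient (h n) x))\<^sup>2)"
  let ?B = "\<lambda>n. 2 * (LINT x|lebesgue_on U. (u x - v n x)\<^sup>2) + 2 * (LINT x|lebesgue_on U. (norm (g x - w n x))\<^sup>2)
      + 2 * inverse (real (Suc n))"
  have "(\<lambda>n. ?B n) \<longlonglongrightarrow> 2 * 0 + 2 * 0 + 2 * 0"
    by (intro tendsto_intros lim1 lim2 LIMSEQ_inverse_real_of_nat)
  then have B: "(\<lambda>n. ?B n) \<longlonglongrightarrow> 0" by simp
  have "?E n \<le> ?B n" for n
  proof -
    note i1 = integrable_W12_distance[OF sq sqn[of n]]
    note i2 = integrable_W12_distance[OF sqn[of n] sqh[of n]]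
    note i3 = integrable_W12_distance[OF sq sqh[of n]]
    have p: "(norm (a - c))\<^sup>2 \<le> 2 * (norm (a - b))\<^sup>2 + 2 * (norm (b - c))\<^sup>2" for a b c :: "'b::real_normed_vector"
    proof -
      have "norm (a - c) \<le> norm (a - b) + norm (b - c)" using norm_triangle_ineq[of "a - b" "b - c"] by simp
      then have "(norm (a - c))\<^sup>2 \<le> (norm (a - b) + norm (b - c))\<^sup>2" by (intro power_mono) auto
      then show ?thesis using sum_squares_bound[of "norm (a - b)" "norm (b - c)"] by (simp add: power2_sum)
    qed
    have "?E n \<le> (LINT x|lebesgue_on U. 2 * (u x - v n x)\<^sup>2 + 2 * (norm (g x - w n x))\<^sup>2
        + 2 * ((v n x - h n x)\<^sup>2 + (norm (w n x - gradient (h n) x))\<^sup>2))"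
    proof (rule integral_mono)
      fix x
      show "(u x - h n x)\<^sup>2 + (norm (g x - gradient (h n) x))\<^sup>2 \<le> 2 * (u x - v n x)\<^sup>2 + 2 * (norm (g x - w n x))\<^sup>2
        + 2 * ((v n x - h n x)\<^sup>2 + (norm (w n x - gradient (h n) x))\<^sup>2)"
        using p[of "u x" "h n x" "v n x"] p[of "g x" "gradient (h n) x" "w n x"] by simp
    qed (use i1 i2 i3 in auto)
    also have "\<dots> = 2 * (LINT x|lebesgue_on U. (u x - v n x)\<^sup>2) + 2 * (LINT x|lebesgue_on U. (norm (g x - w n x))\<^sup>2)
      + 2 * (LINT x|lebesgue_on U. ((v n x - h n x)\<^sup>2 + (norm (w n x - gradient (h n) x))\<^sup>2))"
      using i1 i2 by simp
    finally show ?thesis using small[of n] by linarith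
  qed
  moreover have "0 \<le> ?E n" for n by simp
  ultimately have "?E \<longlonglongrightarrow> 0"
    by (intro Lim_null_comparison[OF _ B]) (simp add: abs_of_nonneg)
  with sq h show ?thesis unfolding W012_with_gradient_def by blast
qed

lemma W012_with_gradient_test:
  assumes "open U" "h \<in> test_functions U"
  shows "W012_with_gradient U h (gradient h)"
  unfolding W012_with_gradient_def
  by (intro conjI test_functions_square_integrable assms exI[of _ "\<lambda>_. h"]) (use assms in auto)

section \<open>Products, compositions and truncations in the Sobolev space\<close>

lemma smooth_measurable:
  assumes "smooth h"
  shows "h \<in> borel_measurable (lebesgue_on U)" "gradient h \<in> borel_measurable (lebesgue_on U)"
proof -
  have "h \<in> borel_measurable borel" "gradient h \<in> borel_measurable borel"
    by (auto intro: borel_measurable_continuous_onI smooth_continuous smooth_gradient_continuous assms)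
  then have "h \<in> borel_measurable lebesgue" "gradient h \<in> borel_measurable lebesgue"
    by (auto intro: measurable_completion)
  then show "h \<in> borel_measurable (lebesgue_on U)" "gradient h \<in> borel_measurable (lebesgue_on U)"
    by (auto intro: measurable_restrict_space1)
qed

lemma smooth_bounded_on:
  assumes "smooth \<psi>" "bounded U"
  obtains B where "B > 0" "\<And>x. x \<in> U \<Longrightarrow> \<bar>\<psi> x\<bar> \<le> B" "\<And>x. x \<in> U \<Longrightarrow> norm (gradient \<psi> x) \<le> B"
proof -
  have c: "compact (closure U)" using assms(2) by simp
  have "compact (\<psi> ` closure U)" "compact (gradient \<psi> ` closure U)"
    by (auto intro!: compact_continuous_image c smooth_continuous smooth_gradient_continuous assms)
  then have "bounded (\<psi> ` closure U)" "bounded (gradient \<psi> ` closure U)"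
    using compact_imp_bounded by blast+
  then obtain b d where "\<And>x. x \<in> closure U \<Longrightarrow> \<bar>\<psi> x\<bar> \<le> b" "\<And>x. x \<in> closure U \<Longrightarrow> norm (gradient \<psi> x) \<le> d"
    unfolding bounded_iff by auto
  then have bd: "\<And>x. x \<in> U \<Longrightarrow> \<bar>\<psi> x\<bar> \<le> b" "\<And>x. x \<in> U \<Longrightarrow> norm (gradient \<psi> x) \<le> d"
    using closure_subset[of U] by blast+
  show thesis
    by (rule that[of "max 1 (max b d)"]) (use bd in \<open>fastforce simp: le_max_iff_disj\<close>)+
qed

text \<open>On the bounded set \<open>U\<close> both \<psi> and its gradient are bounded, so the
  product rule for the approximating test functions survives the L^2 limit.\<close>

lemma W012_with_gradient_mult:
  assumes U: "open U" "bounded U" and \<psi>: "smooth \<psi>" and W: "W012_with_gradient U u g"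
  shows "W012_with_gradient U (\<lambda>x. \<psi> x * u x) (\<lambda>x. \<psi> x *\<^sub>R g x + u x *\<^sub>R gradient \<psi> x)"
proof -
  obtain B where B: "B > 0" "\<And>x. x \<in> U \<Longrightarrow> \<bar>\<psi> x\<bar> \<le> B" "\<And>x. x \<in> U \<Longrightarrow> norm (gradient \<psi> x) \<le> B"
    using smooth_bounded_on[OF \<psi> U(2)] by blast
  obtain h where h: "\<And>k::nat. h k \<in> test_functions U"
    and l1: "(\<lambda>k. LINT x|lebesgue_on U. (u x - h k x)\<^sup>2) \<longlonglongrightarrow> 0"
    and l2: "(\<lambda>k. LINT x|lebesgue_on U. (norm (g x - gradient (h k) x))\<^sup>2) \<longlonglongrightarrow> 0"
    using W012_with_gradient_seq[OF U(1) W] by blast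
  have sq: "square_integrable U u" "square_integrable U g"
    using W by (auto simp: W012_with_gradient_def)
  note m = smooth_measurable[OF \<psi>]
  have sqp: "square_integrable U (\<lambda>x. \<psi> x * v x)" "square_integrable U (\<lambda>x. \<psi> x *\<^sub>R w x + v x *\<^sub>R gradient \<psi> x)"
    if "square_integrable U v" "square_integrable U w" for v w
    using square_integrable_bounded_mult[OF that(1) m(1) B(2)] square_integrable_bounded_mult[OF that(2) m(1) B(2)]
      square_integrable_scaled_vector[OF that(1) m(2) B(3)]
    by (auto intro!: square_integrable_add)
  have p: "(\<lambda>x. \<psi> x * h k x) \<in> test_functions U" for k
    by (rule test_functions_mult[OF \<psi> h])
  have g: "gradient (\<lambda>x. \<psi> x * h k x) x = \<psi> x *\<^sub>R gradient (h k) x + h k x *\<^sub>R gradient \<psi> x" for k x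
    by (rule gradient_eqI[OF GDERIV_mult[OF smooth_GDERIV[OF \<psi>] smooth_GDERIV[OF test_functions_smooth[OF h]]]])
  note sqh = test_functions_square_integrable[OF h U(1)]
  note i = integrable_W12_distance[OF sq sqh]
  note i' = integrable_W12_distance[OF sqp[OF sq] sqp[OF sqh]]
  show ?thesis
  proof (rule W012_with_gradient_limit[OF U(1) W012_with_gradient_test[OF U(1) p] sqp[OF sq]])
    have "(\<lambda>k. B\<^sup>2 * (LINT x|lebesgue_on U. (u x - h k x)\<^sup>2)) \<longlonglongrightarrow> B\<^sup>2 * 0"
      by (intro tendsto_intros l1)
    then have lim: "(\<lambda>k. B\<^sup>2 * (LINT x|lebesgue_on U. (u x - h k x)\<^sup>2)) \<longlonglongrightarrow> 0" by simp
    show "(\<lambda>k. LINT x|lebesgue_on U. (\<psi> x * u x - \<psi> x * h k x)\<^sup>2) \<longlonglongrightarrow> 0"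
    proof (rule Lim_null_comparison[OF _ lim], intro always_eventually allI)
      fix k
      have "(LINT x|lebesgue_on U. (\<psi> x * u x - \<psi> x * h k x)\<^sup>2) \<le> (LINT x|lebesgue_on U. B\<^sup>2 * (u x - h k x)\<^sup>2)"
      proof (rule integral_mono)
        fix x assume "x \<in> space (lebesgue_on U)"
        then have "\<bar>\<psi> x\<bar>\<^sup>2 \<le> B\<^sup>2" using B by (intro power_mono) auto
        then show "(\<psi> x * u x - \<psi> x * h k x)\<^sup>2 \<le> B\<^sup>2 * (u x - h k x)\<^sup>2"
          by (simp add: right_diff_distrib[symmetric] power_mult_distrib mult_right_mono)
      qed (use i'(1) i(1) in auto)
      then show "norm (LINT x|lebesgue_on U. (\<psi> x * u x - \<psi> x * h k x)\<^sup>2) \<le> B\<^sup>2 * (LINT x|lebesgue_on U. (u x - h k x)\<^sup>2)"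
        by simp
    qed
    have "(\<lambda>k. 2 * B\<^sup>2 * (LINT x|lebesgue_on U. (norm (g x - gradient (h k) x))\<^sup>2)
        + 2 * B\<^sup>2 * (LINT x|lebesgue_on U. (u x - h k x)\<^sup>2)) \<longlonglongrightarrow> 2 * B\<^sup>2 * 0 + 2 * B\<^sup>2 * 0"
      by (intro tendsto_intros l1 l2)
    then have lim: "(\<lambda>k. 2 * B\<^sup>2 * (LINT x|lebesgue_on U. (norm (g x - gradient (h k) x))\<^sup>2)
        + 2 * B\<^sup>2 * (LINT x|lebesgue_on U. (u x - h k x)\<^sup>2)) \<longlonglongrightarrow> 0" by simp
    show "(\<lambda>k. LINT x|lebesgue_on U. (norm (\<psi> x *\<^sub>R g x + u x *\<^sub>R gradient \<psi> x
        - gradient (\<lambda>x. \<psi> x * h k x) x))\<^sup>2) \<longlonglongrightarrow> 0"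
      unfolding g
    proof (rule Lim_null_comparison[OF _ lim], intro always_eventually allI)
      fix k
      have "(LINT x|lebesgue_on U. (norm (\<psi> x *\<^sub>R g x + u x *\<^sub>R gradient \<psi> x
          - (\<psi> x *\<^sub>R gradient (h k) x + h k x *\<^sub>R gradient \<psi> x)))\<^sup>2)
        \<le> (LINT x|lebesgue_on U. 2 * B\<^sup>2 * (norm (g x - gradient (h k) x))\<^sup>2 + 2 * B\<^sup>2 * (u x - h k x)\<^sup>2)"
      proof (rule integral_mono)
        fix x assume "x \<in> space (lebesgue_on U)"
        then have x: "\<bar>\<psi> x\<bar> \<le> B" "norm (gradient \<psi> x) \<le> B" using B by auto
        have "\<psi> x *\<^sub>R g x + u x *\<^sub>R gradient \<psi> x - (\<psi> x *\<^sub>R gradient (h k) x + h k x *\<^sub>R gradient \<psi> x)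
          = \<psi> x *\<^sub>R (g x - gradient (h k) x) + (u x - h k x) *\<^sub>R gradient \<psi> x"
          by (simp add: scaleR_diff_right scaleR_diff_left)
        then have "norm (\<psi> x *\<^sub>R g x + u x *\<^sub>R gradient \<psi> x - (\<psi> x *\<^sub>R gradient (h k) x + h k x *\<^sub>R gradient \<psi> x))
          \<le> \<bar>\<psi> x\<bar> * norm (g x - gradient (h k) x) + \<bar>u x - h k x\<bar> * norm (gradient \<psi> x)"
          using norm_triangle_ineq[of "\<psi> x *\<^sub>R (g x - gradient (h k) x)" "(u x - h k x) *\<^sub>R gradient \<psi> x"] by simp
        also have "\<dots> \<le> B * norm (g x - gradient (h k) x) + \<bar>u x - h k x\<bar> * B"
          using x by (intro add_mono mult_right_mono mult_left_mono) auto
        finally have "(norm (\<psi> x *\<^sub>R g x + u x *\<^sub>R gradient \<psi> x - (\<psi> x *\<^sub>R gradient (h k) x + h k x *\<^sub>R gradient \<psi> x)))\<^sup>2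
          \<le> (B * norm (g x - gradient (h k) x) + \<bar>u x - h k x\<bar> * B)\<^sup>2"
          by (intro power_mono) auto
        also have "\<dots> \<le> 2 * B\<^sup>2 * (norm (g x - gradient (h k) x))\<^sup>2 + 2 * B\<^sup>2 * (u x - h k x)\<^sup>2"
          using sum_squares_bound[of "B * norm (g x - gradient (h k) x)" "\<bar>u x - h k x\<bar> * B"]
          by (simp add: power2_sum power_mult_distrib mult_ac)
        finally show "(norm (\<psi> x *\<^sub>R g x + u x *\<^sub>R gradient \<psi> x - (\<psi> x *\<^sub>R gradient (h k) x + h k x *\<^sub>R gradient \<psi> x)))\<^sup>2
          \<le> 2 * B\<^sup>2 * (norm (g x - gradient (h k) x))\<^sup>2 + 2 * B\<^sup>2 * (u x - h k x)\<^sup>2" .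
      qed (use i'(2) i in auto)
      also have "\<dots> = 2 * B\<^sup>2 * (LINT x|lebesgue_on U. (norm (g x - gradient (h k) x))\<^sup>2)
        + 2 * B\<^sup>2 * (LINT x|lebesgue_on U. (u x - h k x)\<^sup>2)"
        using i by simp
      finally show "norm (LINT x|lebesgue_on U. (norm (\<psi> x *\<^sub>R g x + u x *\<^sub>R gradient \<psi> x
          - (\<psi> x *\<^sub>R gradient (h k) x + h k x *\<^sub>R gradient \<psi> x)))\<^sup>2)
        \<le> 2 * B\<^sup>2 * (LINT x|lebesgue_on U. (norm (g x - gradient (h k) x))\<^sup>2)
        + 2 * B\<^sup>2 * (LINT x|lebesgue_on U. (u x - h k x)\<^sup>2)"
        by simp
    qed
  qed
qed

text \<open>Pointwise convergence is needed whenever a nonlinear function is applied to the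
  approximants, or a pointwise inequality is to be inherited by the limit. L^1 convergence of the
  squared differences supplies it along a subsequence.\<close>

lemma W012_with_gradient_AE_seq:
  assumes U: "open U" and W: "W012_with_gradient U u g"
  obtains h where "\<And>k::nat. h k \<in> test_functions U"
    "(\<lambda>k. LINT x|lebesgue_on U. (u x - h k x)\<^sup>2) \<longlonglongrightarrow> 0"
    "(\<lambda>k. LINT x|lebesgue_on U. (norm (g x - gradient (h k) x))\<^sup>2) \<longlonglongrightarrow> 0"
    "AE x in lebesgue_on U. (\<lambda>k. h k x) \<longlonglongrightarrow> u x"
proof -
  have sq: "square_integrable U u" "square_integrable U g"
    using W by (auto simp: W012_with_gradient_def)
  obtain h where h: "\<And>k::nat. h k \<in> test_functions U"
    and l1: "(\<lambda>k. LINT x|lebesgue_on U. (u x - h k x)\<^sup>2) \<longlonglongrightarrow> 0"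
    and l2: "(\<lambda>k. LINT x|lebesgue_on U. (norm (g x - gradient (h k) x))\<^sup>2) \<longlonglongrightarrow> 0"
    using W012_with_gradient_seq[OF U W] by blast
  note i = integrable_W12_distance[OF sq test_functions_square_integrable[OF h U]]
  have "\<exists>r::nat\<Rightarrow>nat. strict_mono r \<and> (AE x in lebesgue_on U. (\<lambda>n. (u x - h (r n) x)\<^sup>2) \<longlonglongrightarrow> 0)"
    using tendsto_L1_AE_subseq[of "lebesgue_on U" "\<lambda>k x. (u x - h k x)\<^sup>2"] i(1) l1 by simp
  then obtain r where r: "strict_mono r" and ae: "AE x in lebesgue_on U. (\<lambda>n. (u x - h (r n) x)\<^sup>2) \<longlonglongrightarrow> 0"
    by blast
  show thesis
  proof (rule that[of "\<lambda>k. h (r k)"])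
    show "(\<lambda>k. LINT x|lebesgue_on U. (u x - h (r k) x)\<^sup>2) \<longlonglongrightarrow> 0"
      using LIMSEQ_subseq_LIMSEQ[OF l1 r] by (simp add: o_def)
    show "(\<lambda>k. LINT x|lebesgue_on U. (norm (g x - gradient (h (r k)) x))\<^sup>2) \<longlonglongrightarrow> 0"
      using LIMSEQ_subseq_LIMSEQ[OF l2 r] by (simp add: o_def)
    show "AE x in lebesgue_on U. (\<lambda>k. h (r k) x) \<longlonglongrightarrow> u x"
      using ae
    proof eventually_elim
      case (elim x)
      then have "(\<lambda>n. sqrt ((u x - h (r n) x)\<^sup>2)) \<longlonglongrightarrow> sqrt 0" by (rule tendsto_real_sqrt)
      then have "(\<lambda>n. u x - h (r n) x) \<longlonglongrightarrow> 0" by (simp add: tendsto_rabs_zero_iff)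
      then have "(\<lambda>n. u x - (u x - h (r n) x)) \<longlonglongrightarrow> u x - 0" by (intro tendsto_intros)
      then show ?case by simp
    qed
  qed (rule h)
qed

text \<open>The error in the gradient splits in two. One part carries
  \<open>deriv F (h k x)\<close>, which is at most 1, times the gradient error. The other carries
  the difference of \<open>deriv F\<close> at \<open>u\<close> and at \<open>h k\<close> times the
  fixed field \<open>g\<close>; it tends to zero almost everywhere and is dominated, since its
  square is at most 4 times that of \<open>g\<close>.\<close>

lemma W012_with_gradient_compose:
  fixes F :: "real \<Rightarrow> real"
  assumes U: "open U" and F: "smooth F" "F 0 = 0" "\<And>t. \<bar>deriv F t\<bar> \<le> 1"
    and W: "W012_with_gradient U u g"
  shows "W012_with_gradient U (\<lambda>x. F (u x)) (\<lambda>x. deriv F (u x) *\<^sub>R g x)"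
proof -
  have sq: "square_integrable U u" "square_integrable U g"
    using W by (auto simp: W012_with_gradient_def)
  then have um: "u \<in> borel_measurable (lebesgue_on U)" "g \<in> borel_measurable (lebesgue_on U)"
    by (auto simp: square_integrable_def)
  obtain h where h: "\<And>k::nat. h k \<in> test_functions U"
    and l1: "(\<lambda>k. LINT x|lebesgue_on U. (u x - h k x)\<^sup>2) \<longlonglongrightarrow> 0"
    and l2: "(\<lambda>k. LINT x|lebesgue_on U. (norm (g x - gradient (h k) x))\<^sup>2) \<longlonglongrightarrow> 0"
    and ae: "AE x in lebesgue_on U. (\<lambda>k. h k x) \<longlonglongrightarrow> u x"
    using W012_with_gradient_AE_seq[OF U W] by blast
  have contF: "continuous_on UNIV F" "continuous_on UNIV (deriv F)"
    by (auto intro: smooth_continuous smooth_deriv F)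
  then have Fm: "F \<in> borel_measurable borel" "deriv F \<in> borel_measurable borel"
    by (auto intro: borel_measurable_continuous_onI)
  note hm = test_functions_measurable(3,4)[OF h]
  have comp_m: "(\<lambda>x. F (v x)) \<in> borel_measurable (lebesgue_on U)" "(\<lambda>x. deriv F (v x)) \<in> borel_measurable (lebesgue_on U)"
    if "v \<in> borel_measurable (lebesgue_on U)" for v
    using measurable_compose[OF that Fm(1)] measurable_compose[OF that Fm(2)] by auto
  have lip: "\<bar>F s - F t\<bar> \<le> \<bar>s - t\<bar>" for s t
    using GDERIV_lipschitz[of F "deriv F" 1 s t] smooth_deriv(2)[OF F(1)] F(3) by simp
  have sqF: "square_integrable U (\<lambda>x. F (u x))"
    unfolding square_integrable_def
  proof
    show "integrable (lebesgue_on U) (\<lambda>x. (norm (F (u x)))\<^sup>2)"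
    proof (rule Bochner_Integration.integrable_bound)
      show "integrable (lebesgue_on U) (\<lambda>x. (norm (u x))\<^sup>2)" using sq by (simp add: square_integrable_def)
      show "(\<lambda>x. (norm (F (u x)))\<^sup>2) \<in> borel_measurable (lebesgue_on U)" using comp_m(1)[OF um(1)] by simp
      have "(norm (F t))\<^sup>2 \<le> (norm t)\<^sup>2" for t using lip[of t 0] F(2) by (intro power_mono) auto
      then show "AE x in lebesgue_on U. norm ((norm (F (u x)))\<^sup>2) \<le> norm ((norm (u x))\<^sup>2)" by simp
    qed
  qed (rule comp_m(1)[OF um(1)])
  have sqG: "square_integrable U (\<lambda>x. deriv F (v x) *\<^sub>R w x)"
    if "v \<in> borel_measurable (lebesgue_on U)" "square_integrable U w" for v w
    using square_integrable_bounded_mult[OF that(2) comp_m(2)[OF that(1)] F(3)] .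
  have p: "(\<lambda>x. F (h k x)) \<in> test_functions U" for k
    by (rule test_functions_compose[OF F(1,2) h])
  have g: "gradient (\<lambda>x. F (h k x)) x = deriv F (h k x) *\<^sub>R gradient (h k) x" for k x
    by (rule gradient_eqI[OF smooth_compose_GDERIV[OF F(1) test_functions_smooth[OF h]]])
  note sqh = test_functions_square_integrable[OF h U]
  note i = integrable_W12_distance[OF sq sqh]
  note i' = integrable_W12_distance[OF sqF sqG[OF um(1) sq(2)] test_functions_square_integrable[OF p U]]
  have i'': "integrable (lebesgue_on U) (\<lambda>x. (norm ((deriv F (u x) - deriv F (h k x)) *\<^sub>R g x))\<^sup>2)" for k
    using square_integrable_diff[OF sqG[OF um(1) sq(2)] sqG[OF hm(1)[of k] sq(2)]]
    by (simp add: square_integrable_def scaleR_diff_left)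
  show ?thesis
  proof (rule W012_with_gradient_limit[OF U W012_with_gradient_test[OF U p] sqF sqG[OF um(1) sq(2)]])
    show "(\<lambda>k. LINT x|lebesgue_on U. (F (u x) - F (h k x))\<^sup>2) \<longlonglongrightarrow> 0"
    proof (rule Lim_null_comparison[OF _ l1], intro always_eventually allI)
      fix k
      have "(LINT x|lebesgue_on U. (F (u x) - F (h k x))\<^sup>2) \<le> (LINT x|lebesgue_on U. (u x - h k x)\<^sup>2)"
        using i'(1) i(1) lip by (intro integral_mono) (auto simp: abs_le_square_iff[symmetric])
      then show "norm (LINT x|lebesgue_on U. (F (u x) - F (h k x))\<^sup>2) \<le> (LINT x|lebesgue_on U. (u x - h k x)\<^sup>2)"
        by simp
    qed
    have l3: "(\<lambda>k. LINT x|lebesgue_on U. (norm ((deriv F (u x) - deriv F (h k x)) *\<^sub>R g x))\<^sup>2)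
        \<longlonglongrightarrow> (LINT x|lebesgue_on U. 0)"
    proof (rule integral_dominated_convergence[where w = "\<lambda>x. 4 * (norm (g x))\<^sup>2"])
      show "integrable (lebesgue_on U) (\<lambda>x. 4 * (norm (g x))\<^sup>2)" using sq by (simp add: square_integrable_def)
      show "(\<lambda>x. (norm ((deriv F (u x) - deriv F (h k x)) *\<^sub>R g x))\<^sup>2) \<in> borel_measurable (lebesgue_on U)" for k
        using i'' by (rule borel_measurable_integrable)
      have "\<bar>deriv F s - deriv F t\<bar>\<^sup>2 \<le> 2\<^sup>2" for s t
        using F(3)[of s] F(3)[of t] by (intro power_mono) auto
      then have "(deriv F s - deriv F t)\<^sup>2 * c \<le> 4 * c" if "0 \<le> c" for s t c
        using that by (intro mult_right_mono) auto
      then show "AE x in lebesgue_on U. norm ((norm ((deriv F (u x) - deriv F (h k x)) *\<^sub>R g x))\<^sup>2) \<le> 4 * (norm (g x))\<^sup>2" for k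
        by (simp add: power_mult_distrib)
      show "AE x in lebesgue_on U. (\<lambda>k. (norm ((deriv F (u x) - deriv F (h k x)) *\<^sub>R g x))\<^sup>2) \<longlonglongrightarrow> 0"
        using ae
      proof eventually_elim
        case (elim x)
        have "isCont (deriv F) (u x)" using contF(2) continuous_on_eq_continuous_at by blast
        then have "(\<lambda>k. deriv F (h k x)) \<longlonglongrightarrow> deriv F (u x)"
          using elim isCont_tendsto_compose by blast
        then have "(\<lambda>k. (norm ((deriv F (u x) - deriv F (h k x)) *\<^sub>R g x))\<^sup>2)
            \<longlonglongrightarrow> (norm ((deriv F (u x) - deriv F (u x)) *\<^sub>R g x))\<^sup>2"
          by (intro tendsto_intros)
        then show ?case by simp
      qed
    qed simp
    have "(\<lambda>k. 2 * (LINT x|lebesgue_on U. (norm (g x - gradient (h k) x))\<^sup>2)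
        + 2 * (LINT x|lebesgue_on U. (norm ((deriv F (u x) - deriv F (h k x)) *\<^sub>R g x))\<^sup>2)) \<longlonglongrightarrow> 2 * 0 + 2 * (LINT x|lebesgue_on U. 0)"
      by (intro tendsto_intros l2 l3)
    then have lim: "(\<lambda>k. 2 * (LINT x|lebesgue_on U. (norm (g x - gradient (h k) x))\<^sup>2)
        + 2 * (LINT x|lebesgue_on U. (norm ((deriv F (u x) - deriv F (h k x)) *\<^sub>R g x))\<^sup>2)) \<longlonglongrightarrow> 0" by simp
    show "(\<lambda>k. LINT x|lebesgue_on U. (norm (deriv F (u x) *\<^sub>R g x - gradient (\<lambda>x. F (h k x)) x))\<^sup>2) \<longlonglongrightarrow> 0"
    proof (rule Lim_null_comparison[OF _ lim], intro always_eventually allI)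
      fix k
      have "(LINT x|lebesgue_on U. (norm (deriv F (u x) *\<^sub>R g x - gradient (\<lambda>x. F (h k x)) x))\<^sup>2)
        \<le> (LINT x|lebesgue_on U. 2 * (norm (g x - gradient (h k) x))\<^sup>2 + 2 * (norm ((deriv F (u x) - deriv F (h k x)) *\<^sub>R g x))\<^sup>2)"
      proof (rule integral_mono)
        fix x
        have "deriv F (u x) *\<^sub>R g x - gradient (\<lambda>x. F (h k x)) x
          = deriv F (h k x) *\<^sub>R (g x - gradient (h k) x) + (deriv F (u x) - deriv F (h k x)) *\<^sub>R g x"
          unfolding g by (simp add: scaleR_diff_right scaleR_diff_left)
        then have "norm (deriv F (u x) *\<^sub>R g x - gradient (\<lambda>x. F (h k x)) x)
          \<le> \<bar>deriv F (h k x)\<bar> * norm (g x - gradient (h k) x) + norm ((deriv F (u x) - deriv F (h k x)) *\<^sub>R g x)"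
          using norm_triangle_ineq[of "deriv F (h k x) *\<^sub>R (g x - gradient (h k) x)"] by (metis norm_scaleR)
        also have "\<dots> \<le> 1 * norm (g x - gradient (h k) x) + norm ((deriv F (u x) - deriv F (h k x)) *\<^sub>R g x)"
          by (intro add_mono mult_right_mono F(3)) auto
        finally have "(norm (deriv F (u x) *\<^sub>R g x - gradient (\<lambda>x. F (h k x)) x))\<^sup>2
          \<le> (norm (g x - gradient (h k) x) + norm ((deriv F (u x) - deriv F (h k x)) *\<^sub>R g x))\<^sup>2"
          by (intro power_mono) auto
        also have "\<dots> \<le> 2 * (norm (g x - gradient (h k) x))\<^sup>2 + 2 * (norm ((deriv F (u x) - deriv F (h k x)) *\<^sub>R g x))\<^sup>2"
          using sum_squares_bound[of "norm (g x - gradient (h k) x)" "norm ((deriv F (u x) - deriv F (h k x)) *\<^sub>R g x)"]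
          by (simp add: power2_sum)
        finally show "(norm (deriv F (u x) *\<^sub>R g x - gradient (\<lambda>x. F (h k x)) x))\<^sup>2
          \<le> 2 * (norm (g x - gradient (h k) x))\<^sup>2 + 2 * (norm ((deriv F (u x) - deriv F (h k x)) *\<^sub>R g x))\<^sup>2" .
      qed (use i'(2) i(2) i'' in auto)
      also have "\<dots> = 2 * (LINT x|lebesgue_on U. (norm (g x - gradient (h k) x))\<^sup>2)
        + 2 * (LINT x|lebesgue_on U. (norm ((deriv F (u x) - deriv F (h k x)) *\<^sub>R g x))\<^sup>2)"
        using i(2)[of k] i''[of k] by (subst Bochner_Integration.integral_add) auto
      finally show "norm (LINT x|lebesgue_on U. (norm (deriv F (u x) *\<^sub>R g x - gradient (\<lambda>x. F (h k x)) x))\<^sup>2)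
        \<le> 2 * (LINT x|lebesgue_on U. (norm (g x - gradient (h k) x))\<^sup>2)
        + 2 * (LINT x|lebesgue_on U. (norm ((deriv F (u x) - deriv F (h k x)) *\<^sub>R g x))\<^sup>2)"
        by simp
    qed
  qed
qed

text \<open>An approximation of the positive part, not a mollification. With y = \<epsilon> / s its
  derivative at s > 0 is (1 + y) exp (- y), which lies between 0 and 1, so the composition rule with
  derivative bound 1 applies for every \<epsilon>.\<close>

definition smooth_positive_part :: "real \<Rightarrow> real \<Rightarrow> real" where
  "smooth_positive_part \<epsilon> s = s * flat_exp (s / \<epsilon>)"

lemma smooth_positive_part_DERIV:
  assumes "\<epsilon> > 0"
  shows "DERIV (smooth_positive_part \<epsilon>) s :> (if s \<le> 0 then 0 else exp (- (\<epsilon> / s)) * (1 + \<epsilon> / s))"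
proof -
  have "DERIV (\<lambda>s. flat_exp (s / \<epsilon>)) s :> (flat_exp (s / \<epsilon>) / (s / \<epsilon>)\<^sup>2) * (1 / \<epsilon>)"
    by (rule DERIV_chain2[OF flat_exp_DERIV]) (use assms in \<open>auto intro!: derivative_eq_intros\<close>)
  then have "DERIV (smooth_positive_part \<epsilon>) s :>
      1 * flat_exp (s / \<epsilon>) + (flat_exp (s / \<epsilon>) / (s / \<epsilon>)\<^sup>2) * (1 / \<epsilon>) * s"
    unfolding smooth_positive_part_def by (intro DERIV_mult DERIV_ident)
  moreover have "1 * flat_exp (s / \<epsilon>) + (flat_exp (s / \<epsilon>) / (s / \<epsilon>)\<^sup>2) * (1 / \<epsilon>) * s =
      (if s \<le> 0 then 0 else exp (- (\<epsilon> / s)) * (1 + \<epsilon> / s))"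
    using assms by (auto simp: flat_exp_def divide_le_0_iff power2_eq_square field_simps)
  ultimately show ?thesis by simp
qed

lemma smooth_smooth_positive_part: "smooth (smooth_positive_part \<epsilon>)"
proof -
  have "smooth (\<lambda>s::real. (s \<bullet> 1) * flat_exp ((s \<bullet> 1) * (1 / \<epsilon>)))"
    by (intro smooth_mult smooth_compose[OF smooth_flat_exp] smooth_inner smooth_const)
  then show ?thesis by (simp add: smooth_positive_part_def[abs_def])
qed

text \<open>The condition k >= 0 makes the approximations vanish at 0, as compositions with test
  functions require. Their derivatives are exactly 0 at and below the level k and tend to 1 above
  it, so the limit of the gradients is found by dominated convergence without a discussion of the
  level set u = k.\<close>

lemma W012_with_gradient_positive_part:
  assumes U: "open U" and k: "0 \<le> k" and W: "W012_with_gradient U u g"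
  shows "W012_with_gradient U (\<lambda>x. max (u x - k) 0) (\<lambda>x. (if k < u x then 1 else 0) *\<^sub>R g x)"
proof -
  have sq: "square_integrable U u" "square_integrable U g"
    using W by (auto simp: W012_with_gradient_def)
  then have um[measurable]: "u \<in> borel_measurable (lebesgue_on U)" "g \<in> borel_measurable (lebesgue_on U)"
    by (auto simp: square_integrable_def)
  define \<epsilon> where "\<epsilon> n = inverse (real (Suc n))" for n
  have \<epsilon>: "\<epsilon> n > 0" for n by (simp add: \<epsilon>_def)
  have \<epsilon>0: "\<epsilon> \<longlonglongrightarrow> 0" unfolding \<epsilon>_def by (rule LIMSEQ_inverse_real_of_nat)
  define F where "F n t = smooth_positive_part (\<epsilon> n) (t - k)" for n t
  define F' where "F' n t = (if t \<le> k then 0 else exp (- (\<epsilon> n / (t - k))) * (1 + \<epsilon> n / (t - k)))" for n t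
  have sF: "smooth (F n)" for n
  proof -
    have "smooth (\<lambda>t::real. smooth_positive_part (\<epsilon> n) (t \<bullet> 1 - k))"
      by (intro smooth_compose[OF smooth_smooth_positive_part] smooth_diff smooth_inner smooth_const)
    then show ?thesis by (simp add: F_def[abs_def])
  qed
  have dF: "DERIV (F n) t :> F' n t" for n t
  proof -
    have "DERIV (F n) t :> (if t - k \<le> 0 then 0 else exp (- (\<epsilon> n / (t - k))) * (1 + \<epsilon> n / (t - k))) * 1"
      unfolding F_def by (rule DERIV_chain2[OF smooth_positive_part_DERIV[OF \<epsilon>]]) (auto intro!: derivative_eq_intros)
    then show ?thesis by (simp add: F'_def)
  qed
  then have deriv: "deriv (F n) = F' n" for n using DERIV_imp_deriv by blast
  have F'b: "0 \<le> F' n t" "F' n t \<le> 1" for n t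
  proof -
    show "0 \<le> F' n t" using \<epsilon>[of n] by (auto simp: F'_def intro!: mult_nonneg_nonneg add_nonneg_nonneg)
    have "exp (- y) * (1 + y) \<le> 1" for y :: real
      using exp_ge_add_one_self[of y] by (simp add: exp_minus field_simps)
    then show "F' n t \<le> 1" by (simp add: F'_def)
  qed
  have F0: "F n 0 = 0" for n
    using k \<epsilon>[of n] by (auto simp: F_def smooth_positive_part_def flat_exp_def divide_le_0_iff)
  have Wn: "W012_with_gradient U (\<lambda>x. F n (u x)) (\<lambda>x. F' n (u x) *\<^sub>R g x)" for n
    using W012_with_gradient_compose[OF U sF F0 _ W, of n] F'b[of n] unfolding deriv by simp
  have sqp: "square_integrable U (\<lambda>x. max (u x - k) 0)"
    unfolding square_integrable_def
  proof
    show "integrable (lebesgue_on U) (\<lambda>x. (norm (max (u x - k) 0))\<^sup>2)"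
    proof (rule Bochner_Integration.integrable_bound)
      show "integrable (lebesgue_on U) (\<lambda>x. (norm (u x))\<^sup>2)" using sq by (simp add: square_integrable_def)
      have "(norm (max (t - k) 0))\<^sup>2 \<le> (norm t)\<^sup>2" for t using k by (intro power_mono) auto
      then show "AE x in lebesgue_on U. norm ((norm (max (u x - k) 0))\<^sup>2) \<le> norm ((norm (u x))\<^sup>2)" by simp
    qed simp
  qed simp
  have sqg: "square_integrable U (\<lambda>x. (if k < u x then 1 else 0) *\<^sub>R g x)"
    by (rule square_integrable_bounded_mult[OF sq(2), where B = 1]) auto
  show ?thesis
  proof (rule W012_with_gradient_limit[OF U Wn sqp sqg])
    have "(\<lambda>n. LINT x|lebesgue_on U. (max (u x - k) 0 - F n (u x))\<^sup>2) \<longlonglongrightarrow> (LINT x|lebesgue_on U. 0)"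
    proof (rule integral_dominated_convergence[where w = "\<lambda>x. (norm (u x))\<^sup>2"])
      show "integrable (lebesgue_on U) (\<lambda>x. (norm (u x))\<^sup>2)" using sq by (simp add: square_integrable_def)
      show "(\<lambda>x. (max (u x - k) 0 - F n (u x))\<^sup>2) \<in> borel_measurable (lebesgue_on U)" for n
        using Wn[of n] by (auto simp: W012_with_gradient_def square_integrable_def)
      show "AE x in lebesgue_on U. norm ((max (u x - k) 0 - F n (u x))\<^sup>2) \<le> (norm (u x))\<^sup>2" for n
      proof (intro AE_I2)
        fix x
        have "0 \<le> F n (u x)" "F n (u x) \<le> max (u x - k) 0"
          using flat_exp_nonneg[of "(u x - k) / \<epsilon> n"] flat_exp_le_1[of "(u x - k) / \<epsilon> n"] \<epsilon>[of n]
          by (auto simp: F_def smooth_positive_part_def max_def flat_exp_def divide_le_0_iff mult_left_le)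
        then have "\<bar>max (u x - k) 0 - F n (u x)\<bar> \<le> \<bar>u x\<bar>" using k by auto
        then have "\<bar>max (u x - k) 0 - F n (u x)\<bar>\<^sup>2 \<le> \<bar>u x\<bar>\<^sup>2" by (intro power_mono) auto
        then show "norm ((max (u x - k) 0 - F n (u x))\<^sup>2) \<le> (norm (u x))\<^sup>2" by simp
      qed
      show "AE x in lebesgue_on U. (\<lambda>n. (max (u x - k) 0 - F n (u x))\<^sup>2) \<longlonglongrightarrow> 0"
      proof (intro AE_I2)
        fix x
        show "(\<lambda>n. (max (u x - k) 0 - F n (u x))\<^sup>2) \<longlonglongrightarrow> 0"
        proof (cases "u x \<le> k")
          case True
          then have "F n (u x) = 0" for n
            using \<epsilon>[of n] by (simp add: F_def smooth_positive_part_def flat_exp_def divide_le_0_iff)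
          then show ?thesis using True by simp
        next
          case False
          have "(\<lambda>n. (u x - k) - (u x - k) * exp (- (\<epsilon> n / (u x - k)))) \<longlonglongrightarrow> (u x - k) - (u x - k) * exp (- (0 / (u x - k)))"
            using False by (intro tendsto_intros \<epsilon>0) auto
          then have "(\<lambda>n. ((u x - k) - (u x - k) * exp (- (\<epsilon> n / (u x - k))))\<^sup>2) \<longlonglongrightarrow> 0\<^sup>2"
            by (intro tendsto_power) simp
          moreover have "F n (u x) = (u x - k) * exp (- (\<epsilon> n / (u x - k)))" for n
            using \<epsilon>[of n] False by (simp add: F_def smooth_positive_part_def flat_exp_def divide_le_0_iff)
          ultimately show ?thesis using False by simp
        qed
      qed
    qed simp
    then show "(\<lambda>n. LINT x|lebesgue_on U. (max (u x - k) 0 - F n (u x))\<^sup>2) \<longlonglongrightarrow> 0" by simp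
    have "(\<lambda>n. LINT x|lebesgue_on U. (norm ((if k < u x then 1 else 0) *\<^sub>R g x - F' n (u x) *\<^sub>R g x))\<^sup>2) \<longlonglongrightarrow> (LINT x|lebesgue_on U. 0)"
    proof (rule integral_dominated_convergence[where w = "\<lambda>x. (norm (g x))\<^sup>2"])
      show "integrable (lebesgue_on U) (\<lambda>x. (norm (g x))\<^sup>2)" using sq by (simp add: square_integrable_def)
      show "(\<lambda>x. (norm ((if k < u x then 1 else 0) *\<^sub>R g x - F' n (u x) *\<^sub>R g x))\<^sup>2) \<in> borel_measurable (lebesgue_on U)" for n
      proof -
        have "(\<lambda>x. F' n (u x) *\<^sub>R g x) \<in> borel_measurable (lebesgue_on U)"
          using Wn[of n] by (auto simp: W012_with_gradient_def square_integrable_def)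
        then show ?thesis by simp
      qed
      show "AE x in lebesgue_on U. norm ((norm ((if k < u x then 1 else 0) *\<^sub>R g x - F' n (u x) *\<^sub>R g x))\<^sup>2) \<le> (norm (g x))\<^sup>2" for n
      proof (intro AE_I2)
        fix x
        have "\<bar>(if k < u x then 1 else 0) - F' n (u x)\<bar> \<le> 1"
          using F'b[of n "u x"] by (auto simp: F'_def)
        then have "\<bar>(if k < u x then 1 else 0) - F' n (u x)\<bar>\<^sup>2 * (norm (g x))\<^sup>2 \<le> 1\<^sup>2 * (norm (g x))\<^sup>2"
          by (intro mult_right_mono power_mono) auto
        then show "norm ((norm ((if k < u x then 1 else 0) *\<^sub>R g x - F' n (u x) *\<^sub>R g x))\<^sup>2) \<le> (norm (g x))\<^sup>2"
          unfolding scaleR_diff_left[symmetric] by (simp add: power_mult_distrib)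
      qed
      show "AE x in lebesgue_on U. (\<lambda>n. (norm ((if k < u x then 1 else 0) *\<^sub>R g x - F' n (u x) *\<^sub>R g x))\<^sup>2) \<longlonglongrightarrow> 0"
      proof (intro AE_I2)
        fix x
        have "(\<lambda>n. F' n (u x)) \<longlonglongrightarrow> (if k < u x then 1 else 0)"
        proof (cases "u x \<le> k")
          case True
          then show ?thesis by (simp add: F'_def)
        next
          case False
          have "(\<lambda>n. exp (- (\<epsilon> n / (u x - k))) * (1 + \<epsilon> n / (u x - k))) \<longlonglongrightarrow> exp (- (0 / (u x - k))) * (1 + 0 / (u x - k))"
            using False by (intro tendsto_intros \<epsilon>0) auto
          then show ?thesis using False by (simp add: F'_def)
        qed
        then have "(\<lambda>n. (norm ((if k < u x then 1 else 0) *\<^sub>R g x - F' n (u x) *\<^sub>R g x))\<^sup>2) \<longlonglongrightarrow>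
          (norm ((if k < u x then 1 else 0) *\<^sub>R g x - (if k < u x then 1 else 0) *\<^sub>R g x))\<^sup>2"
          by (intro tendsto_intros)
        then show "(\<lambda>n. (norm ((if k < u x then 1 else 0) *\<^sub>R g x - F' n (u x) *\<^sub>R g x))\<^sup>2) \<longlonglongrightarrow> 0" by simp
      qed
    qed simp
    then show "(\<lambda>n. LINT x|lebesgue_on U. (norm ((if k < u x then 1 else 0) *\<^sub>R g x - F' n (u x) *\<^sub>R g x))\<^sup>2) \<longlonglongrightarrow> 0"
      by simp
  qed
qed

section \<open>The energy form\<close>

text \<open>The integrand of \<open>dirichlet_form\<close> with free vectors in place of the chosen
  \<open>weak_gradient\<close>, so that gradients known explicitly can be inserted.\<close>

definition energy_density :: "('a::euclidean_space \<Rightarrow> 'a \<Rightarrow> 'a \<Rightarrow> real) \<Rightarrow> 'a \<Rightarrow> 'a \<Rightarrow> 'a \<Rightarrow> real" where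
  "energy_density a x \<xi> \<zeta> = (\<Sum>i\<in>Basis. \<Sum>j\<in>Basis. a x i j * (\<xi> \<bullet> i) * (\<zeta> \<bullet> j))"

lemma energy_density_add_left: "energy_density a x (\<xi> + \<xi>') \<zeta> = energy_density a x \<xi> \<zeta> + energy_density a x \<xi>' \<zeta>"
  by (simp add: energy_density_def inner_add_left sum.distrib algebra_simps)

lemma energy_density_add_right: "energy_density a x \<zeta> (\<xi> + \<xi>') = energy_density a x \<zeta> \<xi> + energy_density a x \<zeta> \<xi>'"
  by (simp add: energy_density_def inner_add_left sum.distrib algebra_simps)

lemma energy_density_scaleR:
  "energy_density a x (c *\<^sub>R \<xi>) \<zeta> = c * energy_density a x \<xi> \<zeta>"
  "energy_density a x \<xi> (c *\<^sub>R \<zeta>) = c * energy_density a x \<xi> \<zeta>"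
  by (simp_all add: energy_density_def sum_distrib_left mult_ac)

lemma energy_density_commute:
  assumes "uniformly_elliptic \<Lambda> a"
  shows "energy_density a x \<xi> \<zeta> = energy_density a x \<zeta> \<xi>"
  unfolding energy_density_def
  by (subst sum.swap, intro sum.cong refl) (use assms in \<open>simp add: uniformly_elliptic_def mult_ac\<close>)

lemma energy_density_bounds:
  assumes "uniformly_elliptic \<Lambda> a"
  shows "inverse \<Lambda> * (norm \<xi>)\<^sup>2 \<le> energy_density a x \<xi> \<xi>" "energy_density a x \<xi> \<xi> \<le> \<Lambda> * (norm \<xi>)\<^sup>2"
  using assms unfolding uniformly_elliptic_def energy_density_def by auto

text \<open>Polarisation: the form is nonnegative at the sum and at the difference of the two
  vectors, which bounds twice the mixed term by the two diagonal ones.\<close>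

lemma energy_density_abs_le:
  assumes "uniformly_elliptic \<Lambda> a" "1 \<le> \<Lambda>"
  shows "\<bar>energy_density a x \<xi> \<zeta>\<bar> \<le> \<Lambda> * ((norm \<xi>)\<^sup>2 + (norm \<zeta>)\<^sup>2)"
proof -
  have nn: "0 \<le> energy_density a x \<eta> \<eta>" for \<eta>
    using energy_density_bounds(1)[OF assms(1), of \<eta> x] assms(2)
    by (smt (verit) inverse_nonnegative_iff_nonnegative mult_nonneg_nonneg zero_le_power2)
  have "0 \<le> energy_density a x (\<xi> + \<zeta>) (\<xi> + \<zeta>)" "0 \<le> energy_density a x (\<xi> + (-1) *\<^sub>R \<zeta>) (\<xi> + (-1) *\<^sub>R \<zeta>)"
    by (rule nn)+
  then have "2 * \<bar>energy_density a x \<xi> \<zeta>\<bar> \<le> energy_density a x \<xi> \<xi> + energy_density a x \<zeta> \<zeta>"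
    unfolding energy_density_add_left energy_density_add_right energy_density_scaleR
    using energy_density_commute[OF assms(1), of x \<xi> \<zeta>] by auto
  also have "\<dots> \<le> \<Lambda> * (norm \<xi>)\<^sup>2 + \<Lambda> * (norm \<zeta>)\<^sup>2"
    by (intro add_mono energy_density_bounds assms)
  finally show ?thesis by (simp add: distrib_left)
qed

lemma energy_density_integrable:
  assumes ell: "uniformly_elliptic \<Lambda> a" "1 \<le> \<Lambda>" and sq: "square_integrable U g" "square_integrable U w"
  shows "(\<lambda>x. energy_density a x (g x) (w x)) \<in> borel_measurable (lebesgue_on U)"
    and "integrable (lebesgue_on U) (\<lambda>x. energy_density a x (g x) (w x))"
proof -
  have "(\<lambda>x. a x i j) \<in> borel_measurable (lebesgue_on U)" if "i \<in> Basis" "j \<in> Basis" for i j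
    using ell(1) that unfolding uniformly_elliptic_def by (intro measurable_restrict_space1) auto
  then show m: "(\<lambda>x. energy_density a x (g x) (w x)) \<in> borel_measurable (lebesgue_on U)"
    using sq unfolding energy_density_def square_integrable_def
    by (intro borel_measurable_sum borel_measurable_times) auto
  show "integrable (lebesgue_on U) (\<lambda>x. energy_density a x (g x) (w x))"
  proof (rule Bochner_Integration.integrable_bound)
    show "integrable (lebesgue_on U) (\<lambda>x. \<Lambda> * ((norm (g x))\<^sup>2 + (norm (w x))\<^sup>2))"
      using sq by (simp add: square_integrable_def)
    show "AE x in lebesgue_on U. norm (energy_density a x (g x) (w x)) \<le> norm (\<Lambda> * ((norm (g x))\<^sup>2 + (norm (w x))\<^sup>2))"
      using energy_density_abs_le[OF ell] ell(2) by (simp add: abs_mult)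
  qed (rule m)
qed

lemma dirichlet_form_eq:
  assumes U: "open U" and ell: "uniformly_elliptic \<Lambda> a" "1 \<le> \<Lambda>"
    and W: "W012_with_gradient U u g" "W012_with_gradient U v w"
  shows "dirichlet_form a U u v = (LINT x|lebesgue_on U. energy_density a x (g x) (w x))"
proof -
  have sq: "square_integrable U g" "square_integrable U w"
    using W by (auto simp: W012_with_gradient_def)
  have sq': "square_integrable U (weak_gradient U u)" "square_integrable U (weak_gradient U v)"
    using W012_imp_with_gradient[OF W012_with_gradient_imp_W012(1)[OF U W(1)]]
      W012_imp_with_gradient[OF W012_with_gradient_imp_W012(1)[OF U W(2)]]
    by (auto simp: W012_with_gradient_def)
  have "(LINT x|lebesgue_on U. energy_density a x (weak_gradient U u x) (weak_gradient U v x))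
     = (LINT x|lebesgue_on U. energy_density a x (g x) (w x))"
  proof (rule integral_cong_AE)
    show "AE x in lebesgue_on U. energy_density a x (weak_gradient U u x) (weak_gradient U v x) = energy_density a x (g x) (w x)"
      using W012_with_gradient_imp_W012(2)[OF U W(1)] W012_with_gradient_imp_W012(2)[OF U W(2)]
      by eventually_elim simp
  qed (intro energy_density_integrable(1)[OF ell] sq sq')+
  then show ?thesis by (simp add: dirichlet_form_def energy_density_def)
qed

section \<open>Energy estimates for the principal eigenfunction\<close>

lemma dirichlet_form_nonneg:
  assumes U: "open U" and ell: "uniformly_elliptic \<Lambda> a" "1 \<le> \<Lambda>" and u: "u \<in> W012 U"
  shows "0 \<le> dirichlet_form a U u u"
proof -
  have "0 \<le> energy_density a x \<xi> \<xi>" for x \<xi>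
    using energy_density_bounds(1)[OF ell(1), of \<xi> x] ell(2)
    by (smt (verit) inverse_nonnegative_iff_nonnegative mult_nonneg_nonneg zero_le_power2)
  then show ?thesis
    unfolding dirichlet_form_eq[OF U ell W012_imp_with_gradient[OF u] W012_imp_with_gradient[OF u]] by simp
qed

lemma dirichlet_eigenvalue_le:
  assumes U: "open U" and ell: "uniformly_elliptic \<Lambda> a" "1 \<le> \<Lambda>" and u: "u \<in> W012 U"
    and pos: "0 < (LINT x|lebesgue_on U. (u x)\<^sup>2)"
  shows "dirichlet_eigenvalue a U \<le> dirichlet_form a U u u / (LINT x|lebesgue_on U. (u x)\<^sup>2)"
  unfolding dirichlet_eigenvalue_def
proof (rule cINF_lower)
  show "bdd_below ((\<lambda>u. dirichlet_form a U u u / (LINT x|lebesgue_on U. (u x)\<^sup>2)) `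
      {u \<in> W012 U. \<not> (AE x in lebesgue_on U. u x = 0)})"
    by (intro bdd_belowI[of _ 0]) (auto intro!: divide_nonneg_nonneg dirichlet_form_nonneg[OF U ell])
  have "\<not> (AE x in lebesgue_on U. u x = 0)"
  proof
    assume "AE x in lebesgue_on U. u x = 0"
    then have "AE x in lebesgue_on U. (u x)\<^sup>2 = 0" by eventually_elim simp
    then have "(LINT x|lebesgue_on U. (u x)\<^sup>2) = 0" by (rule integral_eq_zero_AE)
    with pos show False by simp
  qed
  with u show "u \<in> {u \<in> W012 U. \<not> (AE x in lebesgue_on U. u x = 0)}" by simp
qed

text \<open>The Rayleigh quotient of a cutoff equal to 1 on the half ball: its gradient is of order
  1/\<rho>, and the volumes of the ball and of the half ball have the ratio
  \<open>2 ^ DIM('a)\<close>.\<close>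

lemma dirichlet_eigenvalue_le_ball:
  obtains C where "C > 0"
    "\<And>(a::'a::euclidean_space \<Rightarrow> 'a \<Rightarrow> 'a \<Rightarrow> real) U \<Lambda> z \<rho>. open U \<Longrightarrow> uniformly_elliptic \<Lambda> a \<Longrightarrow> 1 \<le> \<Lambda> \<Longrightarrow>
      0 < \<rho> \<Longrightarrow> ball z \<rho> \<subseteq> U \<Longrightarrow> dirichlet_eigenvalue a U \<le> C * \<Lambda> / \<rho>\<^sup>2"
proof -
  obtain C where C: "C > 0" "\<And>(z::'a) s t x. 0 < s \<Longrightarrow> s < t \<Longrightarrow>
      norm (gradient (annulus_cutoff z s t) x) \<le> C / (t - s)"
    using annulus_cutoff_gradient_bound by blast
  have "dirichlet_eigenvalue a U \<le> (16 * C\<^sup>2 * 2 ^ DIM('a)) * \<Lambda> / \<rho>\<^sup>2"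
    if U: "open U" and ell: "uniformly_elliptic \<Lambda> a" "1 \<le> \<Lambda>" and \<rho>: "0 < \<rho>" "ball z \<rho> \<subseteq> U"
    for a :: "'a \<Rightarrow> 'a \<Rightarrow> 'a \<Rightarrow> real" and U \<Lambda> z \<rho>
  proof -
    \<comment> \<open>Stopping at 3\<rho>/4 keeps the support a compact subset of \<open>U\<close>,
      although only the open ball of radius \<rho> is known to lie in \<open>U\<close>.\<close>
    define h where "h = annulus_cutoff z (\<rho> / 2) (3 * \<rho> / 4)"
    note c = annulus_cutoff[of "\<rho> / 2" "3 * \<rho> / 4", where z = z, folded h_def]
    have h: "h \<in> test_functions U"
    proof (rule test_functionsI)
      show "smooth h" using c(1) \<rho>(1) by simp
      show "compact (cball z (3 * \<rho> / 4))" by simp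
      show "cball z (3 * \<rho> / 4) \<subseteq> U" using \<rho> by (auto simp: subset_eq)
      show "h x = 0" if "x \<notin> cball z (3 * \<rho> / 4)" for x using c(5)[of x] that \<rho>(1) by simp
    qed
    have g: "(norm (gradient h x))\<^sup>2 \<le> 16 * C\<^sup>2 / \<rho>\<^sup>2 * indicator (ball z \<rho>) x" for x
    proof (cases "x \<in> ball z \<rho>")
      case True
      have "norm (gradient h x) \<le> C / (3 * \<rho> / 4 - \<rho> / 2)" unfolding h_def using \<rho>(1) by (intro C(2)) auto
      then have "(norm (gradient h x))\<^sup>2 \<le> (C / (3 * \<rho> / 4 - \<rho> / 2))\<^sup>2" by (intro power_mono) auto
      also have "C / (3 * \<rho> / 4 - \<rho> / 2) = 4 * C / \<rho>" by (simp add: field_simps)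
      finally show ?thesis using True by (simp add: power_divide power_mult_distrib)
    next
      case False
      then show ?thesis using c(7)[of x] \<rho>(1) by simp
    qed
    note sq = test_functions_square_integrable[OF h U]
    note W = W012_with_gradient_test[OF U h]
    have Us: "U \<in> sets lebesgue" using U by simp
    have meas: "integrable (lebesgue_on U) (indicator A :: 'a \<Rightarrow> real)"
        "(LINT x|lebesgue_on U. indicator A x) = measure lborel A"
      if "A \<in> sets borel" "A \<subseteq> U" "bounded A" for A
    proof -
      have i: "integrable lborel (indicator A :: 'a \<Rightarrow> real)"
        using that emeasure_bounded_finite[OF that(3)] by (intro integrable_real_indicator) auto
      have z: "x \<notin> U \<Longrightarrow> indicator A x = (0::real)" for x using that by (auto simp: indicator_def)
      have m: "(indicator A :: 'a \<Rightarrow> real) \<in> borel_measurable borel" using that by simp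
      show "integrable (lebesgue_on U) (indicator A :: 'a \<Rightarrow> real)"
        using integral_lebesgue_on_eq_lborel(2)[OF m U z] i by simp
      show "(LINT x|lebesgue_on U. indicator A x) = measure lborel A"
        using integral_lebesgue_on_eq_lborel(1)[OF m U z] that(1) by simp
    qed
    have E: "dirichlet_form a U h h \<le> \<Lambda> * (16 * C\<^sup>2 / \<rho>\<^sup>2 * measure lborel (ball z \<rho>))"
    proof -
      have "dirichlet_form a U h h \<le> (LINT x|lebesgue_on U. \<Lambda> * (16 * C\<^sup>2 / \<rho>\<^sup>2 * indicator (ball z \<rho>) x))"
        unfolding dirichlet_form_eq[OF U ell W W]
      proof (rule integral_mono)
        show "integrable (lebesgue_on U) (\<lambda>x. energy_density a x (gradient h x) (gradient h x))"
          by (rule energy_density_integrable(2)[OF ell sq(2) sq(2)])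
        show "integrable (lebesgue_on U) (\<lambda>x. \<Lambda> * (16 * C\<^sup>2 / \<rho>\<^sup>2 * indicator (ball z \<rho>) x))"
          using meas(1)[of "ball z \<rho>"] \<rho> by simp
        fix x
        have "energy_density a x (gradient h x) (gradient h x) \<le> \<Lambda> * (norm (gradient h x))\<^sup>2"
          by (rule energy_density_bounds(2)[OF ell(1)])
        also have "\<dots> \<le> \<Lambda> * (16 * C\<^sup>2 / \<rho>\<^sup>2 * indicator (ball z \<rho>) x)"
          using ell(2) by (intro mult_left_mono g) auto
        finally show "energy_density a x (gradient h x) (gradient h x) \<le> \<Lambda> * (16 * C\<^sup>2 / \<rho>\<^sup>2 * indicator (ball z \<rho>) x)" .
      qed
      also have "\<dots> = \<Lambda> * (16 * C\<^sup>2 / \<rho>\<^sup>2 * measure lborel (ball z \<rho>))"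
        using meas[of "ball z \<rho>"] \<rho> by simp
      finally show ?thesis .
    qed
    have sub: "cball z (\<rho> / 2) \<subseteq> U" using \<rho> by (auto simp: subset_eq)
    have N: "measure lborel (cball z (\<rho> / 2)) \<le> (LINT x|lebesgue_on U. (h x)\<^sup>2)"
    proof -
      have "(LINT x|lebesgue_on U. indicator (cball z (\<rho> / 2)) x) \<le> (LINT x|lebesgue_on U. (h x)\<^sup>2)"
      proof (rule integral_mono)
        show "integrable (lebesgue_on U) (indicator (cball z (\<rho> / 2)) :: 'a \<Rightarrow> real)"
          using meas(1)[of "cball z (\<rho> / 2)"] sub by simp
        show "integrable (lebesgue_on U) (\<lambda>x. (h x)\<^sup>2)" using sq by (simp add: square_integrable_def)
        show "indicator (cball z (\<rho> / 2)) x \<le> (h x)\<^sup>2" for x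
          using c(4)[of x] \<rho>(1) by (auto simp: indicator_def)
      qed
      then show ?thesis using meas(2)[of "cball z (\<rho> / 2)"] sub by simp
    qed
    have vol: "measure lborel (ball z \<rho>) = 2 ^ DIM('a) * measure lborel (cball z (\<rho> / 2))"
      using \<rho>(1) content_ball[of \<rho> z] content_cball[of "\<rho> / 2" z] by (simp add: power_divide)
    have pos: "0 < measure lborel (cball z (\<rho> / 2))"
      using \<rho>(1) content_cball_pos[of "\<rho> / 2" z] by simp
    have "dirichlet_eigenvalue a U \<le> dirichlet_form a U h h / (LINT x|lebesgue_on U. (h x)\<^sup>2)"
      by (rule dirichlet_eigenvalue_le[OF U ell W012_with_gradient_imp_W012(1)[OF U W]])
        (use N pos in linarith)
    also have "\<dots> \<le> (\<Lambda> * (16 * C\<^sup>2 / \<rho>\<^sup>2 * measure lborel (ball z \<rho>))) / measure lborel (cball z (\<rho> / 2))"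
      using ell(2) by (intro frac_le E N pos) auto
    also have "\<dots> = (16 * C\<^sup>2 * 2 ^ DIM('a)) * \<Lambda> / \<rho>\<^sup>2"
      unfolding vol using pos by simp
    finally show ?thesis .
  qed
  then show thesis using C(1) by (intro that[of "16 * C\<^sup>2 * 2 ^ DIM('a)"]) auto
qed

text \<open>Testing the equation with \<phi> itself and using the normalisation shows that the
  eigenvalue equals the Dirichlet form of \<phi>; ellipticity compares this with the gradient
  integral.\<close>

lemma principal_eigenfunction_energy:
  assumes U: "open U" and ell: "uniformly_elliptic \<Lambda> a" "1 \<le> \<Lambda>" and \<phi>: "principal_eigenfunction a U \<phi>"
  shows "(LINT x|lebesgue_on U. (norm (weak_gradient U \<phi> x))\<^sup>2) \<le> \<Lambda> * dirichlet_eigenvalue a U"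
    and "0 \<le> dirichlet_eigenvalue a U"
proof -
  let ?G = "weak_gradient U \<phi>"
  have W: "W012_with_gradient U \<phi> ?G" and mem: "\<phi> \<in> W012 U"
    using \<phi> W012_imp_with_gradient by (auto simp: principal_eigenfunction_def)
  have sq: "square_integrable U ?G" using W by (auto simp: W012_with_gradient_def)
  have "dirichlet_eigenvalue a U = dirichlet_form a U \<phi> \<phi>"
    using \<phi> mem by (simp add: principal_eigenfunction_def power2_eq_square)
  also have "\<dots> = (LINT x|lebesgue_on U. energy_density a x (?G x) (?G x))"
    by (rule dirichlet_form_eq[OF U ell W W])
  also have "\<dots> \<ge> (LINT x|lebesgue_on U. inverse \<Lambda> * (norm (?G x))\<^sup>2)"
    using sq by (intro integral_mono energy_density_bounds(1)[OF ell(1)] energy_density_integrable(2)[OF ell])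
      (auto simp: square_integrable_def)
  finally have le: "inverse \<Lambda> * (LINT x|lebesgue_on U. (norm (?G x))\<^sup>2) \<le> dirichlet_eigenvalue a U" by simp
  then show "(LINT x|lebesgue_on U. (norm (?G x))\<^sup>2) \<le> \<Lambda> * dirichlet_eigenvalue a U"
    using ell(2) by (simp add: field_simps)
  have "0 \<le> inverse \<Lambda> * (LINT x|lebesgue_on U. (norm (?G x))\<^sup>2)"
    using ell(2) by (intro mult_nonneg_nonneg integral_nonneg) auto
  with le show "0 \<le> dirichlet_eigenvalue a U" by linarith
qed

text \<open>The energy estimate for truncations. The gradient \<open>g\<close> is returned together
  with the places where it vanishes, because the Sobolev inequality will be applied with the measure
  of the remaining set. The level k = 0 gives the estimate for the positive function \<phi>
  itself.\<close>

lemma Caccioppoli: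
  assumes U: "open U" "bounded U" and ell: "uniformly_elliptic \<Lambda> a" "1 \<le> \<Lambda>"
    and \<phi>: "principal_eigenfunction a U \<phi>" and k: "0 \<le> k" and \<eta>: "smooth \<eta>"
  obtains g where
    "W012_with_gradient U (\<lambda>x. \<eta> x * max (\<phi> x - k) 0) g"
    "\<And>x. x \<in> U \<Longrightarrow> \<phi> x \<le> k \<Longrightarrow> g x = 0"
    "\<And>x. x \<in> U \<Longrightarrow> \<eta> x = 0 \<Longrightarrow> gradient \<eta> x = 0 \<Longrightarrow> g x = 0"
    "integrable (lebesgue_on U) (\<lambda>x. (\<eta> x)\<^sup>2 * (\<phi> x * max (\<phi> x - k) 0))"
    "integrable (lebesgue_on U) (\<lambda>x. (max (\<phi> x - k) 0)\<^sup>2 * (norm (gradient \<eta> x))\<^sup>2)"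
    "(LINT x|lebesgue_on U. (norm (g x))\<^sup>2) \<le>
      \<Lambda> * (dirichlet_eigenvalue a U * (LINT x|lebesgue_on U. (\<eta> x)\<^sup>2 * (\<phi> x * max (\<phi> x - k) 0))
        + \<Lambda> * (LINT x|lebesgue_on U. (max (\<phi> x - k) 0)\<^sup>2 * (norm (gradient \<eta> x))\<^sup>2))"
proof -
  define v where "v x = max (\<phi> x - k) 0" for x
  let ?G = "weak_gradient U \<phi>"
  have W: "W012_with_gradient U \<phi> ?G"
    using \<phi> W012_imp_with_gradient by (auto simp: principal_eigenfunction_def)
  define G' where "G' x = (if k < \<phi> x then 1 else 0) *\<^sub>R ?G x" for x
  have Wv: "W012_with_gradient U v G'"
    unfolding v_def G'_def by (rule W012_with_gradient_positive_part[OF U(1) k W])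
  define g where "g x = \<eta> x *\<^sub>R G' x + v x *\<^sub>R gradient \<eta> x" for x
  have Ww: "W012_with_gradient U (\<lambda>x. \<eta> x * v x) g"
    unfolding g_def by (rule W012_with_gradient_mult[OF U \<eta> Wv])
  define g2 where "g2 x = \<eta> x *\<^sub>R g x + (\<eta> x * v x) *\<^sub>R gradient \<eta> x" for x
  have W2: "W012_with_gradient U (\<lambda>x. \<eta> x * (\<eta> x * v x)) g2"
    unfolding g2_def by (rule W012_with_gradient_mult[OF U \<eta> Ww])
  \<comment> \<open>By the symmetry of \<open>a\<close>, the cross terms of the energy of \<open>\<eta> v\<close> are absorbed by the test
    function \<open>\<eta>\<^sup>2 v\<close>.\<close>
  have pw: "energy_density a x (g x) (g x) = energy_density a x (?G x) (g2 x)
      + (v x)\<^sup>2 * energy_density a x (gradient \<eta> x) (gradient \<eta> x)" for x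
  proof (cases "k < \<phi> x")
    case True
    then have "G' x = ?G x" by (simp add: G'_def)
    then show ?thesis
      unfolding g2_def g_def energy_density_add_left energy_density_add_right energy_density_scaleR
      using energy_density_commute[OF ell(1), of x "gradient \<eta> x" "?G x"]
      by (simp add: power2_eq_square algebra_simps energy_density_add_right energy_density_scaleR)
  next
    case False
    then have "v x = 0" "G' x = 0" by (auto simp: v_def G'_def)
    then show ?thesis by (simp add: g_def g2_def energy_density_def)
  qed
  have sq: "square_integrable U \<phi>" "square_integrable U ?G" "square_integrable U v" "square_integrable U g"
      "square_integrable U g2" "square_integrable U (\<lambda>x. \<eta> x * (\<eta> x * v x))"
    using W Wv Ww W2 by (auto simp: W012_with_gradient_def)
  obtain B where B: "B > 0" "\<And>x. x \<in> U \<Longrightarrow> \<bar>\<eta> x\<bar> \<le> B" "\<And>x. x \<in> U \<Longrightarrow> norm (gradient \<eta> x) \<le> B"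
    using smooth_bounded_on[OF \<eta> U(2)] by blast
  have sqv: "square_integrable U (\<lambda>x. v x *\<^sub>R gradient \<eta> x)"
    by (rule square_integrable_scaled_vector[OF sq(3) smooth_measurable(2)[OF \<eta>] B(3)])
  have i1: "integrable (lebesgue_on U) (\<lambda>x. (\<eta> x)\<^sup>2 * (\<phi> x * v x))"
    using square_integrable_mult[OF sq(1) sq(6)] by (simp add: power2_eq_square mult_ac)
  have i2: "integrable (lebesgue_on U) (\<lambda>x. (v x)\<^sup>2 * (norm (gradient \<eta> x))\<^sup>2)"
    using sqv by (simp add: square_integrable_def power_mult_distrib)
  have i3: "integrable (lebesgue_on U) (\<lambda>x. (v x)\<^sup>2 * energy_density a x (gradient \<eta> x) (gradient \<eta> x))"
    using energy_density_integrable(2)[OF ell sqv sqv]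
    by (simp add: energy_density_scaleR power2_eq_square mult_ac)
  note i4 = energy_density_integrable(2)[OF ell sq(2) sq(5)]
  have "inverse \<Lambda> * (LINT x|lebesgue_on U. (norm (g x))\<^sup>2) = (LINT x|lebesgue_on U. inverse \<Lambda> * (norm (g x))\<^sup>2)"
    by simp
  also have "\<dots> \<le> (LINT x|lebesgue_on U. energy_density a x (g x) (g x))"
    using sq(4) by (intro integral_mono energy_density_bounds(1)[OF ell(1)] energy_density_integrable(2)[OF ell])
      (auto simp: square_integrable_def)
  also have "\<dots> = (LINT x|lebesgue_on U. energy_density a x (?G x) (g2 x))
      + (LINT x|lebesgue_on U. (v x)\<^sup>2 * energy_density a x (gradient \<eta> x) (gradient \<eta> x))"
    unfolding pw by (rule Bochner_Integration.integral_add[OF i4 i3])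
  also have "(LINT x|lebesgue_on U. energy_density a x (?G x) (g2 x)) = dirichlet_form a U \<phi> (\<lambda>x. \<eta> x * (\<eta> x * v x))"
    by (rule dirichlet_form_eq[OF U(1) ell W W2, symmetric])
  also have "\<dots> = dirichlet_eigenvalue a U * (LINT x|lebesgue_on U. (\<phi> x * (\<eta> x * (\<eta> x * v x))))"
    using \<phi> W012_with_gradient_imp_W012(1)[OF U(1) W2] unfolding principal_eigenfunction_def by blast
  also have "(LINT x|lebesgue_on U. (\<phi> x * (\<eta> x * (\<eta> x * v x)))) = (LINT x|lebesgue_on U. (\<eta> x)\<^sup>2 * (\<phi> x * v x))"
    by (rule Bochner_Integration.integral_cong) (auto simp: power2_eq_square mult_ac)
  also have "(LINT x|lebesgue_on U. (v x)\<^sup>2 * energy_density a x (gradient \<eta> x) (gradient \<eta> x))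
      \<le> (LINT x|lebesgue_on U. \<Lambda> * ((v x)\<^sup>2 * (norm (gradient \<eta> x))\<^sup>2))"
  proof (rule integral_mono[OF i3])
    show "integrable (lebesgue_on U) (\<lambda>x. \<Lambda> * ((v x)\<^sup>2 * (norm (gradient \<eta> x))\<^sup>2))" using i2 by simp
    fix x
    show "(v x)\<^sup>2 * energy_density a x (gradient \<eta> x) (gradient \<eta> x) \<le> \<Lambda> * ((v x)\<^sup>2 * (norm (gradient \<eta> x))\<^sup>2)"
      using mult_left_mono[OF energy_density_bounds(2)[OF ell(1), of x "gradient \<eta> x"], of "(v x)\<^sup>2"]
      by (simp add: mult_ac)
  qed
  finally have "inverse \<Lambda> * (LINT x|lebesgue_on U. (norm (g x))\<^sup>2)
      \<le> dirichlet_eigenvalue a U * (LINT x|lebesgue_on U. (\<eta> x)\<^sup>2 * (\<phi> x * v x))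
        + \<Lambda> * (LINT x|lebesgue_on U. (v x)\<^sup>2 * (norm (gradient \<eta> x))\<^sup>2)" by simp
  then have "\<Lambda> * (inverse \<Lambda> * (LINT x|lebesgue_on U. (norm (g x))\<^sup>2))
      \<le> \<Lambda> * (dirichlet_eigenvalue a U * (LINT x|lebesgue_on U. (\<eta> x)\<^sup>2 * (\<phi> x * v x))
        + \<Lambda> * (LINT x|lebesgue_on U. (v x)\<^sup>2 * (norm (gradient \<eta> x))\<^sup>2))"
    using ell(2) by (intro mult_left_mono) auto
  then have "(LINT x|lebesgue_on U. (norm (g x))\<^sup>2)
      \<le> \<Lambda> * (dirichlet_eigenvalue a U * (LINT x|lebesgue_on U. (\<eta> x)\<^sup>2 * (\<phi> x * v x))
        + \<Lambda> * (LINT x|lebesgue_on U. (v x)\<^sup>2 * (norm (gradient \<eta> x))\<^sup>2))"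
    using ell(2) by (simp add: mult.assoc[symmetric])
  moreover have "g x = 0" if "\<phi> x \<le> k" for x using that by (simp add: g_def v_def G'_def)
  moreover have "g x = 0" if "\<eta> x = 0" "gradient \<eta> x = 0" for x using that by (simp add: g_def)
  ultimately show thesis
    using that[OF Ww[unfolded v_def]] i1 i2 unfolding v_def by blast
qed

lemma tendsto_integral_norm_square:
  assumes sq: "\<And>k. square_integrable U (f k)" "square_integrable U g"
    and lim: "(\<lambda>k. LINT x|lebesgue_on U. (norm (g x - f k x))\<^sup>2) \<longlonglongrightarrow> 0"
  shows "(\<lambda>k. LINT x|lebesgue_on U. (norm (f k x))\<^sup>2) \<longlonglongrightarrow> (LINT x|lebesgue_on U. (norm (g x))\<^sup>2)"
proof -
  have sqd: "square_integrable U (\<lambda>x. g x - f k x)" for k by (intro square_integrable_diff sq)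
  have n: "square_integrable U (\<lambda>x. norm (w x))" if "square_integrable U w" for w :: "'a \<Rightarrow> 'b"
    using that by (auto simp: square_integrable_def)
  have "(\<lambda>k. LINT x|lebesgue_on U. norm (g x - f k x) * norm (g x)) \<longlonglongrightarrow> 0"
    by (rule tendsto_integral_mult_zero[OF n[OF sqd] n[OF sq(2)] lim])
  then have "(\<lambda>k. (LINT x|lebesgue_on U. (norm (g x - f k x))\<^sup>2)
      + 2 * (LINT x|lebesgue_on U. norm (g x - f k x) * norm (g x))) \<longlonglongrightarrow> 0 + 2 * 0"
    by (intro tendsto_intros lim)
  then have lim': "(\<lambda>k. (LINT x|lebesgue_on U. (norm (g x - f k x))\<^sup>2)
      + 2 * (LINT x|lebesgue_on U. norm (g x - f k x) * norm (g x))) \<longlonglongrightarrow> 0" by simp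
  have "norm ((LINT x|lebesgue_on U. (norm (f k x))\<^sup>2) - (LINT x|lebesgue_on U. (norm (g x))\<^sup>2))
      \<le> (LINT x|lebesgue_on U. (norm (g x - f k x))\<^sup>2)
      + 2 * (LINT x|lebesgue_on U. norm (g x - f k x) * norm (g x))" for k
  proof -
    have i: "integrable (lebesgue_on U) (\<lambda>x. (norm (f k x))\<^sup>2)" "integrable (lebesgue_on U) (\<lambda>x. (norm (g x))\<^sup>2)"
      "integrable (lebesgue_on U) (\<lambda>x. (norm (g x - f k x))\<^sup>2)"
      "integrable (lebesgue_on U) (\<lambda>x. norm (g x - f k x) * norm (g x))"
      using sq(1)[of k] sq(2) sqd[of k] square_integrable_mult[OF n[OF sqd[of k]] n[OF sq(2)]]
      by (auto simp: square_integrable_def)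
    have "norm ((LINT x|lebesgue_on U. (norm (f k x))\<^sup>2) - (LINT x|lebesgue_on U. (norm (g x))\<^sup>2))
      = norm (LINT x|lebesgue_on U. (norm (f k x))\<^sup>2 - (norm (g x))\<^sup>2)" using i by simp
    also have "\<dots> \<le> (LINT x|lebesgue_on U. norm ((norm (f k x))\<^sup>2 - (norm (g x))\<^sup>2))"
      by (rule integral_norm_bound)
    also have "\<dots> \<le> (LINT x|lebesgue_on U. (norm (g x - f k x))\<^sup>2 + 2 * (norm (g x - f k x) * norm (g x)))"
    proof (rule integral_mono)
      fix x
      have "(norm (f k x))\<^sup>2 - (norm (g x))\<^sup>2 = (norm (g x - f k x))\<^sup>2 - 2 * ((g x - f k x) \<bullet> g x)"
        unfolding power2_norm_eq_inner by (simp add: inner_diff inner_commute algebra_simps)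
      moreover have "\<bar>(g x - f k x) \<bullet> g x\<bar> \<le> norm (g x - f k x) * norm (g x)" by (rule Cauchy_Schwarz_ineq2)
      moreover have "0 \<le> (norm (g x - f k x))\<^sup>2" by simp
      ultimately show "norm ((norm (f k x))\<^sup>2 - (norm (g x))\<^sup>2) \<le> (norm (g x - f k x))\<^sup>2 + 2 * (norm (g x - f k x) * norm (g x))"
        unfolding real_norm_def by linarith
    qed (use i in auto)
    finally show ?thesis using i by simp
  qed
  then show ?thesis by (subst LIM_zero_iff[symmetric]) (rule Lim_null_comparison[OF _ lim'], simp)
qed

section \<open>One-dimensional estimates\<close>

text \<open>Stated with a nonnegative integral in \<open>ennreal\<close>, so that it can later be
  integrated over the other coordinate by Tonelli.\<close>

lemma FTC_abs_le:
  fixes F f :: "real \<Rightarrow> real"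
  assumes "a \<le> b" "\<And>x. DERIV F x :> f x" "continuous_on UNIV f"
  shows "ennreal \<bar>F b - F a\<bar> \<le> (\<integral>\<^sup>+x. ennreal \<bar>f x\<bar> * indicator {a..b} x \<partial>lborel)"
proof -
  have "integrable lborel (\<lambda>x. indicator {a..b} x *\<^sub>R f x)"
    using assms(3) by (intro borel_integrable_compact) (auto intro: continuous_on_subset)
  then have "ennreal (norm (\<integral>x. indicator {a..b} x *\<^sub>R f x \<partial>lborel)) \<le> (\<integral>\<^sup>+x. norm (indicator {a..b} x *\<^sub>R f x) \<partial>lborel)"
    by (rule integral_norm_bound_ennreal)
  moreover have "(\<integral>x. indicator {a..b} x *\<^sub>R f x \<partial>lborel) = F b - F a"
    using assms by (intro integral_FTC_Icc)
      (auto simp: has_real_derivative_iff_has_vector_derivative[symmetric] intro: has_field_derivative_at_within continuous_on_subset)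
  moreover have "ennreal (norm (indicator {a..b} x *\<^sub>R f x)) = ennreal \<bar>f x\<bar> * indicator {a..b} x" for x
    by (auto simp: indicator_def)
  ultimately show ?thesis by simp
qed

lemma FTC_square_le:
  fixes F f :: "real \<Rightarrow> real"
  assumes "a \<le> b" "\<And>x. DERIV F x :> f x" "continuous_on UNIV f"
  shows "ennreal ((F b - F a)\<^sup>2) \<le> ennreal (b - a) * (\<integral>\<^sup>+x. ennreal ((f x)\<^sup>2) * indicator {a..b} x \<partial>lborel)"
proof -
  have fm: "f \<in> borel_measurable borel" using assms(3) by (rule borel_measurable_continuous_onI)
  have "ennreal ((F b - F a)\<^sup>2) = (ennreal \<bar>F b - F a\<bar>)\<^sup>2"
    by (simp add: ennreal_power)
  also have "\<dots> \<le> (\<integral>\<^sup>+x. ennreal \<bar>f x\<bar> * indicator {a..b} x \<partial>lborel)\<^sup>2"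
    by (rule power_mono[OF FTC_abs_le[OF assms]]) simp
  also have "(\<integral>\<^sup>+x. ennreal \<bar>f x\<bar> * indicator {a..b} x \<partial>lborel)
      = (\<integral>\<^sup>+x. (ennreal \<bar>f x\<bar> * indicator {a..b} x) * indicator {a..b} x \<partial>lborel)"
    by (rule nn_integral_cong) (auto simp: indicator_def)
  also have "\<dots>\<^sup>2 \<le> (\<integral>\<^sup>+x. (ennreal \<bar>f x\<bar> * indicator {a..b} x)^2 \<partial>lborel) * (\<integral>\<^sup>+x. (indicator {a..b} x)^2 \<partial>lborel)"
    using fm by (intro Cauchy_Schwarz_nn_integral) auto
  also have "(\<integral>\<^sup>+x. (ennreal \<bar>f x\<bar> * indicator {a..b} x)^2 \<partial>lborel) = (\<integral>\<^sup>+x. ennreal ((f x)\<^sup>2) * indicator {a..b} x \<partial>lborel)"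
    by (rule nn_integral_cong) (auto simp: indicator_def ennreal_power)
  also have "(\<integral>\<^sup>+x. (indicator {a..b} x)^2 \<partial>lborel) = (\<integral>\<^sup>+x. indicator {a..b} x \<partial>lborel)"
    by (rule nn_integral_cong) (auto simp: indicator_def)
  also have "\<dots> = ennreal (b - a)" using assms(1) by simp
  finally show ?thesis by (simp add: mult.commute)
qed

text \<open>A test function vanishes at both ends. Integrating the derivative from either end and
  applying Cauchy-Schwarz costs the distance to that end.\<close>

lemma interval_test_function_bound:
  fixes h :: "real \<Rightarrow> real"
  assumes h: "h \<in> test_functions {u1<..<u2}" and x: "x \<in> {u1<..<u2}"
  shows "(h x)\<^sup>2 \<le> min (x - u1) (u2 - x) * (LINT x|lebesgue_on {u1<..<u2}. (norm (gradient h x))\<^sup>2)"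
proof -
  let ?U = "{u1<..<u2}"
  have U: "open ?U" by simp
  have sm: "smooth h" by (rule test_functions_smooth[OF h])
  have d: "DERIV h y :> gradient h y" for y using smooth_GDERIV[OF sm, of y] by simp
  have c: "continuous_on UNIV (gradient h)" by (rule smooth_gradient_continuous[OF sm])
  have m: "(\<lambda>y. (norm (gradient h y))\<^sup>2) \<in> borel_measurable borel"
    using test_functions_measurable(2)[OF h] by simp
  have z: "(norm (gradient h y))\<^sup>2 = 0" if "y \<notin> ?U" for y using test_functions_outside(2)[OF h that] by simp
  have i: "integrable lborel (\<lambda>y. (norm (gradient h y))\<^sup>2)"
    using test_functions_square_integrable(2)[OF h U] integral_lebesgue_on_eq_lborel(2)[OF m U z]
    by (simp add: square_integrable_def)
  let ?I = "LINT x|lebesgue_on ?U. (norm (gradient h x))\<^sup>2"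
  have I: "(\<integral>\<^sup>+y. ennreal ((gradient h y)\<^sup>2) \<partial>lborel) = ennreal ?I"
    using nn_integral_eq_integral[OF i] integral_lebesgue_on_eq_lborel(1)[OF m U z] by simp
  have le: "(h b - h a)\<^sup>2 \<le> (b - a) * ?I" if "a \<le> b" for a b
  proof -
    have "ennreal ((h b - h a)\<^sup>2) \<le> ennreal (b - a) * (\<integral>\<^sup>+y. ennreal ((gradient h y)\<^sup>2) * indicator {a..b} y \<partial>lborel)"
      by (rule FTC_square_le[OF that d c])
    also have "\<dots> \<le> ennreal (b - a) * (\<integral>\<^sup>+y. ennreal ((gradient h y)\<^sup>2) \<partial>lborel)"
      by (intro mult_left_mono nn_integral_mono) (auto simp: indicator_def)
    also have "\<dots> = ennreal ((b - a) * ?I)"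
      unfolding I using that by (simp add: ennreal_mult)
    finally show ?thesis using that by (subst (asm) ennreal_le_iff) auto
  qed
  have "h u1 = 0" "h u2 = 0" using test_functions_outside(1)[OF h] by auto
  then show ?thesis using le[of u1 x] le[of x u2] x by (auto simp: min_def power2_commute[of 0])
qed

text \<open>The set where the inequality fails is open by continuity, and a nonempty open set is not
  negligible. This converts almost everywhere bounds into bounds at the given point.\<close>

lemma continuous_AE_le:
  fixes f :: "'a::euclidean_space \<Rightarrow> real"
  assumes U: "open U" and f: "continuous_on U f" and g: "continuous_on U g"
    and ae: "AE x in lebesgue_on U. f x \<le> g x" and x: "x \<in> U"
  shows "f x \<le> g x"
proof (rule ccontr)
  assume n: "\<not> f x \<le> g x"
  define S where "S = U \<inter> (\<lambda>y. f y - g y) -` {0<..}"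
  have S: "open S"
    unfolding S_def by (rule continuous_open_preimage[OF continuous_on_diff[OF f g] U open_greaterThan])
  have "x \<in> S" using n x by (simp add: S_def)
  have "AE y in lebesgue. y \<in> U \<longrightarrow> f y \<le> g y"
    using ae AE_restrict_space_iff[of U lebesgue] U by simp
  then have "AE y in lebesgue. y \<notin> S" by eventually_elim (auto simp: S_def)
  then have "S \<in> null_sets lebesgue" using S by (subst AE_iff_null_sets) auto
  then have "negligible S" by (simp add: negligible_iff_null_sets)
  then show False using open_not_negligible[OF S] \<open>x \<in> S\<close> by blast
qed

text \<open>The bound for test functions passes to \<phi> almost everywhere along a subsequence, and
  then to \<open>x\<close> itself by continuity.\<close>

lemma interval_eigenfunction_bound:
  assumes ell: "uniformly_elliptic \<Lambda> a" "1 \<le> \<Lambda>" and \<phi>: "principal_eigenfunction a {u1<..<u2} \<phi>"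
    and x: "x \<in> {u1<..<u2}"
  shows "(\<phi> x)\<^sup>2 \<le> min (x - u1) (u2 - x) * (\<Lambda> * dirichlet_eigenvalue a {u1<..<u2})"
proof -
  let ?U = "{u1<..<u2}" and ?G = "weak_gradient {u1<..<u2} \<phi>"
  have U: "open ?U" by simp
  have W: "W012_with_gradient ?U \<phi> ?G"
    using \<phi> W012_imp_with_gradient by (auto simp: principal_eigenfunction_def)
  then have sq: "square_integrable ?U ?G" by (simp add: W012_with_gradient_def)
  obtain h where h: "\<And>k::nat. h k \<in> test_functions ?U"
    and l2: "(\<lambda>k. LINT x|lebesgue_on ?U. (norm (?G x - gradient (h k) x))\<^sup>2) \<longlonglongrightarrow> 0"
    and ae: "AE x in lebesgue_on ?U. (\<lambda>k. h k x) \<longlonglongrightarrow> \<phi> x"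
    using W012_with_gradient_AE_seq[OF U W] by blast
  let ?I = "LINT x|lebesgue_on ?U. (norm (?G x))\<^sup>2"
  have lim: "(\<lambda>k. LINT x|lebesgue_on ?U. (norm (gradient (h k) x))\<^sup>2) \<longlonglongrightarrow> ?I"
    by (rule tendsto_integral_norm_square[OF test_functions_square_integrable(2)[OF h U] sq l2])
  have "(\<phi> x)\<^sup>2 \<le> min (x - u1) (u2 - x) * ?I"
  proof (rule continuous_AE_le[OF U _ _ _ x])
    show "continuous_on ?U (\<lambda>x. (\<phi> x)\<^sup>2)"
      using \<phi> by (auto simp: principal_eigenfunction_def intro!: continuous_intros)
    show "continuous_on ?U (\<lambda>x. min (x - u1) (u2 - x) * ?I)"
      by (intro continuous_intros)
    show "AE x in lebesgue_on ?U. (\<phi> x)\<^sup>2 \<le> min (x - u1) (u2 - x) * ?I"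
      using ae AE_space
    proof eventually_elim
      case (elim x)
      then have xU: "x \<in> ?U" by simp
      show ?case
      proof (rule LIMSEQ_le)
        show "(\<lambda>k. (h k x)\<^sup>2) \<longlonglongrightarrow> (\<phi> x)\<^sup>2" using elim by (intro tendsto_intros)
        show "(\<lambda>k. min (x - u1) (u2 - x) * (LINT x|lebesgue_on ?U. (norm (gradient (h k) x))\<^sup>2))
            \<longlonglongrightarrow> min (x - u1) (u2 - x) * ?I" by (intro tendsto_intros lim)
        show "\<exists>N. \<forall>n\<ge>N. (h n x)\<^sup>2 \<le> min (x - u1) (u2 - x) * (LINT x|lebesgue_on ?U. (norm (gradient (h n) x))\<^sup>2)"
          using interval_test_function_bound[OF h xU] by blast
      qed
    qed
  qed
  also have "\<dots> \<le> min (x - u1) (u2 - x) * (\<Lambda> * dirichlet_eigenvalue a ?U)"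
    using x principal_eigenfunction_energy(1)[OF U ell \<phi>] by (intro mult_left_mono) auto
  finally show ?thesis .
qed

lemma interval_boundary_dist_ge:
  assumes "0 < \<beta>" "1 \<le> \<Lambda>"
  shows "\<exists>K>0. \<forall>(a :: real \<Rightarrow> real \<Rightarrow> real \<Rightarrow> real) (u1 :: real) (u2 :: real)
            (\<phi> :: real \<Rightarrow> real) (xU :: real).
          uniformly_elliptic \<Lambda> a \<and> u1 < u2 \<and>
          principal_eigenfunction a {u1<..<u2} \<phi> \<and>
          xU \<in> {u1<..<u2} \<and> \<phi> xU \<ge> \<beta> / sqrt (measure lebesgue {u1<..<u2}) \<longrightarrow>
          boundary_dist {u1<..<u2} xU \<ge> K * (u2 - u1)"
proof -
  obtain C where C: "C > 0"
    "\<And>(a::real \<Rightarrow> real \<Rightarrow> real \<Rightarrow> real) U \<Lambda> z \<rho>. open U \<Longrightarrow> uniformly_elliptic \<Lambda> a \<Longrightarrow> 1 \<le> \<Lambda> \<Longrightarrow>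
      0 < \<rho> \<Longrightarrow> ball z \<rho> \<subseteq> U \<Longrightarrow> dirichlet_eigenvalue a U \<le> C * \<Lambda> / \<rho>\<^sup>2"
    using dirichlet_eigenvalue_le_ball by blast
  \<comment> \<open>With L the length, the inscribed ball of radius L/2 bounds the eigenvalue by 4 C
    \<Lambda> / L^2, and the energy bound contributes one more \<Lambda>. Comparing the resulting
    upper bound for the square of \<phi> at the point with \<beta>^2 / L gives this value.\<close>
  define K where "K = \<beta>\<^sup>2 / (4 * C * \<Lambda>\<^sup>2)"
  have K: "K > 0" using assms C(1) by (simp add: K_def)
  have "K * (u2 - u1) \<le> boundary_dist {u1<..<u2} x"
    if ell: "uniformly_elliptic \<Lambda> a" and u: "u1 < u2" and \<phi>: "principal_eigenfunction a {u1<..<u2} \<phi>"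
      and x: "x \<in> {u1<..<u2}" and big: "\<phi> x \<ge> \<beta> / sqrt (measure lebesgue {u1<..<u2})"
    for a :: "real \<Rightarrow> real \<Rightarrow> real \<Rightarrow> real" and u1 u2 \<phi> x
  proof -
    define L where "L = u2 - u1"
    have L: "L > 0" using u by (simp add: L_def)
    have sub: "ball ((u1 + u2) / 2) (L / 2) \<subseteq> {u1<..<u2}"
      by (auto simp: dist_real_def L_def abs_less_iff field_simps)
    have ev: "dirichlet_eigenvalue a {u1<..<u2} \<le> C * \<Lambda> / (L / 2)\<^sup>2"
      by (rule C(2)[OF _ ell assms(2) _ sub]) (use L in auto)
    have "measure lebesgue {u1<..<u2} = L" using u by (simp add: L_def)
    with big have "\<beta> / sqrt L \<le> \<phi> x" by simp
    then have "(\<beta> / sqrt L)\<^sup>2 \<le> (\<phi> x)\<^sup>2" using assms L by (intro power_mono) auto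
    then have "\<beta>\<^sup>2 / L \<le> (\<phi> x)\<^sup>2" using L by (simp add: power_divide)
    also have "\<dots> \<le> min (x - u1) (u2 - x) * (\<Lambda> * dirichlet_eigenvalue a {u1<..<u2})"
      by (rule interval_eigenfunction_bound[OF ell assms(2) \<phi> x])
    also have "\<dots> \<le> min (x - u1) (u2 - x) * (\<Lambda> * (C * \<Lambda> / (L / 2)\<^sup>2))"
      using x assms(2) by (intro mult_left_mono ev) auto
    finally have "\<beta>\<^sup>2 / L \<le> min (x - u1) (u2 - x) * (4 * C * \<Lambda>\<^sup>2 / L\<^sup>2)"
      by (simp add: power2_eq_square mult_ac)
    then have "\<beta>\<^sup>2 / L * L\<^sup>2 \<le> min (x - u1) (u2 - x) * (4 * C * \<Lambda>\<^sup>2 / L\<^sup>2) * L\<^sup>2"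
      by (intro mult_right_mono) auto
    then have "\<beta>\<^sup>2 * L \<le> min (x - u1) (u2 - x) * (4 * C * \<Lambda>\<^sup>2)"
      using L by (simp add: power2_eq_square)
    then have le: "K * L \<le> min (x - u1) (u2 - x)"
    proof -
      have "K * L = \<beta>\<^sup>2 * L / (4 * C * \<Lambda>\<^sup>2)" by (simp add: K_def)
      also have "\<dots> \<le> min (x - u1) (u2 - x)"
        using \<open>\<beta>\<^sup>2 * L \<le> _\<close> C(1) assms by (subst pos_divide_le_eq) auto
      finally show ?thesis .
    qed
    have fr: "frontier {u1<..<u2} = {u1, u2}"
      using u by (auto simp: frontier_def closure_greaterThanLessThan interior_open)
    obtain y where "y \<in> {u1, u2}" "boundary_dist {u1<..<u2} x = dist x y"
      using infdist_attains_inf[of "{u1, u2}" x] unfolding fr by auto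
    then have "min (x - u1) (u2 - x) \<le> boundary_dist {u1<..<u2} x"
      using x by (auto simp: dist_real_def)
    with le show ?thesis unfolding L_def by linarith
  qed
  with K show ?thesis by blast
qed

section \<open>Sobolev and Poincare inequalities in the plane\<close>

definition plane_point :: "real \<Rightarrow> real \<Rightarrow> real^2" where
  "plane_point x y = x *\<^sub>R axis 1 1 + y *\<^sub>R axis 2 1"

lemma plane_point_nth [simp]: "plane_point x y $ 1 = x" "plane_point x y $ 2 = y"
  by (simp_all add: plane_point_def axis_def)

lemma Basis_real2: "(Basis :: (real^2) set) = {axis 1 1, axis 2 1}"
  by (auto simp: Basis_vec_def exhaust_2 UNIV_2)

lemma axis_neq_real2: "axis 1 (1::real) \<noteq> (axis 2 1 :: real^2)"
  by (simp add: axis_eq_axis)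

lemma plane_point_measurable: "(\<lambda>p. plane_point (fst p) (snd p)) \<in> borel_measurable (lborel \<Otimes>\<^sub>M lborel)"
proof -
  have "continuous_on UNIV (\<lambda>p. plane_point (fst p) (snd p))"
    unfolding plane_point_def by (intro continuous_intros)
  then have "(\<lambda>p. plane_point (fst p) (snd p)) \<in> borel_measurable borel"
    by (rule borel_measurable_continuous_onI)
  then show ?thesis by (simp add: lborel_prod)
qed

text \<open>Lebesgue measure is determined by its values on boxes, whose preimages under the
  coordinate map are products of intervals. This makes Tonelli available in the type
  \<open>real^2\<close>.\<close>

lemma lborel_real2:
  "(lborel :: (real^2) measure) = distr (lborel \<Otimes>\<^sub>M lborel) borel (\<lambda>p. plane_point (fst p) (snd p))"
proof (rule lborel_eqI)
  fix l u :: "real^2"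
  assume lu: "\<And>b. b \<in> Basis \<Longrightarrow> l \<bullet> b \<le> u \<bullet> b"
  have le: "l $ 1 \<le> u $ 1" "l $ 2 \<le> u $ 2"
    using lu[of "axis 1 1"] lu[of "axis 2 1"] by (auto simp: Basis_real2 inner_axis)
  have eq: "(\<lambda>p. plane_point (fst p) (snd p)) -` box l u \<inter> space (lborel \<Otimes>\<^sub>M lborel)
      = box (l $ 1) (u $ 1) \<times> box (l $ 2) (u $ 2)"
    by (auto simp: mem_box_cart forall_2 space_pair_measure)
  have "emeasure (distr (lborel \<Otimes>\<^sub>M lborel) borel (\<lambda>p. plane_point (fst p) (snd p))) (box l u)
      = emeasure lborel (box (l $ 1) (u $ 1)) * emeasure lborel (box (l $ 2) (u $ 2))"
    by (subst emeasure_distr[OF plane_point_measurable])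
      (simp_all add: eq lborel.emeasure_pair_measure_Times)
  also have "\<dots> = ennreal ((u $ 1 - l $ 1) * (u $ 2 - l $ 2))"
    using le by (simp add: ennreal_mult)
  also have "(u $ 1 - l $ 1) * (u $ 2 - l $ 2) = prod ((\<bullet>) (u - l)) Basis"
    by (simp add: Basis_real2 axis_neq_real2 inner_axis)
  finally show "emeasure (distr (lborel \<Otimes>\<^sub>M lborel) borel (\<lambda>p. plane_point (fst p) (snd p))) (box l u)
    = ennreal (prod ((\<bullet>) (u - l)) Basis)" .
qed simp

lemma plane_measurable:
  assumes "f \<in> borel_measurable borel"
  shows "(\<lambda>p. f (plane_point (fst p) (snd p))) \<in> borel_measurable (lborel \<Otimes>\<^sub>M lborel)"
    and "(\<lambda>y. f (plane_point x y)) \<in> borel_measurable lborel"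
    and "(\<lambda>x. f (plane_point x y)) \<in> borel_measurable lborel"
proof -
  show m: "(\<lambda>p. f (plane_point (fst p) (snd p))) \<in> borel_measurable (lborel \<Otimes>\<^sub>M lborel)"
    by (rule measurable_compose[OF plane_point_measurable assms])
  show "(\<lambda>y. f (plane_point x y)) \<in> borel_measurable lborel"
    using measurable_compose[OF measurable_Pair1'[of x lborel lborel] m] by simp
  show "(\<lambda>x. f (plane_point x y)) \<in> borel_measurable lborel"
    using measurable_compose[OF measurable_Pair2'[of y lborel lborel] m] by simp
qed

lemma nn_integral_real2:
  fixes f :: "real^2 \<Rightarrow> ennreal"
  assumes f: "f \<in> borel_measurable borel"
  shows "(\<integral>\<^sup>+z. f z \<partial>lborel) = (\<integral>\<^sup>+x. \<integral>\<^sup>+y. f (plane_point x y) \<partial>lborel \<partial>lborel)"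
    and "(\<integral>\<^sup>+z. f z \<partial>lborel) = (\<integral>\<^sup>+y. \<integral>\<^sup>+x. f (plane_point x y) \<partial>lborel \<partial>lborel)"
    and "(\<lambda>x. \<integral>\<^sup>+y. f (plane_point x y) \<partial>lborel) \<in> borel_measurable lborel"
    and "(\<lambda>y. \<integral>\<^sup>+x. f (plane_point x y) \<partial>lborel) \<in> borel_measurable lborel"
proof -
  note m = plane_measurable(1)[OF f]
  have "(\<integral>\<^sup>+z. f z \<partial>lborel) = (\<integral>\<^sup>+p. f (plane_point (fst p) (snd p)) \<partial>(lborel \<Otimes>\<^sub>M lborel))"
    unfolding lborel_real2 by (rule nn_integral_distr[OF plane_point_measurable]) (use f in simp)
  then show "(\<integral>\<^sup>+z. f z \<partial>lborel) = (\<integral>\<^sup>+x. \<integral>\<^sup>+y. f (plane_point x y) \<partial>lborel \<partial>lborel)"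
    "(\<integral>\<^sup>+z. f z \<partial>lborel) = (\<integral>\<^sup>+y. \<integral>\<^sup>+x. f (plane_point x y) \<partial>lborel \<partial>lborel)"
    using lborel.nn_integral_fst[OF m] lborel_pair.nn_integral_snd[OF m] by simp_all
  have m': "(\<lambda>(x, y). f (plane_point x y)) \<in> borel_measurable (lborel \<Otimes>\<^sub>M lborel)"
    using m by (simp add: case_prod_beta')
  show "(\<lambda>x. \<integral>\<^sup>+y. f (plane_point x y) \<partial>lborel) \<in> borel_measurable lborel"
    using lborel.borel_measurable_nn_integral[OF m'] .
  have "(\<lambda>(y, x). f (plane_point x y)) \<in> borel_measurable (lborel \<Otimes>\<^sub>M lborel)"
    using measurable_pair_swap[OF m'] by (simp add: case_prod_beta')
  then show "(\<lambda>y. \<integral>\<^sup>+x. f (plane_point x y) \<partial>lborel) \<in> borel_measurable lborel"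
    by (rule lborel.borel_measurable_nn_integral)
qed

section \<open>Gradient inequalities for test functions on the plane\<close>

lemma plane_DERIV:
  assumes "smooth h"
  shows "DERIV (\<lambda>s. h (plane_point s y)) s :> gradient h (plane_point s y) $ 1"
    and "DERIV (\<lambda>s. h (plane_point x s)) s :> gradient h (plane_point x s) $ 2"
    and "continuous_on UNIV (\<lambda>s. gradient h (plane_point s y) $ 1)"
    and "continuous_on UNIV (\<lambda>s. gradient h (plane_point x s) $ 2)"
proof -
  have "((\<lambda>s. plane_point s y) has_derivative (\<lambda>s. s *\<^sub>R axis 1 1)) (at s)" for s
    unfolding plane_point_def by (auto intro!: derivative_eq_intros)
  from has_derivative_compose[OF this smooth_GDERIV[OF assms, unfolded gderiv_def]]
  show "DERIV (\<lambda>s. h (plane_point s y)) s :> gradient h (plane_point s y) $ 1"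
    by (simp add: has_field_derivative_def inner_axis' mult_commute_abs)
  have "((\<lambda>s. plane_point x s) has_derivative (\<lambda>s. s *\<^sub>R axis 2 1)) (at s)" for s
    unfolding plane_point_def by (auto intro!: derivative_eq_intros)
  from has_derivative_compose[OF this smooth_GDERIV[OF assms, unfolded gderiv_def]]
  show "DERIV (\<lambda>s. h (plane_point x s)) s :> gradient h (plane_point x s) $ 2"
    by (simp add: has_field_derivative_def inner_axis' mult_commute_abs)
  have c: "continuous_on UNIV (\<lambda>z. gradient h z $ i)" for i
    by (intro continuous_intros smooth_gradient_continuous assms)
  have "continuous_on UNIV (\<lambda>s. plane_point s y)" "continuous_on UNIV (\<lambda>s. plane_point x s)"
    unfolding plane_point_def by (intro continuous_intros)+
  then show "continuous_on UNIV (\<lambda>s. gradient h (plane_point s y) $ 1)"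
    "continuous_on UNIV (\<lambda>s. gradient h (plane_point x s) $ 2)"
    using continuous_on_compose2[OF c] by blast+
qed

text \<open>The argument of Gagliardo and Nirenberg. Integrating along the horizontal line bounds
  |h(x,y)| by a function P(y), integrating along the vertical line bounds it by a function Q(x). The
  square is at most Q(x) P(y), whose integral factorises into two copies of the L^1 norm of the
  gradient.\<close>

lemma Sobolev_plane_test:
  fixes h :: "real^2 \<Rightarrow> real"
  assumes h: "h \<in> test_functions U"
  shows "(\<integral>\<^sup>+z. ennreal ((h z)\<^sup>2) \<partial>lborel) \<le> (\<integral>\<^sup>+z. ennreal (norm (gradient h z)) \<partial>lborel)\<^sup>2"
proof -
  have sm: "smooth h" by (rule test_functions_smooth[OF h])
  obtain K where K: "compact K" "\<And>x. x \<notin> K \<Longrightarrow> h x = 0"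
    by (rule test_functionsE[OF h]) blast
  obtain R where R: "\<And>x. x \<in> K \<Longrightarrow> norm x \<le> R"
    using compact_imp_bounded[OF K(1)] bounded_iff by blast
  have far: "h z = 0" if "R < \<bar>z $ i\<bar>" for z i
  proof -
    have "R < norm z" using that component_le_norm_cart[of z i] by simp
    then show ?thesis using K(2) R by (meson leD)
  qed
  let ?n = "\<lambda>z. ennreal (norm (gradient h z))"
  have nm: "?n \<in> borel_measurable borel" using test_functions_measurable(2)[OF h] by simp
  have hm: "(\<lambda>z. ennreal ((h z)\<^sup>2)) \<in> borel_measurable borel" using test_functions_measurable(1)[OF h] by simp
  define P where "P y = (\<integral>\<^sup>+s. ?n (plane_point s y) \<partial>lborel)" for y
  define Q where "Q x = (\<integral>\<^sup>+t. ?n (plane_point x t) \<partial>lborel)" for x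
  have PQm: "P \<in> borel_measurable lborel" "Q \<in> borel_measurable lborel"
    unfolding P_def Q_def by (rule nn_integral_real2(4)[OF nm], rule nn_integral_real2(3)[OF nm])
  have hP: "ennreal \<bar>h (plane_point x y)\<bar> \<le> P y" for x y
  proof -
    \<comment> \<open>A starting point to the left of \<open>x\<close> and beyond the support of
      \<open>h\<close>, so that integration along the line starts from the value 0.\<close>
    define a where "a = min x (- (\<bar>R\<bar> + 1))"
    have "a \<le> x" "R < \<bar>a\<bar>" by (auto simp: a_def)
    then have "h (plane_point a y) = 0" using far[of "plane_point a y" 1] by simp
    then have "ennreal \<bar>h (plane_point x y)\<bar> \<le> (\<integral>\<^sup>+s. ennreal \<bar>gradient h (plane_point s y) $ 1\<bar> * indicator {a..x} s \<partial>lborel)"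
      using FTC_abs_le[OF \<open>a \<le> x\<close> plane_DERIV(1)[OF sm, of y] plane_DERIV(3)[OF sm, of y]] by simp
    also have "\<dots> \<le> P y"
      unfolding P_def
      by (intro nn_integral_mono) (auto simp: indicator_def intro!: ennreal_leI component_le_norm_cart)
    finally show ?thesis .
  qed
  have hQ: "ennreal \<bar>h (plane_point x y)\<bar> \<le> Q x" for x y
  proof -
    define a where "a = min y (- (\<bar>R\<bar> + 1))"
    have "a \<le> y" "R < \<bar>a\<bar>" by (auto simp: a_def)
    then have "h (plane_point x a) = 0" using far[of "plane_point x a" 2] by simp
    then have "ennreal \<bar>h (plane_point x y)\<bar> \<le> (\<integral>\<^sup>+s. ennreal \<bar>gradient h (plane_point x s) $ 2\<bar> * indicator {a..y} s \<partial>lborel)"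
      using FTC_abs_le[OF \<open>a \<le> y\<close> plane_DERIV(2)[OF sm, of x] plane_DERIV(4)[OF sm, of x]] by simp
    also have "\<dots> \<le> Q x"
      unfolding Q_def
      by (intro nn_integral_mono) (auto simp: indicator_def intro!: ennreal_leI component_le_norm_cart)
    finally show ?thesis .
  qed
  have "(\<integral>\<^sup>+z. ennreal ((h z)\<^sup>2) \<partial>lborel) = (\<integral>\<^sup>+x. \<integral>\<^sup>+y. ennreal ((h (plane_point x y))\<^sup>2) \<partial>lborel \<partial>lborel)"
    by (rule nn_integral_real2(1)[OF hm])
  also have "\<dots> \<le> (\<integral>\<^sup>+x. \<integral>\<^sup>+y. Q x * P y \<partial>lborel \<partial>lborel)"
  proof (intro nn_integral_mono)
    fix x y
    have "ennreal ((h (plane_point x y))\<^sup>2) = ennreal \<bar>h (plane_point x y)\<bar> * ennreal \<bar>h (plane_point x y)\<bar>"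
      by (simp add: ennreal_mult[symmetric] power2_eq_square)
    also have "\<dots> \<le> Q x * P y" by (intro mult_mono hP hQ) auto
    finally show "ennreal ((h (plane_point x y))\<^sup>2) \<le> Q x * P y" .
  qed
  also have "\<dots> = (\<integral>\<^sup>+x. Q x * (\<integral>\<^sup>+y. P y \<partial>lborel) \<partial>lborel)"
    using PQm by (simp add: nn_integral_cmult)
  also have "\<dots> = (\<integral>\<^sup>+x. Q x \<partial>lborel) * (\<integral>\<^sup>+y. P y \<partial>lborel)"
    using PQm by (simp add: nn_integral_multc)
  also have "(\<integral>\<^sup>+x. Q x \<partial>lborel) = (\<integral>\<^sup>+z. ?n z \<partial>lborel)"
    unfolding Q_def by (rule nn_integral_real2(1)[OF nm, symmetric])
  also have "(\<integral>\<^sup>+y. P y \<partial>lborel) = (\<integral>\<^sup>+z. ?n z \<partial>lborel)"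
    unfolding P_def by (rule nn_integral_real2(2)[OF nm, symmetric])
  finally show ?thesis by (simp add: power2_eq_square)
qed

text \<open>Squares replace discs in the Poincare inequality because all their slices parallel to an
  axis are intervals of the same length.\<close>

definition square_around :: "real^2 \<Rightarrow> real \<Rightarrow> (real^2) set" where
  "square_around x r = {z. \<bar>z $ 1 - x $ 1\<bar> \<le> r \<and> \<bar>z $ 2 - x $ 2\<bar> \<le> r}"

lemma square_around_closed: "closed (square_around x r)"
  unfolding square_around_def
  by (intro closed_Collect_conj closed_Collect_le continuous_intros)

lemma square_around_indicator:
  "indicator (square_around x r) (plane_point s t) =
    (indicator {x $ 1 - r..x $ 1 + r} s * indicator {x $ 2 - r..x $ 2 + r} t :: 'b::{comm_semiring_1})"
  by (auto simp: square_around_def indicator_def abs_le_iff)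

lemma FTC_square_le_interval:
  fixes F f :: "real \<Rightarrow> real"
  assumes "x \<in> {a..b}" "y \<in> {a..b}" "\<And>x. DERIV F x :> f x" "continuous_on UNIV f"
  shows "ennreal ((F x - F y)\<^sup>2) \<le> ennreal (b - a) * (\<integral>\<^sup>+x. ennreal ((f x)\<^sup>2) * indicator {a..b} x \<partial>lborel)"
proof -
  have le: "ennreal ((F t - F s)\<^sup>2) \<le> ennreal (b - a) * (\<integral>\<^sup>+x. ennreal ((f x)\<^sup>2) * indicator {a..b} x \<partial>lborel)"
    if "s \<le> t" "s \<in> {a..b}" "t \<in> {a..b}" for s t
  proof -
    have "ennreal ((F t - F s)\<^sup>2) \<le> ennreal (t - s) * (\<integral>\<^sup>+x. ennreal ((f x)\<^sup>2) * indicator {s..t} x \<partial>lborel)"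
      by (rule FTC_square_le[OF that(1) assms(3,4)])
    also have "\<dots> \<le> ennreal (b - a) * (\<integral>\<^sup>+x. ennreal ((f x)\<^sup>2) * indicator {a..b} x \<partial>lborel)"
      using that by (intro mult_mono ennreal_leI nn_integral_mono) (auto simp: indicator_def)
    finally show ?thesis .
  qed
  show ?thesis
    using le[of x y] le[of y x] assms(1,2) by (cases "x \<le> y") (auto simp: power2_commute[of "F x"])
qed

text \<open>A point (s,t) of the large square is joined to the hole by a path with two legs:
  horizontally to (y,t) with y in the base of the hole, then vertically to the height of the hole's
  centre, where \<open>h\<close> is 0. Both legs stay in the large square. The estimate is then
  averaged over y and integrated over (s,t).\<close>

lemma Poincare_plane_test:
  fixes h :: "real^2 \<Rightarrow> real"
  assumes h: "h \<in> test_functions U" and r: "0 < l" "l \<le> r"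
    and sub: "square_around w l \<subseteq> square_around x r" and zero: "square_around w l \<inter> U = {}"
  shows "(\<integral>\<^sup>+z. ennreal ((h z)\<^sup>2) * indicator (square_around x r) z \<partial>lborel)
    \<le> ennreal (16 * r ^ 3 / l) * (\<integral>\<^sup>+z. ennreal ((norm (gradient h z))\<^sup>2) * indicator (square_around x r) z \<partial>lborel)"
proof -
  have sm: "smooth h" by (rule test_functions_smooth[OF h])
  define I1 I2 where "I1 = {x $ 1 - r..x $ 1 + r}" and "I2 = {x $ 2 - r..x $ 2 + r}"
  define J where "J = {w $ 1 - l..w $ 1 + l}"
  have Qi: "indicator (square_around x r) (plane_point s t) = (indicator I1 s * indicator I2 t :: ennreal)" for s t
    unfolding I1_def I2_def by (rule square_around_indicator)
  have mem: "plane_point s t \<in> square_around x r \<longleftrightarrow> s \<in> I1 \<and> t \<in> I2" for s t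
    by (auto simp: square_around_def I1_def I2_def abs_le_iff)
  have mw: "plane_point s (w $ 2) \<in> square_around w l \<longleftrightarrow> s \<in> J" for s
    using r by (auto simp: square_around_def J_def abs_le_iff)
  have J: "s \<in> J \<Longrightarrow> s \<in> I1 \<and> w $ 2 \<in> I2" for s using mw mem sub by blast
  have h0: "h (plane_point s (w $ 2)) = 0" if "s \<in> J" for s
    using that mw zero test_functions_outside(1)[OF h] by blast
  let ?g = "\<lambda>z. ennreal ((norm (gradient h z))\<^sup>2)"
  let ?gQ = "\<lambda>z. ?g z * indicator (square_around x r) z"
  have Qs: "square_around x r \<in> sets borel" using square_around_closed by (rule borel_closed)
  have gm: "?g \<in> borel_measurable borel" using test_functions_measurable(2)[OF h] by simp
  have gQm: "?gQ \<in> borel_measurable borel" using gm Qs by simp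
  have hm: "(\<lambda>z. ennreal ((h z)\<^sup>2)) \<in> borel_measurable borel" using test_functions_measurable(1)[OF h] by simp
  have hQm: "(\<lambda>z. ennreal ((h z)\<^sup>2) * indicator (square_around x r) z) \<in> borel_measurable borel" using hm Qs by simp
  define A where "A t = (\<integral>\<^sup>+s. ?g (plane_point s t) * indicator I1 s \<partial>lborel)" for t
  define B where "B s = (\<integral>\<^sup>+t. ?g (plane_point s t) * indicator I2 t \<partial>lborel)" for s
  have Am: "A \<in> borel_measurable lborel" and Bm: "B \<in> borel_measurable lborel"
  proof -
    have "(\<lambda>z. ?g z * indicator I1 (z $ 1)) \<in> borel_measurable borel" "(\<lambda>z. ?g z * indicator I2 (z $ 2)) \<in> borel_measurable borel"
      using gm by (auto intro!: borel_measurable_times measurable_compose[of "\<lambda>z. z $ _" borel borel] simp: I1_def I2_def)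
    from nn_integral_real2(4)[OF this(1)] nn_integral_real2(3)[OF this(2)]
    show "A \<in> borel_measurable lborel" "B \<in> borel_measurable lborel" by (simp_all add: A_def[abs_def] B_def[abs_def])
  qed
  define D where "D = (\<integral>\<^sup>+z. ?gQ z \<partial>lborel)"
  have DA: "(\<integral>\<^sup>+t. A t * indicator I2 t \<partial>lborel) = D"
    unfolding D_def nn_integral_real2(2)[OF gQm] Qi A_def
    by (intro nn_integral_cong) (auto simp: indicator_def)
  have DB: "(\<integral>\<^sup>+s. B s * indicator I1 s \<partial>lborel) = D"
    unfolding D_def nn_integral_real2(1)[OF gQm] Qi B_def
    by (intro nn_integral_cong) (auto simp: indicator_def)
  \<comment> \<open>Each leg has length at most 2 r, which is the factor from Cauchy-Schwarz; the
    square of a sum of two increments doubles it. \<open>A t\<close> and \<open>B y\<close> are the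
    gradient integrals over the full horizontal and vertical slices.\<close>
  have key: "ennreal ((h (plane_point s t))\<^sup>2) \<le> ennreal (4 * r) * (A t + B y)"
    if "s \<in> I1" "t \<in> I2" "y \<in> J" for s t y
  proof -
    have gi: "ennreal ((gradient h z $ i)\<^sup>2) \<le> ?g z" for z i
      using component_le_norm_cart[of "gradient h z" i]
      by (intro ennreal_leI) (simp add: abs_le_square_iff[symmetric])
    have 1: "ennreal ((h (plane_point s t) - h (plane_point y t))\<^sup>2) \<le> ennreal (2 * r) * A t"
    proof -
      have "ennreal ((h (plane_point s t) - h (plane_point y t))\<^sup>2)
        \<le> ennreal (2 * r) * (\<integral>\<^sup>+s. ennreal ((gradient h (plane_point s t) $ 1)\<^sup>2) * indicator I1 s \<partial>lborel)"
        using FTC_square_le_interval[OF _ _ plane_DERIV(1)[OF sm, of t] plane_DERIV(3)[OF sm, of t], of s "x $ 1 - r" "x $ 1 + r" y]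
          that J[OF that(3)] unfolding I1_def by simp
      also have "\<dots> \<le> ennreal (2 * r) * A t"
        unfolding A_def by (intro mult_left_mono nn_integral_mono mult_right_mono gi) auto
      finally show ?thesis .
    qed
    have 2: "ennreal ((h (plane_point y t) - h (plane_point y (w $ 2)))\<^sup>2) \<le> ennreal (2 * r) * B y"
    proof -
      have "ennreal ((h (plane_point y t) - h (plane_point y (w $ 2)))\<^sup>2)
        \<le> ennreal (2 * r) * (\<integral>\<^sup>+s. ennreal ((gradient h (plane_point y s) $ 2)\<^sup>2) * indicator I2 s \<partial>lborel)"
        using FTC_square_le_interval[OF _ _ plane_DERIV(2)[OF sm, of y] plane_DERIV(4)[OF sm, of y], of t "x $ 2 - r" "x $ 2 + r" "w $ 2"]
          that J[OF that(3)] unfolding I2_def by simp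
      also have "\<dots> \<le> ennreal (2 * r) * B y"
        unfolding B_def by (intro mult_left_mono nn_integral_mono mult_right_mono gi) auto
      finally show ?thesis .
    qed
    have sq: "(p + q)\<^sup>2 \<le> 2 * (p\<^sup>2 + q\<^sup>2)" for p q :: real
      using sum_squares_bound[of p q] by (simp add: power2_sum)
    have "ennreal ((h (plane_point s t))\<^sup>2)
      \<le> ennreal (2 * ((h (plane_point s t) - h (plane_point y t))\<^sup>2 + (h (plane_point y t) - h (plane_point y (w $ 2)))\<^sup>2))"
      using sq[of "h (plane_point s t) - h (plane_point y t)" "h (plane_point y t)"] h0[OF that(3)]
      by (intro ennreal_leI) simp
    also have "\<dots> = 2 * (ennreal ((h (plane_point s t) - h (plane_point y t))\<^sup>2) + ennreal ((h (plane_point y t) - h (plane_point y (w $ 2)))\<^sup>2))"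
      by (subst ennreal_mult) (auto simp: ennreal_plus)
    also have "\<dots> \<le> 2 * (ennreal (2 * r) * A t + ennreal (2 * r) * B y)"
      by (intro mult_left_mono add_mono 1 2) auto
    also have "\<dots> = (2 * ennreal (2 * r)) * (A t + B y)" by (simp add: distrib_left mult.assoc)
    also have "2 * ennreal (2 * r) = ennreal (4 * r)"
      using r by (simp add: ennreal_mult[symmetric] ennreal_numeral[symmetric] del: ennreal_numeral)
    finally show ?thesis .
  qed
  have Jm: "(\<integral>\<^sup>+y. indicator J y \<partial>lborel) = ennreal (2 * l)" using r by (simp add: J_def)
  have I2m: "(\<integral>\<^sup>+y. indicator I2 y \<partial>lborel) = ennreal (2 * r)" "(\<integral>\<^sup>+y. indicator I1 y \<partial>lborel) = ennreal (2 * r)"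
    using r by (simp_all add: I2_def I1_def)
  have Jsub: "indicator J y \<le> (indicator I1 y :: ennreal)" for y using J by (auto simp: indicator_def)
  \<comment> \<open>The slice integral \<open>B y\<close> has no bound for a single y. Averaging
    over the interval \<open>J\<close> of length 2 l turns it into the integral \<open>D\<close>
    over the square.\<close>
  have avg: "ennreal (2 * l) * ennreal ((h (plane_point s t))\<^sup>2) \<le> ennreal (4 * r) * (ennreal (2 * l) * A t + D)"
    if "s \<in> I1" "t \<in> I2" for s t
  proof -
    have "ennreal (2 * l) * ennreal ((h (plane_point s t))\<^sup>2) = (\<integral>\<^sup>+y. ennreal ((h (plane_point s t))\<^sup>2) * indicator J y \<partial>lborel)"
      unfolding Jm[symmetric] by (subst nn_integral_cmult) (auto simp: J_def mult.commute)
    also have "\<dots> \<le> (\<integral>\<^sup>+y. ennreal (4 * r) * (A t * indicator J y + B y * indicator I1 y) \<partial>lborel)"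
    proof (rule nn_integral_mono)
      fix y
      show "ennreal ((h (plane_point s t))\<^sup>2) * indicator J y \<le> ennreal (4 * r) * (A t * indicator J y + B y * indicator I1 y)"
        using key[OF that, of y] J[of y] by (auto simp: indicator_def)
    qed
    also have "\<dots> = ennreal (4 * r) * (A t * (\<integral>\<^sup>+y. indicator J y \<partial>lborel) + (\<integral>\<^sup>+y. B y * indicator I1 y \<partial>lborel))"
      using Bm by (simp add: nn_integral_cmult nn_integral_add J_def I1_def)
    also have "\<dots> = ennreal (4 * r) * (ennreal (2 * l) * A t + D)"
      unfolding Jm DB by (simp add: mult.commute)
    finally show ?thesis .
  qed
  have "ennreal (2 * l) * (\<integral>\<^sup>+z. ennreal ((h z)\<^sup>2) * indicator (square_around x r) z \<partial>lborel)
    = (\<integral>\<^sup>+s. \<integral>\<^sup>+t. ennreal (2 * l) * (ennreal ((h (plane_point s t))\<^sup>2) * (indicator I1 s * indicator I2 t)) \<partial>lborel \<partial>lborel)"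
  proof -
    have "(\<lambda>z. ennreal (2 * l) * (ennreal ((h z)\<^sup>2) * indicator (square_around x r) z)) \<in> borel_measurable borel"
      using hQm by simp
    from nn_integral_real2(1)[OF this] hQm show ?thesis
      by (simp add: nn_integral_cmult Qi)
  qed
  also have "\<dots> \<le> (\<integral>\<^sup>+s. \<integral>\<^sup>+t. (ennreal (4 * r) * (ennreal (2 * l) * (A t * indicator I2 t) + D * indicator I2 t)) * indicator I1 s \<partial>lborel \<partial>lborel)"
  proof (intro nn_integral_mono)
    fix s t
    show "ennreal (2 * l) * (ennreal ((h (plane_point s t))\<^sup>2) * (indicator I1 s * indicator I2 t))
      \<le> (ennreal (4 * r) * (ennreal (2 * l) * (A t * indicator I2 t) + D * indicator I2 t)) * indicator I1 s"
      using avg[of s t] by (auto simp: indicator_def)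
  qed
  also have "\<dots> = ennreal (4 * r) * (ennreal (2 * l) * D + D * ennreal (2 * r)) * ennreal (2 * r)"
    using Am by (simp add: nn_integral_cmult nn_integral_multc nn_integral_add DA I2m I1_def[symmetric] I2_def[symmetric]
      ) (simp add: I1_def I2_def nn_integral_cmult nn_integral_multc nn_integral_add DA[unfolded I2_def] I2m[unfolded I2_def I1_def])
  also have "\<dots> = ennreal (8 * r\<^sup>2 * (2 * l + 2 * r)) * D"
  proof -
    have "ennreal (8 * r\<^sup>2 * (2 * l + 2 * r)) = ennreal (4 * r) * (ennreal (2 * l) + ennreal (2 * r)) * ennreal (2 * r)"
      using r by (simp add: ennreal_mult[symmetric] ennreal_plus[symmetric] power2_eq_square algebra_simps del: ennreal_plus)
    then show ?thesis by (simp add: algebra_simps)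
  qed
  also have "\<dots> \<le> ennreal (2 * l * (16 * r ^ 3 / l)) * D"
  proof (intro mult_right_mono ennreal_leI)
    \<comment> \<open>Here l <= r merges the contributions of the two legs; 32 r^3 divided by the
      length 2 l gives the constant 16 r^3 / l.\<close>
    have "8 * r\<^sup>2 * (2 * l + 2 * r) \<le> 8 * r\<^sup>2 * (4 * r)" using r by (intro mult_left_mono) auto
    also have "\<dots> = 2 * l * (16 * r ^ 3 / l)" using r by (simp add: power2_eq_square power3_eq_cube)
    finally show "8 * r\<^sup>2 * (2 * l + 2 * r) \<le> 2 * l * (16 * r ^ 3 / l)" .
  qed simp
  also have "\<dots> = ennreal (2 * l) * (ennreal (16 * r ^ 3 / l) * D)"
    using r by (subst ennreal_mult) (auto simp: mult.assoc)
  finally have "ennreal (2 * l) * (\<integral>\<^sup>+z. ennreal ((h z)\<^sup>2) * indicator (square_around x r) z \<partial>lborel)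
    \<le> ennreal (2 * l) * (ennreal (16 * r ^ 3 / l) * D)" .
  then show ?thesis
    using r unfolding D_def by (subst (asm) ennreal_mult_le_mult_iff) auto
qed

section \<open>Passage from test functions to the Sobolev space on the plane\<close>

lemma nn_integral_eq_lebesgue_on:
  fixes f :: "'a::euclidean_space \<Rightarrow> real"
  assumes "f \<in> borel_measurable borel" "open U" "\<And>x. x \<notin> U \<Longrightarrow> f x = 0" "\<And>x. 0 \<le> f x"
    and "integrable (lebesgue_on U) f"
  shows "(\<integral>\<^sup>+x. ennreal (f x) \<partial>lborel) = ennreal (LINT x|lebesgue_on U. f x)"
  using assms integral_lebesgue_on_eq_lborel[OF assms(1-3)]
  by (simp add: nn_integral_eq_integral)

lemma square_integrable_const:
  assumes "open U" "bounded U"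
  shows "square_integrable U (\<lambda>x. c::real)"
proof -
  have "emeasure (lebesgue_on U) (space (lebesgue_on U)) = emeasure lborel U"
    using assms(1) by (simp add: emeasure_restrict_space)
  also have "\<dots> < \<infinity>" using assms(2) by (rule emeasure_bounded_finite)
  finally have "finite_measure (lebesgue_on U)" by (intro finite_measureI) auto
  then show ?thesis
    unfolding square_integrable_def by (auto intro: finite_measure.integrable_const)
qed

lemma indicator_measurable_lebesgue_on:
  "A \<in> sets borel \<Longrightarrow> (indicator A :: 'a::euclidean_space \<Rightarrow> real) \<in> borel_measurable (lebesgue_on U)"
  by (rule measurable_restrict_space1[OF borel_measurable_indicator]) simp

lemma square_integrable_indicator:
  assumes "square_integrable U f" "A \<in> sets borel"
  shows "square_integrable U (\<lambda>x. indicator A x *\<^sub>R f x)"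
  by (rule square_integrable_bounded_mult[OF assms(1) indicator_measurable_lebesgue_on[OF assms(2)], where B = 1])
    (simp add: indicator_def)

lemma indicator_square_integrable:
  fixes f :: "'a::euclidean_space \<Rightarrow> 'b::euclidean_space"
  assumes "square_integrable U f" "A \<in> sets borel"
  shows "integrable (lebesgue_on U) (\<lambda>x. indicator A x * (norm (f x))\<^sup>2)"
proof -
  have "(norm (indicator A x *\<^sub>R f x))\<^sup>2 = indicator A x * (norm (f x))\<^sup>2" for x
    by (auto simp: indicator_def)
  then show ?thesis
    using square_integrable_indicator[OF assms] by (simp add: square_integrable_def)
qed

text \<open>The L^1 norm of the gradient is an integral over \<open>A\<close> alone, so
  Cauchy-Schwarz produces the measure of \<open>A\<close> as a factor. This factor makes the De
  Giorgi recursion quadratic.\<close>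

lemma Sobolev_plane:
  fixes U :: "(real^2) set"
  assumes U: "open U" "bounded U" and W: "W012_with_gradient U u g"
    and A: "A \<in> sets (lebesgue_on U)" "\<And>x. x \<in> U \<Longrightarrow> x \<notin> A \<Longrightarrow> g x = 0"
  shows "(LINT x|lebesgue_on U. (u x)\<^sup>2) \<le> measure (lebesgue_on U) A * (LINT x|lebesgue_on U. (norm (g x))\<^sup>2)"
proof -
  have sq: "square_integrable U u" "square_integrable U g" using W by (auto simp: W012_with_gradient_def)
  have n: "square_integrable U (\<lambda>x. norm (w x))" if "square_integrable U w" for w :: "real^2 \<Rightarrow> real^2"
    using that by (auto simp: square_integrable_def)
  have int: "integrable (lebesgue_on U) (\<lambda>x. norm (w x))" if "square_integrable U w" for w :: "real^2 \<Rightarrow> real^2"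
    using square_integrable_mult[OF n[OF that] square_integrable_const[OF U, of 1]] by simp
  obtain h where h: "\<And>k::nat. h k \<in> test_functions U"
    and l1: "(\<lambda>k. LINT x|lebesgue_on U. (u x - h k x)\<^sup>2) \<longlonglongrightarrow> 0"
    and l2: "(\<lambda>k. LINT x|lebesgue_on U. (norm (g x - gradient (h k) x))\<^sup>2) \<longlonglongrightarrow> 0"
    using W012_with_gradient_seq[OF U(1) W] by blast
  note sqh = test_functions_square_integrable[OF h U(1)]
  have test: "(LINT x|lebesgue_on U. (h k x)\<^sup>2) \<le> (LINT x|lebesgue_on U. norm (gradient (h k) x))\<^sup>2" for k
  proof -
    have "(\<integral>\<^sup>+x. ennreal ((h k x)\<^sup>2) \<partial>lborel) = ennreal (LINT x|lebesgue_on U. (h k x)\<^sup>2)"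
      by (rule nn_integral_eq_lebesgue_on)
        (use U test_functions_measurable(1)[OF h[of k]] test_functions_outside[OF h[of k]] sqh(1)[of k] in
          \<open>auto simp: square_integrable_def\<close>)
    moreover have "(\<integral>\<^sup>+x. ennreal (norm (gradient (h k) x)) \<partial>lborel) = ennreal (LINT x|lebesgue_on U. norm (gradient (h k) x))"
      by (rule nn_integral_eq_lebesgue_on)
        (use U test_functions_measurable(2)[OF h[of k]] test_functions_outside[OF h[of k]] int[OF sqh(2)[of k]] in auto)
    ultimately show ?thesis
      using Sobolev_plane_test[OF h[of k]] by (simp add: ennreal_power)
  qed
  have lim1: "(\<lambda>k. LINT x|lebesgue_on U. (h k x)\<^sup>2) \<longlonglongrightarrow> (LINT x|lebesgue_on U. (u x)\<^sup>2)"
    using tendsto_integral_norm_square[OF sqh(1) sq(1)] l1 by simp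
  have lim2: "(\<lambda>k. LINT x|lebesgue_on U. norm (gradient (h k) x)) \<longlonglongrightarrow> (LINT x|lebesgue_on U. norm (g x))"
  proof (subst LIM_zero_iff[symmetric], rule Lim_null_comparison)
    have "(\<lambda>k. LINT x|lebesgue_on U. norm (g x - gradient (h k) x) * 1) \<longlonglongrightarrow> 0"
      by (rule tendsto_integral_mult_zero[OF n[OF square_integrable_diff[OF sq(2) sqh(2)]] square_integrable_const[OF U] l2])
    then show "(\<lambda>k. LINT x|lebesgue_on U. norm (g x - gradient (h k) x)) \<longlonglongrightarrow> 0" by simp
    have "norm ((LINT x|lebesgue_on U. norm (gradient (h k) x)) - (LINT x|lebesgue_on U. norm (g x)))
        \<le> (LINT x|lebesgue_on U. norm (g x - gradient (h k) x))" for k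
    proof -
      have "norm ((LINT x|lebesgue_on U. norm (gradient (h k) x)) - (LINT x|lebesgue_on U. norm (g x)))
        = norm (LINT x|lebesgue_on U. norm (gradient (h k) x) - norm (g x))"
        using int[OF sqh(2)[of k]] int[OF sq(2)] by simp
      also have "\<dots> \<le> (LINT x|lebesgue_on U. norm (norm (gradient (h k) x) - norm (g x)))"
        by (rule integral_norm_bound)
      also have "\<dots> \<le> (LINT x|lebesgue_on U. norm (g x - gradient (h k) x))"
        using int[OF sqh(2)[of k]] int[OF sq(2)] int[OF square_integrable_diff[OF sq(2) sqh(2)[of k]]]
        by (intro integral_mono) (auto simp: norm_minus_commute[of "g _"] norm_triangle_ineq3)
      finally show ?thesis .
    qed
    then show "\<forall>\<^sub>F k in sequentially. norm ((LINT x|lebesgue_on U. norm (gradient (h k) x)) - (LINT x|lebesgue_on U. norm (g x)))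
        \<le> (LINT x|lebesgue_on U. norm (g x - gradient (h k) x))" by simp
  qed
  have "(LINT x|lebesgue_on U. (u x)\<^sup>2) \<le> (LINT x|lebesgue_on U. norm (g x))\<^sup>2"
    by (rule LIMSEQ_le[OF lim1 tendsto_power[OF lim2]]) (use test in blast)
  also have "(LINT x|lebesgue_on U. norm (g x)) = (LINT x|lebesgue_on U. indicator A x * norm (g x))"
    by (rule Bochner_Integration.integral_cong) (use A(2) in \<open>auto simp: indicator_def\<close>)
  also have "\<dots>\<^sup>2 \<le> (LINT x|lebesgue_on U. (indicator A x)\<^sup>2) * (LINT x|lebesgue_on U. (norm (g x))\<^sup>2)"
  proof (rule integral_Cauchy_Schwarz)
    have "(indicator A x)\<^sup>2 = (indicator A x :: real)" for x by (simp add: indicator_def)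
    moreover have "integrable (lebesgue_on U) (\<lambda>x. indicator A x *\<^sub>R (1::real))"
      using A(1) square_integrable_const[OF U, of 1]
      by (intro integrable_mult_indicator) (auto simp: square_integrable_def)
    ultimately show "integrable (lebesgue_on U) (\<lambda>x. (indicator A x :: real)\<^sup>2)" by simp
    show "integrable (lebesgue_on U) (\<lambda>x. (norm (g x))\<^sup>2)" using sq by (simp add: square_integrable_def)
    show "integrable (lebesgue_on U) (\<lambda>x. indicator A x * norm (g x))"
      using integrable_mult_indicator[OF A(1) int[OF sq(2)]] by simp
  qed
  also have "(LINT x|lebesgue_on U. (indicator A x)\<^sup>2) = measure (lebesgue_on U) A"
  proof -
    have "(indicator A x)\<^sup>2 = (indicator A x :: real)" for x by (simp add: indicator_def)
    then show ?thesis using A(1) sets.sets_into_space[OF A(1)] by (simp add: Int_absorb2)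
  qed
  finally show ?thesis .
qed

text \<open>Test functions vanish on the square outside \<open>U\<close>, which is the hole of the
  previous inequality. Since \<open>16 * r ^ 3 / l\<close> is of order r^2 when l and r are
  comparable, this is the Poincare inequality at scale r.\<close>

lemma Poincare_plane:
  fixes U :: "(real^2) set"
  assumes U: "open U" and W: "W012_with_gradient U u g" and r: "0 < l" "l \<le> r"
    and sub: "square_around w l \<subseteq> square_around x r" and zero: "square_around w l \<inter> U = {}"
  shows "(LINT z|lebesgue_on U. indicator (square_around x r) z * (u z)\<^sup>2)
    \<le> 16 * r ^ 3 / l * (LINT z|lebesgue_on U. (norm (g z))\<^sup>2)"
proof -
  let ?Q = "square_around x r"
  have sq: "square_integrable U u" "square_integrable U g" using W by (auto simp: W012_with_gradient_def)
  have Qs: "?Q \<in> sets borel" using square_around_closed by (rule borel_closed)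
  obtain h where h: "\<And>k::nat. h k \<in> test_functions U"
    and l1: "(\<lambda>k. LINT x|lebesgue_on U. (u x - h k x)\<^sup>2) \<longlonglongrightarrow> 0"
    and l2: "(\<lambda>k. LINT x|lebesgue_on U. (norm (g x - gradient (h k) x))\<^sup>2) \<longlonglongrightarrow> 0"
    using W012_with_gradient_seq[OF U W] by blast
  note sqh = test_functions_square_integrable[OF h U]
  have test: "(LINT z|lebesgue_on U. indicator ?Q z * (h k z)\<^sup>2)
      \<le> 16 * r ^ 3 / l * (LINT z|lebesgue_on U. (norm (gradient (h k) z))\<^sup>2)" for k
  proof -
    have "ennreal (LINT z|lebesgue_on U. indicator ?Q z * (h k z)\<^sup>2) = (\<integral>\<^sup>+z. ennreal (indicator ?Q z * (h k z)\<^sup>2) \<partial>lborel)"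
      by (rule nn_integral_eq_lebesgue_on[symmetric])
        (use U Qs test_functions_measurable(1)[OF h[of k]] test_functions_outside[OF h[of k]]
          indicator_square_integrable[OF sqh(1)[of k] Qs] in auto)
    also have "\<dots> = (\<integral>\<^sup>+z. ennreal ((h k z)\<^sup>2) * indicator ?Q z \<partial>lborel)"
      by (rule nn_integral_cong) (auto simp: indicator_def)
    also have "\<dots> \<le> ennreal (16 * r ^ 3 / l) * (\<integral>\<^sup>+z. ennreal ((norm (gradient (h k) z))\<^sup>2) * indicator ?Q z \<partial>lborel)"
      by (rule Poincare_plane_test[OF h r sub zero])
    also have "\<dots> \<le> ennreal (16 * r ^ 3 / l) * (\<integral>\<^sup>+z. ennreal ((norm (gradient (h k) z))\<^sup>2) \<partial>lborel)"
      by (intro mult_left_mono nn_integral_mono) (auto simp: indicator_def)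
    also have "(\<integral>\<^sup>+z. ennreal ((norm (gradient (h k) z))\<^sup>2) \<partial>lborel) = ennreal (LINT z|lebesgue_on U. (norm (gradient (h k) z))\<^sup>2)"
      by (rule nn_integral_eq_lebesgue_on)
        (use U test_functions_measurable(2)[OF h[of k]] test_functions_outside[OF h[of k]] sqh(2)[of k] in
          \<open>auto simp: square_integrable_def\<close>)
    also have "ennreal (16 * r ^ 3 / l) * \<dots> = ennreal (16 * r ^ 3 / l * (LINT z|lebesgue_on U. (norm (gradient (h k) z))\<^sup>2))"
      using r by (intro ennreal_mult[symmetric]) auto
    finally show ?thesis
      using r by (subst (asm) ennreal_le_iff) (auto intro!: mult_nonneg_nonneg divide_nonneg_nonneg)
  qed
  have e: "(norm (indicator ?Q z *\<^sub>R v))\<^sup>2 = indicator ?Q z * v\<^sup>2" for z and v :: real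
    by (auto simp: indicator_def)
  have "(\<lambda>k. LINT z|lebesgue_on U. (norm (indicator ?Q z *\<^sub>R h k z))\<^sup>2) \<longlonglongrightarrow> (LINT z|lebesgue_on U. (norm (indicator ?Q z *\<^sub>R u z))\<^sup>2)"
  proof (rule tendsto_integral_norm_square[OF square_integrable_indicator[OF sqh(1) Qs] square_integrable_indicator[OF sq(1) Qs]])
    show "(\<lambda>k. LINT z|lebesgue_on U. (norm (indicator ?Q z *\<^sub>R u z - indicator ?Q z *\<^sub>R h k z))\<^sup>2) \<longlonglongrightarrow> 0"
    proof (rule Lim_null_comparison[OF _ l1], intro always_eventually allI)
      fix k
      have "(LINT z|lebesgue_on U. (norm (indicator ?Q z *\<^sub>R u z - indicator ?Q z *\<^sub>R h k z))\<^sup>2) \<le> (LINT x|lebesgue_on U. (u x - h k x)\<^sup>2)"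
        using integrable_W12_distance(1)[OF sq sqh[of k]] square_integrable_diff[OF square_integrable_indicator[OF sq(1) Qs] square_integrable_indicator[OF sqh(1)[of k] Qs]]
        by (intro integral_mono) (auto simp: square_integrable_def indicator_def)
      then show "norm (LINT z|lebesgue_on U. (norm (indicator ?Q z *\<^sub>R u z - indicator ?Q z *\<^sub>R h k z))\<^sup>2) \<le> (LINT x|lebesgue_on U. (u x - h k x)\<^sup>2)"
        by simp
    qed
  qed
  then have lim1: "(\<lambda>k. LINT z|lebesgue_on U. indicator ?Q z * (h k z)\<^sup>2) \<longlonglongrightarrow> (LINT z|lebesgue_on U. indicator ?Q z * (u z)\<^sup>2)"
    unfolding e .
  have lim2: "(\<lambda>k. 16 * r ^ 3 / l * (LINT z|lebesgue_on U. (norm (gradient (h k) z))\<^sup>2)) \<longlonglongrightarrow> 16 * r ^ 3 / l * (LINT z|lebesgue_on U. (norm (g z))\<^sup>2)"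
    by (intro tendsto_mult_left tendsto_integral_norm_square[OF sqh(2) sq(2) l2])
  show ?thesis
    by (rule LIMSEQ_le[OF lim1 lim2]) (use test in blast)
qed

section \<open>The local maximum principle\<close>

text \<open>The De Giorgi iteration: a recursion that gains a square beats the geometric loss.\<close>

lemma De_Giorgi_recursion:
  fixes Y :: "nat \<Rightarrow> real"
  assumes M: "0 < M" and s: "0 < s" and Y0: "\<And>j. 0 \<le> Y j" and init: "Y 0 \<le> s / (16 * M)"
    and step: "\<And>j. Y (Suc j) \<le> M * 16 ^ j / s * (Y j)\<^sup>2"
  shows "Y j \<le> s / (16 * M) / 16 ^ j"
proof (induction j)
  case 0
  then show ?case using init by simp
next
  case (Suc j)
  have "Y (Suc j) \<le> M * 16 ^ j / s * (Y j)\<^sup>2" by (rule step)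
  also have "\<dots> \<le> M * 16 ^ j / s * (s / (16 * M) / 16 ^ j)\<^sup>2"
    \<comment> \<open>Squaring the bound yields 16^(-2j), of which the growth 16^j consumes half;
      the smallness s / (16 M) of the start contributes the next factor 1/16.\<close>
    using M s Y0[of j] Suc by (intro mult_left_mono power_mono) auto
  also have "\<dots> = s / (16 * M) / 16 ^ Suc j"
    using M s by (simp add: power2_eq_square field_simps)
  finally show ?case .
qed

text \<open>Radii shrink from r towards r/2 while levels rise from 0 towards k, and
  \<open>Y j\<close> is the squared excess over the j-th level on the j-th disc. Chebyshev bounds
  the measure of the next superlevel set by \<open>Y j\<close>, the energy estimate bounds the
  gradient by \<open>Y j\<close>, and the Sobolev inequality multiplies the two. The condition on
  the eigenvalue puts its term on a par with the gradient of the cutoff, which is of order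
  1/r^2.\<close>

lemma De_Giorgi_local_bound:
  assumes \<Lambda>: "1 \<le> \<Lambda>"
  obtains C where "C > 0"
    "\<And>(a :: real^2 \<Rightarrow> real^2 \<Rightarrow> real^2 \<Rightarrow> real) U \<phi> x0 r.
      open U \<Longrightarrow> bounded U \<Longrightarrow> uniformly_elliptic \<Lambda> a \<Longrightarrow> principal_eigenfunction a U \<phi> \<Longrightarrow>
      0 < r \<Longrightarrow> dirichlet_eigenvalue a U * r\<^sup>2 \<le> 1 \<Longrightarrow> x0 \<in> U \<Longrightarrow>
      (\<phi> x0)\<^sup>2 \<le> C / r\<^sup>2 * (LINT x|lebesgue_on U. indicator (cball x0 r) x * (\<phi> x)\<^sup>2)"
proof -
  obtain C0 where C0: "C0 > 0" "\<And>(z::real^2) s t x. 0 < s \<Longrightarrow> s < t \<Longrightarrow>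
      norm (gradient (annulus_cutoff z s t) x) \<le> C0 / (t - s)"
    using annulus_cutoff_gradient_bound by blast
  \<comment> \<open>The product of the factor 4 in \<open>Am'\<close> and of \<Lambda>^2 (4 + 16
    C0^2) in \<open>G\<close>.\<close>
  define M where "M = 16 * \<Lambda>\<^sup>2 * (1 + 4 * C0\<^sup>2)"
  have M: "M > 0" using \<Lambda> by (simp add: M_def add_pos_nonneg)
  have main: "(\<phi> x0)\<^sup>2 \<le> 16 * M / r\<^sup>2 * (LINT x|lebesgue_on U. indicator (cball x0 r) x * (\<phi> x)\<^sup>2)"
    if U: "open U" "bounded U" and ell: "uniformly_elliptic \<Lambda> a" and \<phi>: "principal_eigenfunction a U \<phi>"
      and r: "0 < r" and ev: "dirichlet_eigenvalue a U * r\<^sup>2 \<le> 1" and x0: "x0 \<in> U"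
    for a :: "real^2 \<Rightarrow> real^2 \<Rightarrow> real^2 \<Rightarrow> real" and U \<phi> x0 r
  proof -
    let ?ev = "dirichlet_eigenvalue a U"
    have ev0: "0 \<le> ?ev" by (rule principal_eigenfunction_energy(2)[OF U(1) ell \<Lambda> \<phi>])
    have ev1: "?ev \<le> 1 / r\<^sup>2" using ev r by (simp add: field_simps)
    have \<phi>pos: "x \<in> U \<Longrightarrow> 0 < \<phi> x" and \<phi>cont: "continuous_on U \<phi>" for x
      using \<phi> by (auto simp: principal_eigenfunction_def)
    have W: "W012_with_gradient U \<phi> (weak_gradient U \<phi>)"
      using \<phi> W012_imp_with_gradient by (auto simp: principal_eigenfunction_def)
    have sq\<phi>: "square_integrable U \<phi>" using W by (auto simp: W012_with_gradient_def)
    \<comment> \<open>Consecutive radii differ by r / (4 * 2^j), so the cutoffs have gradients of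
      order 2^j / r and never reach below the radius r/2.\<close>
    define rr where "rr j = r * (1 / 2 + (1 / 2) ^ Suc j)" for j
    have rr: "0 < rr j" "rr (Suc j) < rr j" "rr j - rr (Suc j) = r / (4 * 2 ^ j)" "r / 2 \<le> rr j" "rr 0 = r" for j
      using r by (auto simp: rr_def field_simps power_one_over intro!: add_pos_pos mult_pos_pos)
    have bound: "\<phi> x0 \<le> k"
      if k: "0 < k" and big: "(LINT x|lebesgue_on U. indicator (cball x0 r) x * (\<phi> x)\<^sup>2) \<le> k\<^sup>2 * r\<^sup>2 / (16 * M)" for k
    proof -
      \<comment> \<open>The first level is 0, so that \<open>Y 0\<close> involves \<phi> itself, and
        consecutive levels differ by k / (2 * 2^j).\<close>
      define kk where "kk j = k * (1 - (1 / 2) ^ j)" for j :: nat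
      have kk: "0 \<le> kk j" "kk j \<le> k" "kk (Suc j) - kk j = k / (2 * 2 ^ j)" "kk j \<le> kk (Suc j)" "kk 0 = 0" for j
      proof -
        have p: "(0::real) < (1 / 2) ^ j" "(1 / 2 :: real) ^ j \<le> 1" by (auto intro: power_le_one)
        show "0 \<le> kk j" "kk j \<le> k" "kk 0 = 0" using k p by (auto simp: kk_def mult_left_le)
        show d: "kk (Suc j) - kk j = k / (2 * 2 ^ j)" by (simp add: kk_def field_simps power_one_over)
        have "0 \<le> k / (2 * 2 ^ j)" using k by simp
        then show "kk j \<le> kk (Suc j)" using d by linarith
      qed
      define v where "v j x = max (\<phi> x - kk j) 0" for j x
      have sqv: "square_integrable U (v j)" for j
        using W012_with_gradient_positive_part[OF U(1) kk(1)[of j] W] unfolding v_def[abs_def]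
        by (simp add: W012_with_gradient_def)
      define Y where "Y j = (LINT x|lebesgue_on U. indicator (cball x0 (rr j)) x * (v j x)\<^sup>2)" for j
      have iY: "integrable (lebesgue_on U) (\<lambda>x. indicator (cball x0 s) x * (v j x)\<^sup>2)" for j s
        using indicator_square_integrable[OF sqv[of j], of "cball x0 s"] by simp
      have Y0: "0 \<le> Y j" for j unfolding Y_def by (intro Bochner_Integration.integral_nonneg) auto
      have vmono: "v (Suc j) x \<le> v j x" "0 \<le> v j x" for j x using kk(4)[of j] by (auto simp: v_def)
      have step: "Y (Suc j) \<le> M * 16 ^ j / (k\<^sup>2 * r\<^sup>2) * (Y j)\<^sup>2" for j
      proof -
        define \<eta> where "\<eta> = annulus_cutoff x0 (rr (Suc j)) (rr j)"
        note \<eta> = annulus_cutoff[OF rr(1)[of "Suc j"] rr(2)[of j], where z = x0, folded \<eta>_def]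
        obtain g where g: "W012_with_gradient U (\<lambda>x. \<eta> x * max (\<phi> x - kk (Suc j)) 0) g"
          and g1: "\<And>x. x \<in> U \<Longrightarrow> \<phi> x \<le> kk (Suc j) \<Longrightarrow> g x = 0"
          and g2: "\<And>x. x \<in> U \<Longrightarrow> \<eta> x = 0 \<Longrightarrow> gradient \<eta> x = 0 \<Longrightarrow> g x = 0"
          and i1: "integrable (lebesgue_on U) (\<lambda>x. (\<eta> x)\<^sup>2 * (\<phi> x * max (\<phi> x - kk (Suc j)) 0))"
          and i2: "integrable (lebesgue_on U) (\<lambda>x. (max (\<phi> x - kk (Suc j)) 0)\<^sup>2 * (norm (gradient \<eta> x))\<^sup>2)"
          and gle: "(LINT x|lebesgue_on U. (norm (g x))\<^sup>2) \<le>
            \<Lambda> * (?ev * (LINT x|lebesgue_on U. (\<eta> x)\<^sup>2 * (\<phi> x * max (\<phi> x - kk (Suc j)) 0))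
              + \<Lambda> * (LINT x|lebesgue_on U. (max (\<phi> x - kk (Suc j)) 0)\<^sup>2 * (norm (gradient \<eta> x))\<^sup>2))"
          by (rule Caccioppoli[OF U ell \<Lambda> \<phi> kk(1)[of "Suc j"] \<eta>(1)]) blast
        note i1 = i1[folded v_def] and i2 = i2[folded v_def] and gle = gle[folded v_def] and g = g[folded v_def]
        have sqw: "square_integrable U (\<lambda>x. \<eta> x * v (Suc j) x)" using g by (simp add: W012_with_gradient_def)
        \<comment> \<open>Outside \<open>A\<close> either the truncation or the cutoff together with
          its gradient is zero, so \<open>A\<close> carries the whole gradient
          \<open>g\<close>.\<close>
        define A where "A = {x \<in> space (lebesgue_on U). kk (Suc j) < \<phi> x \<and> x \<in> cball x0 (rr j)}"
        have A: "A \<in> sets (lebesgue_on U)"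
        proof -
          have "{x \<in> space (lebesgue_on U). kk (Suc j) < \<phi> x} \<in> sets (lebesgue_on U)"
            by (rule borel_measurable_less) (use sq\<phi> in \<open>auto simp: square_integrable_def\<close>)
          moreover have "U \<inter> cball x0 (rr j) \<in> sets (lebesgue_on U)"
            using U(1) by (auto simp: sets_restrict_space)
          ultimately have "{x \<in> space (lebesgue_on U). kk (Suc j) < \<phi> x} \<inter> (U \<inter> cball x0 (rr j)) \<in> sets (lebesgue_on U)"
            by (rule sets.Int)
          moreover have "{x \<in> space (lebesgue_on U). kk (Suc j) < \<phi> x} \<inter> (U \<inter> cball x0 (rr j)) = A"
            by (auto simp: A_def)
          ultimately show ?thesis by simp
        qed
        have S: "(LINT x|lebesgue_on U. (\<eta> x * v (Suc j) x)\<^sup>2) \<le> measure (lebesgue_on U) A * (LINT x|lebesgue_on U. (norm (g x))\<^sup>2)"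
        proof (rule Sobolev_plane[OF U g A])
          fix x assume "x \<in> U" "x \<notin> A"
          then consider "\<phi> x \<le> kk (Suc j)" | "rr j \<le> dist x0 x" by (auto simp: A_def)
          then show "g x = 0"
            by cases (use g1 g2 \<eta>(5,7) \<open>x \<in> U\<close> in auto)
        qed
        have Yw: "Y (Suc j) \<le> (LINT x|lebesgue_on U. (\<eta> x * v (Suc j) x)\<^sup>2)"
          unfolding Y_def
        proof (rule integral_mono[OF iY])
          show "integrable (lebesgue_on U) (\<lambda>x. (\<eta> x * v (Suc j) x)\<^sup>2)" using sqw by (simp add: square_integrable_def)
          show "indicator (cball x0 (rr (Suc j))) x * (v (Suc j) x)\<^sup>2 \<le> (\<eta> x * v (Suc j) x)\<^sup>2" for x
            using \<eta>(4)[of x] by (auto simp: indicator_def)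
        qed
        \<comment> \<open>Chebyshev's inequality: on \<open>A\<close> the excess over the old level
          is at least the gap between the two levels.\<close>
        have Am: "measure (lebesgue_on U) A * (k / (2 * 2 ^ j))\<^sup>2 \<le> Y j"
        proof -
          have iA: "integrable (lebesgue_on U) (\<lambda>x. indicator A x *\<^sub>R (k / (2 * 2 ^ j))\<^sup>2)"
            using square_integrable_mult[OF square_integrable_const[OF U, of 1] square_integrable_const[OF U, of "(k / (2 * 2 ^ j))\<^sup>2"]]
            by (intro integrable_mult_indicator A) simp
          have "measure (lebesgue_on U) A * (k / (2 * 2 ^ j))\<^sup>2 = (LINT x|lebesgue_on U. indicator A x *\<^sub>R (k / (2 * 2 ^ j))\<^sup>2)"
            using A sets.sets_into_space[OF A] by (simp add: Int_absorb2)
          also have "\<dots> \<le> Y j"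
            unfolding Y_def
          proof (rule integral_mono[OF iA iY])
            fix x
            show "indicator A x *\<^sub>R (k / (2 * 2 ^ j))\<^sup>2 \<le> indicator (cball x0 (rr j)) x * (v j x)\<^sup>2"
            proof (cases "x \<in> A")
              case True
              then have "k / (2 * 2 ^ j) \<le> v j x" using kk(3)[of j] by (auto simp: A_def v_def)
              then have "(k / (2 * 2 ^ j))\<^sup>2 \<le> (v j x)\<^sup>2" using k by (intro power_mono) auto
              then show ?thesis using True by (simp add: A_def)
            qed simp
          qed
          finally show ?thesis .
        qed
        have I1: "(LINT x|lebesgue_on U. (\<eta> x)\<^sup>2 * (\<phi> x * v (Suc j) x)) \<le> (4 * 4 ^ j) * Y j"
        proof -
          have "(LINT x|lebesgue_on U. (\<eta> x)\<^sup>2 * (\<phi> x * v (Suc j) x))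
              \<le> (LINT x|lebesgue_on U. (4 * 4 ^ j) * (indicator (cball x0 (rr j)) x * (v j x)\<^sup>2))"
          proof (rule integral_mono[OF i1])
            show "integrable (lebesgue_on U) (\<lambda>x. (4 * 4 ^ j) * (indicator (cball x0 (rr j)) x * (v j x)\<^sup>2))"
              using iY by simp
            fix x
            show "(\<eta> x)\<^sup>2 * (\<phi> x * v (Suc j) x) \<le> (4 * 4 ^ j) * (indicator (cball x0 (rr j)) x * (v j x)\<^sup>2)"
            proof (cases "dist x0 x < rr j \<and> kk (Suc j) < \<phi> x")
              case False
              then have "\<eta> x = 0 \<or> v (Suc j) x = 0" using \<eta>(5)[of x] by (auto simp: v_def)
              then show ?thesis by (auto simp: indicator_def)
            next
              case True
              then have vj: "v j x = \<phi> x - kk j" "k / (2 * 2 ^ j) \<le> v j x" using kk(3,4)[of j] by (auto simp: v_def)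
              \<comment> \<open>The eigenvalue term contains \<phi> instead of a truncation. Above
                the new level, k is at most 2 * 2^j times the excess over the old level, so \<phi>
                is bounded by a multiple of that excess and the term is controlled by
                \<open>Y j\<close>.\<close>
              have "k \<le> (2 * 2 ^ j) * v j x" using vj(2) by (simp add: field_simps)
              then have "\<phi> x \<le> v j x + (2 * 2 ^ j) * v j x" using vj(1) kk(2)[of j] by linarith
              also have "\<dots> = (1 + 2 * 2 ^ j) * v j x" by (simp add: distrib_right)
              also have "(1 + 2 * 2 ^ j) * v j x \<le> (4 * 4 ^ j) * v j x"
              proof (intro mult_right_mono vmono(2))
                have "(2::real) ^ j \<le> 4 ^ j" "(1::real) \<le> 2 ^ j" by (auto intro: power_mono)
                then show "1 + 2 * 2 ^ j \<le> (4::real) * 4 ^ j" by linarith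
              qed
              finally have le: "\<phi> x \<le> (4 * 4 ^ j) * v j x" .
              have "kk (Suc j) < \<phi> x" using True by simp
              then have "0 \<le> \<phi> x" using kk(1)[of "Suc j"] by linarith
              then have "\<phi> x * v (Suc j) x \<le> ((4 * 4 ^ j) * v j x) * v j x"
                using le vmono by (intro mult_mono) auto
              moreover have "(\<eta> x)\<^sup>2 \<le> 1" using \<eta>(2,3)[of x] by (intro power_le_one) auto
              moreover have "0 \<le> \<phi> x * v (Suc j) x" using \<open>0 \<le> \<phi> x\<close> vmono(2) by simp
              ultimately have "(\<eta> x)\<^sup>2 * (\<phi> x * v (Suc j) x) \<le> 1 * (((4 * 4 ^ j) * v j x) * v j x)"
                by (intro mult_mono[of "(\<eta> x)\<^sup>2" 1 "\<phi> x * v (Suc j) x"]) simp_all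
              then show ?thesis using True by (simp add: power2_eq_square mult_ac)
            qed
          qed
          also have "\<dots> = (4 * 4 ^ j) * Y j" using iY by (simp add: Y_def)
          finally show ?thesis .
        qed
        have I2: "(LINT x|lebesgue_on U. (v (Suc j) x)\<^sup>2 * (norm (gradient \<eta> x))\<^sup>2) \<le> (C0 * (4 * 2 ^ j) / r)\<^sup>2 * Y j"
        proof -
          have "(LINT x|lebesgue_on U. (v (Suc j) x)\<^sup>2 * (norm (gradient \<eta> x))\<^sup>2)
              \<le> (LINT x|lebesgue_on U. (C0 * (4 * 2 ^ j) / r)\<^sup>2 * (indicator (cball x0 (rr j)) x * (v j x)\<^sup>2))"
          proof (rule integral_mono[OF i2])
            show "integrable (lebesgue_on U) (\<lambda>x. (C0 * (4 * 2 ^ j) / r)\<^sup>2 * (indicator (cball x0 (rr j)) x * (v j x)\<^sup>2))"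
              using iY by simp
            fix x
            show "(v (Suc j) x)\<^sup>2 * (norm (gradient \<eta> x))\<^sup>2 \<le> (C0 * (4 * 2 ^ j) / r)\<^sup>2 * (indicator (cball x0 (rr j)) x * (v j x)\<^sup>2)"
            proof (cases "dist x0 x < rr j")
              case False
              then show ?thesis using \<eta>(7)[of x] by simp
            next
              case True
              have "norm (gradient \<eta> x) \<le> C0 / (rr j - rr (Suc j))"
                unfolding \<eta>_def by (rule C0(2)[OF rr(1,2)])
              also have "\<dots> = C0 * (4 * 2 ^ j) / r" unfolding rr(3) by simp
              finally have "(norm (gradient \<eta> x))\<^sup>2 \<le> (C0 * (4 * 2 ^ j) / r)\<^sup>2" by (intro power_mono) auto
              moreover have "(v (Suc j) x)\<^sup>2 \<le> (v j x)\<^sup>2" using vmono by (intro power_mono) auto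
              ultimately have "(v (Suc j) x)\<^sup>2 * (norm (gradient \<eta> x))\<^sup>2 \<le> (v j x)\<^sup>2 * (C0 * (4 * 2 ^ j) / r)\<^sup>2"
                by (intro mult_mono) auto
              then show ?thesis using True by (simp add: mult.commute)
            qed
          qed
          also have "\<dots> = (C0 * (4 * 2 ^ j) / r)\<^sup>2 * Y j" using iY by (simp add: Y_def)
          finally show ?thesis .
        qed
        have G: "(LINT x|lebesgue_on U. (norm (g x))\<^sup>2) \<le> \<Lambda>\<^sup>2 * (4 + 16 * C0\<^sup>2) * 4 ^ j / r\<^sup>2 * Y j"
        proof -
          have "(LINT x|lebesgue_on U. (norm (g x))\<^sup>2) \<le> \<Lambda> * (1 / r\<^sup>2 * ((4 * 4 ^ j) * Y j) + \<Lambda> * ((C0 * (4 * 2 ^ j) / r)\<^sup>2 * Y j))"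
          proof (rule order_trans[OF gle])
            have "?ev * (LINT x|lebesgue_on U. (\<eta> x)\<^sup>2 * (\<phi> x * v (Suc j) x)) \<le> ?ev * ((4 * 4 ^ j) * Y j)"
              using I1 ev0 by (intro mult_left_mono) auto
            also have "\<dots> \<le> 1 / r\<^sup>2 * ((4 * 4 ^ j) * Y j)"
              using ev1 Y0 by (intro mult_right_mono) auto
            finally show "\<Lambda> * (?ev * (LINT x|lebesgue_on U. (\<eta> x)\<^sup>2 * (\<phi> x * v (Suc j) x))
              + \<Lambda> * (LINT x|lebesgue_on U. (v (Suc j) x)\<^sup>2 * (norm (gradient \<eta> x))\<^sup>2))
              \<le> \<Lambda> * (1 / r\<^sup>2 * ((4 * 4 ^ j) * Y j) + \<Lambda> * ((C0 * (4 * 2 ^ j) / r)\<^sup>2 * Y j))"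
              using I2 \<Lambda> by (intro mult_left_mono add_mono) auto
          qed
          also have "\<dots> = (\<Lambda> * 4 + \<Lambda>\<^sup>2 * (16 * C0\<^sup>2)) * (4 ^ j / r\<^sup>2 * Y j)"
          proof -
            have "(2 ^ j)\<^sup>2 = (4::real) ^ j" by (simp add: power2_eq_square power_mult_distrib[symmetric])
            then show ?thesis by (simp add: power_divide power_mult_distrib) (simp add: power2_eq_square algebra_simps add_divide_distrib)
          qed
          also have "\<dots> \<le> (\<Lambda>\<^sup>2 * 4 + \<Lambda>\<^sup>2 * (16 * C0\<^sup>2)) * (4 ^ j / r\<^sup>2 * Y j)"
          proof (rule mult_right_mono)
            show "\<Lambda> * 4 + \<Lambda>\<^sup>2 * (16 * C0\<^sup>2) \<le> \<Lambda>\<^sup>2 * 4 + \<Lambda>\<^sup>2 * (16 * C0\<^sup>2)"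
              using \<Lambda> by (simp add: power2_eq_square)
            show "0 \<le> 4 ^ j / r\<^sup>2 * Y j" using Y0 by simp
          qed
          finally show ?thesis by (simp add: algebra_simps add_divide_distrib)
        qed
        have Am': "measure (lebesgue_on U) A \<le> 4 * 4 ^ j / k\<^sup>2 * Y j"
        proof -
          have "(2 ^ j)\<^sup>2 = (4::real) ^ j" by (simp add: power2_eq_square power_mult_distrib[symmetric])
          then have "measure (lebesgue_on U) A * (k\<^sup>2 / (4 * 4 ^ j)) \<le> Y j" using Am
            by (simp add: power_divide power_mult_distrib)
          then show ?thesis using k by (simp add: field_simps)
        qed
        have "Y (Suc j) \<le> measure (lebesgue_on U) A * (LINT x|lebesgue_on U. (norm (g x))\<^sup>2)"
          using Yw S by linarith
        also have "\<dots> \<le> (4 * 4 ^ j / k\<^sup>2 * Y j) * (\<Lambda>\<^sup>2 * (4 + 16 * C0\<^sup>2) * 4 ^ j / r\<^sup>2 * Y j)"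
          using Y0 by (intro mult_mono Am' G) auto
        also have "\<dots> = M * 16 ^ j / (k\<^sup>2 * r\<^sup>2) * (Y j)\<^sup>2"
        proof -
          have "(16::real) ^ j = 4 ^ j * 4 ^ j" by (simp add: power_mult_distrib[symmetric])
          then show ?thesis by (simp add: M_def power2_eq_square algebra_simps add_divide_distrib)
        qed
        finally show ?thesis .
      qed
      have "Y 0 \<le> (LINT x|lebesgue_on U. indicator (cball x0 r) x * (\<phi> x)\<^sup>2)"
      proof -
        have "v 0 x = \<phi> x" if "x \<in> U" for x using \<phi>pos[OF that] by (simp add: v_def kk(5))
        then have "Y 0 = (LINT x|lebesgue_on U. indicator (cball x0 r) x * (\<phi> x)\<^sup>2)"
          unfolding Y_def rr(5) by (intro Bochner_Integration.integral_cong) auto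
        then show ?thesis by simp
      qed
      then have "Y 0 \<le> (k\<^sup>2 * r\<^sup>2) / (16 * M)" using big by linarith
      then have Yle: "Y j \<le> (k\<^sup>2 * r\<^sup>2) / (16 * M) / 16 ^ j" for j
        by (intro De_Giorgi_recursion M Y0 step) (use k r in auto)
      have iv: "integrable (lebesgue_on U) (\<lambda>x. indicator (cball x0 (r / 2)) x * (max (\<phi> x - k) 0)\<^sup>2)"
        using indicator_square_integrable[of U "\<lambda>x. max (\<phi> x - k) 0" "cball x0 (r / 2)"]
          W012_with_gradient_positive_part[OF U(1) less_imp_le[OF k] W]
        by (simp add: W012_with_gradient_def)
      \<comment> \<open>The squared excess over the limiting level k on the half disc. It lies below
        every \<open>Y j\<close>, and these tend to 0.\<close>
      define Z where "Z = (LINT x|lebesgue_on U. indicator (cball x0 (r / 2)) x * (max (\<phi> x - k) 0)\<^sup>2)"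
      have ZY: "Z \<le> Y j" for j
        unfolding Z_def Y_def
      proof (rule integral_mono[OF iv iY])
        fix x
        have "(max (\<phi> x - k) 0)\<^sup>2 \<le> (v j x)\<^sup>2" unfolding v_def using kk(2)[of j] by (intro power_mono) auto
        moreover have "indicator (cball x0 (r / 2)) x \<le> (indicator (cball x0 (rr j)) x :: real)"
          using rr(4)[of j] by (auto simp: indicator_def)
        ultimately show "indicator (cball x0 (r / 2)) x * (max (\<phi> x - k) 0)\<^sup>2 \<le> indicator (cball x0 (rr j)) x * (v j x)\<^sup>2"
          by (intro mult_mono) auto
      qed
      have Zle: "Z \<le> (k\<^sup>2 * r\<^sup>2) / (16 * M) * (1 / 16) ^ j" for j
      proof -
        have "Z \<le> (k\<^sup>2 * r\<^sup>2) / (16 * M) / 16 ^ j" by (rule order_trans[OF ZY Yle])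
        also have "\<dots> = (k\<^sup>2 * r\<^sup>2) / (16 * M) * (1 / 16) ^ j" by (simp add: power_one_over)
        finally show ?thesis .
      qed
      have "(\<lambda>j. (k\<^sup>2 * r\<^sup>2) / (16 * M) * (1 / 16) ^ j) \<longlonglongrightarrow> (k\<^sup>2 * r\<^sup>2) / (16 * M) * 0"
        by (intro tendsto_mult_left LIMSEQ_realpow_zero) auto
      then have "Z \<le> 0" using Zle by (intro LIMSEQ_le_const[where X = "\<lambda>j. (k\<^sup>2 * r\<^sup>2) / (16 * M) * (1 / 16) ^ j"]) auto
      moreover have "0 \<le> Z" unfolding Z_def by (intro Bochner_Integration.integral_nonneg) auto
      ultimately have "Z = 0" by simp
      then have "AE x in lebesgue_on U. indicator (cball x0 (r / 2)) x * (max (\<phi> x - k) 0)\<^sup>2 = 0"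
        unfolding Z_def using integral_nonneg_eq_0_iff_AE[OF iv] by simp
      then have "AE x in lebesgue. x \<in> U \<longrightarrow> indicator (cball x0 (r / 2)) x * (max (\<phi> x - k) 0)\<^sup>2 = 0"
        using AE_restrict_space_iff[of U lebesgue] U(1) by simp
      then have "AE x in lebesgue. x \<in> U \<inter> ball x0 (r / 2) \<longrightarrow> \<phi> x \<le> k"
        by eventually_elim (auto simp: max_def split: if_splits)
      then have ae: "AE x in lebesgue_on (U \<inter> ball x0 (r / 2)). \<phi> x \<le> k"
        using AE_restrict_space_iff[of "U \<inter> ball x0 (r / 2)" lebesgue] U(1) by simp
      show "\<phi> x0 \<le> k"
        by (rule continuous_AE_le[OF _ _ _ ae])
          (use U(1) x0 r in \<open>auto intro: continuous_on_subset[OF \<phi>cont]\<close>)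
    qed
    let ?I = "LINT x|lebesgue_on U. indicator (cball x0 r) x * (\<phi> x)\<^sup>2"
    have I0: "0 \<le> ?I" by (intro Bochner_Integration.integral_nonneg) auto
    show ?thesis
    proof (rule field_le_epsilon)
      fix e :: real assume e: "0 < e"
      \<comment> \<open>The level sqrt s satisfies the starting condition of the recursion; the
        added e keeps it positive and is removed at the end.\<close>
      define s where "s = 16 * M / r\<^sup>2 * ?I + e"
      have s: "0 < s" unfolding s_def using M r I0 e by (intro add_nonneg_pos) auto
      have "?I = (16 * M / r\<^sup>2 * ?I) * (r\<^sup>2 / (16 * M))" using M r by simp
      also have "\<dots> \<le> s * (r\<^sup>2 / (16 * M))"
        unfolding s_def using M e by (intro mult_right_mono) auto
      also have "\<dots> = (sqrt s)\<^sup>2 * r\<^sup>2 / (16 * M)" using s by simp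
      finally have "\<phi> x0 \<le> sqrt s" using s by (intro bound) auto
      then have "(\<phi> x0)\<^sup>2 \<le> (sqrt s)\<^sup>2" using \<phi>pos[OF x0] by (intro power_mono) auto
      then show "(\<phi> x0)\<^sup>2 \<le> 16 * M / r\<^sup>2 * ?I + e" using s by (simp add: s_def)
    qed
  qed
  show thesis by (rule that[of "16 * M"]) (use M main in auto)
qed

section \<open>Inner uniform domains contain large balls\<close>

fun polygon_length :: "'a::metric_space list \<Rightarrow> ennreal" where
  "polygon_length [] = 0"
| "polygon_length [a] = 0"
| "polygon_length (a # b # zs) = ennreal (dist a b) + polygon_length (b # zs)"

text \<open>\<open>curve_length\<close> sums over positions in the list of parameters. The recursive
  form allows concatenation, insertion and reversal to be handled by list induction.\<close>

lemma polygon_length_eq_sum: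
  "polygon_length (map \<gamma> ts) = (\<Sum>k<length ts - 1. ennreal (dist (\<gamma> (ts ! k)) (\<gamma> (ts ! Suc k))))"
proof (induction ts rule: induct_list012)
  case (3 a b ts)
  have "(\<Sum>k<length (a # b # ts) - 1. ennreal (dist (\<gamma> ((a # b # ts) ! k)) (\<gamma> ((a # b # ts) ! Suc k))))
    = (\<Sum>k<Suc (length (b # ts) - 1). ennreal (dist (\<gamma> ((a # b # ts) ! k)) (\<gamma> ((a # b # ts) ! Suc k))))"
    by simp
  also have "\<dots> = ennreal (dist (\<gamma> a) (\<gamma> b)) +
      (\<Sum>k<length (b # ts) - 1. ennreal (dist (\<gamma> ((b # ts) ! k)) (\<gamma> ((b # ts) ! Suc k))))"
    by (subst sum.lessThan_Suc_shift) simp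
  finally show ?case using 3 by simp
qed auto

lemma curve_length_eq:
  "curve_length \<gamma> = (SUP ts\<in>{ts. sorted ts \<and> set ts \<subseteq> {0..1}}. polygon_length (map \<gamma> ts))"
  by (simp add: curve_length_def polygon_length_eq_sum)

lemma polygon_length_le_curve_length:
  "sorted ts \<Longrightarrow> set ts \<subseteq> {0..1} \<Longrightarrow> polygon_length (map \<gamma> ts) \<le> curve_length \<gamma>"
  unfolding curve_length_eq by (rule SUP_upper) simp

lemma curve_length_leI:
  "(\<And>ts. sorted ts \<Longrightarrow> set ts \<subseteq> {0..1} \<Longrightarrow> polygon_length (map \<gamma> ts) \<le> B) \<Longrightarrow> curve_length \<gamma> \<le> B"
  unfolding curve_length_eq by (rule SUP_least) simp

lemma polygon_length_Cons_le: "polygon_length zs \<le> polygon_length (c # zs)"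
  by (cases zs) auto

lemma polygon_length_split: "polygon_length (zs @ c # ws) = polygon_length (zs @ [c]) + polygon_length (c # ws)"
  by (induction zs rule: induct_list012) (auto simp: add.assoc)

lemma polygon_length_insert: "polygon_length (zs @ ws) \<le> polygon_length (zs @ c # ws)"
proof (induction zs rule: induct_list012)
  case 1
  then show ?case by (simp add: polygon_length_Cons_le)
next
  case (2 a)
  show ?case
  proof (cases ws)
    case (Cons b bs)
    have "ennreal (dist a b) \<le> ennreal (dist a c) + ennreal (dist c b)"
      by (simp add: ennreal_plus[symmetric] ennreal_leI dist_triangle del: ennreal_plus)
    then show ?thesis using Cons by (simp add: add.assoc[symmetric] add_right_mono)
  qed simp
next
  case (3 a b zs)
  then show ?case by (simp add: add_left_mono)
qed

lemma polygon_length_rev: "polygon_length (rev zs) = polygon_length zs"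
proof (induction zs rule: induct_list012)
  case (3 a b zs)
  have "polygon_length (rev (a # b # zs)) = polygon_length (rev zs @ b # [a])" by simp
  also have "\<dots> = polygon_length (rev zs @ [b]) + polygon_length [b, a]"
    by (rule polygon_length_split)
  finally show ?case using 3(2) by (simp add: dist_commute add.commute)
qed auto

text \<open>Inserting the junction point does not shorten an inscribed polygon. The enlarged polygon
  splits there into one inscribed in \<gamma> and one inscribed in \<delta>.\<close>

lemma curve_length_join:
  assumes "pathfinish \<gamma> = pathstart \<delta>"
  shows "curve_length (\<gamma> +++ \<delta>) \<le> curve_length \<gamma> + curve_length \<delta>"
proof (rule curve_length_leI)
  fix ts :: "real list" assume ts: "sorted ts" "set ts \<subseteq> {0..1}"
  \<comment> \<open>The parameters are sorted, so cutting the list at 1/2 separates those of the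
    first curve from those of the second.\<close>
  define xs ys where "xs = takeWhile (\<lambda>t. t \<le> 1 / 2) ts" and "ys = dropWhile (\<lambda>t. t \<le> 1 / 2) ts"
  have split: "ts = xs @ ys" by (simp add: xs_def ys_def)
  have sorted: "sorted xs" "sorted ys" using ts(1) by (simp_all add: split sorted_append)
  have xs: "0 \<le> t \<and> t \<le> 1 / 2" if "t \<in> set xs" for t
    using that ts(2) set_takeWhileD[of t "\<lambda>t. t \<le> 1 / 2" ts] by (auto simp: xs_def)
  have ys: "1 / 2 < t \<and> t \<le> 1" if t: "t \<in> set ys" for t
  proof -
    have ne: "ys \<noteq> []" using t by auto
    then have "\<not> hd ys \<le> 1 / 2" unfolding ys_def by (rule hd_dropWhile)
    moreover have "hd ys \<le> t" using sorted(2) t by (cases ys) auto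
    moreover have "t \<le> 1" using ts(2) t by (auto simp: split)
    ultimately show ?thesis by linarith
  qed
  have half: "(\<gamma> +++ \<delta>) (1 / 2) = \<gamma> 1" "\<gamma> 1 = \<delta> 0"
    using assms by (auto simp: joinpaths_def pathfinish_def pathstart_def)
  have "polygon_length (map (\<gamma> +++ \<delta>) ts) \<le> polygon_length (map (\<gamma> +++ \<delta>) xs @ \<gamma> 1 # map (\<gamma> +++ \<delta>) ys)"
    unfolding split map_append by (rule polygon_length_insert)
  also have "\<dots> = polygon_length (map (\<gamma> +++ \<delta>) xs @ [\<gamma> 1]) + polygon_length (\<gamma> 1 # map (\<gamma> +++ \<delta>) ys)"
    by (rule polygon_length_split)
  also have "map (\<gamma> +++ \<delta>) xs @ [\<gamma> 1] = map \<gamma> (map (\<lambda>t. 2 * t) xs @ [1])"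
    using xs by (auto simp: joinpaths_def)
  also have "\<gamma> 1 # map (\<gamma> +++ \<delta>) ys = map \<delta> (0 # map (\<lambda>t. 2 * t - 1) ys)"
    using ys half(2) by (fastforce simp: joinpaths_def)
  also have "polygon_length (map \<gamma> (map (\<lambda>t. 2 * t) xs @ [1])) + polygon_length (map \<delta> (0 # map (\<lambda>t. 2 * t - 1) ys))
      \<le> curve_length \<gamma> + curve_length \<delta>"
  proof (intro add_mono polygon_length_le_curve_length)
    have "sorted (map (\<lambda>t. 2 * t) xs)" "sorted (map (\<lambda>t. 2 * t - 1) ys)"
      unfolding sorted_map using sorted by (auto elim!: sorted_wrt_mono_rel[rotated])
    then show "sorted (map (\<lambda>t. 2 * t) xs @ [1])" "sorted (0 # map (\<lambda>t. 2 * t - 1) ys)"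
      using xs ys by (fastforce simp: sorted_append)+
    show "set (map (\<lambda>t. 2 * t) xs @ [1]) \<subseteq> {0..1}" using xs by force
    show "set (0 # map (\<lambda>t. 2 * t - 1) ys) \<subseteq> {0..1}" using ys by force
  qed
  finally show "polygon_length (map (\<gamma> +++ \<delta>) ts) \<le> curve_length \<gamma> + curve_length \<delta>" .
qed

lemma curve_length_reversepath_le: "curve_length (reversepath \<gamma>) \<le> curve_length \<gamma>"
proof (rule curve_length_leI)
  fix ts :: "real list" assume ts: "sorted ts" "set ts \<subseteq> {0..1}"
  have "polygon_length (map (reversepath \<gamma>) ts) = polygon_length (rev (map (reversepath \<gamma>) ts))"
    by (rule polygon_length_rev[symmetric])
  also have "rev (map (reversepath \<gamma>) ts) = map \<gamma> (rev (map (\<lambda>t. 1 - t) ts))"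
    by (simp add: rev_map reversepath_def)
  also have "polygon_length \<dots> \<le> curve_length \<gamma>"
  proof (rule polygon_length_le_curve_length)
    show "sorted (rev (map (\<lambda>t. 1 - t) ts))"
      unfolding sorted_wrt_rev sorted_wrt_map using ts(1) by (auto elim!: sorted_wrt_mono_rel[rotated])
  qed (use ts(2) in force)
  finally show "polygon_length (map (reversepath \<gamma>) ts) \<le> curve_length \<gamma>" .
qed

lemma ennreal_le_INF_add:
  fixes f :: "'i \<Rightarrow> ennreal"
  assumes "\<And>i. i \<in> A \<Longrightarrow> T \<le> f i + c"
  shows "T \<le> (INF i\<in>A. f i) + c"
proof (cases "c = top")
  case False
  have "T - c \<le> (INF i\<in>A. f i)"
  proof (rule INF_greatest)
    fix i assume "i \<in> A"
    from assms[OF this] False show "T - c \<le> f i" by (simp add: ennreal_minus_le_iff add.commute)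
  qed
  with False show ?thesis by (simp add: ennreal_minus_le_iff add.commute)
qed simp

lemma inner_dist_triangle: "inner_dist U x y \<le> inner_dist U x z + inner_dist U z y"
proof -
  have "inner_dist U x y \<le> curve_length \<gamma> + curve_length \<delta>"
    if "\<gamma> \<in> curves_in U x z" "\<delta> \<in> curves_in U z y" for \<gamma> \<delta>
  proof -
    have "\<gamma> +++ \<delta> \<in> curves_in U x y"
      using that by (auto simp: curves_in_def path_image_join)
    then have "inner_dist U x y \<le> curve_length (\<gamma> +++ \<delta>)"
      unfolding inner_dist_def by (rule INF_lower)
    also have "\<dots> \<le> curve_length \<gamma> + curve_length \<delta>"
      by (rule curve_length_join) (use that in \<open>auto simp: curves_in_def\<close>)
    finally show ?thesis .
  qed
  then have "inner_dist U x y \<le> inner_dist U z y + curve_length \<gamma>" if "\<gamma> \<in> curves_in U x z" for \<gamma>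
    unfolding inner_dist_def[of U z y] using that by (intro ennreal_le_INF_add) (metis add.commute)
  then show ?thesis
    unfolding inner_dist_def[of U x z] by (intro ennreal_le_INF_add) (metis add.commute)
qed

lemma inner_dist_commute: "inner_dist U x y = inner_dist U y x"
proof -
  have "inner_dist U y x \<le> inner_dist U x y" for x y
    unfolding inner_dist_def[of U x y]
  proof (rule INF_greatest)
    fix \<gamma> assume "\<gamma> \<in> curves_in U x y"
    then have "reversepath \<gamma> \<in> curves_in U y x" by (auto simp: curves_in_def)
    then have "inner_dist U y x \<le> curve_length (reversepath \<gamma>)"
      unfolding inner_dist_def by (rule INF_lower)
    then show "inner_dist U y x \<le> curve_length \<gamma>" using curve_length_reversepath_le order_trans by blast
  qed
  then show ?thesis by (simp add: order_antisym)
qed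

lemma dist_le_inner_dist: "ennreal (dist x y) \<le> inner_dist U x y"
  unfolding inner_dist_def
proof (rule INF_greatest)
  fix \<gamma> assume "\<gamma> \<in> curves_in U x y"
  then have "\<gamma> 0 = x" "\<gamma> 1 = y" by (auto simp: curves_in_def pathstart_def pathfinish_def)
  then show "ennreal (dist x y) \<le> curve_length \<gamma>"
    using polygon_length_le_curve_length[of "[0, 1]" \<gamma>] by simp
qed

lemma curve_length_lipschitz:
  assumes "0 \<le> B" "\<And>s t. s \<in> {0..1} \<Longrightarrow> t \<in> {0..1} \<Longrightarrow> dist (\<gamma> s) (\<gamma> t) \<le> B * \<bar>s - t\<bar>"
  shows "curve_length \<gamma> \<le> ennreal B"
proof (rule curve_length_leI)
  fix ts :: "real list" assume ts: "sorted ts" "set ts \<subseteq> {0..1}"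
  have "ts = [] \<or> polygon_length (map \<gamma> ts) \<le> ennreal (B * (1 - hd ts))"
    using ts
  proof (induction ts rule: induct_list012)
    case (3 a b ts)
    then have ab: "a \<le> b" "a \<in> {0..1}" "b \<in> {0..1}" by auto
    have "polygon_length (map \<gamma> (b # ts)) \<le> ennreal (B * (1 - b))" using 3 by auto
    moreover have "ennreal (dist (\<gamma> a) (\<gamma> b)) \<le> ennreal (B * (b - a))"
      using assms(2)[OF ab(2,3)] ab by (intro ennreal_leI) simp
    ultimately have "polygon_length (map \<gamma> (a # b # ts)) \<le> ennreal (B * (b - a)) + ennreal (B * (1 - b))"
      by (simp add: add_mono)
    also have "\<dots> = ennreal (B * (1 - a))"
      using ab assms(1) by (subst ennreal_plus[symmetric]) (auto simp: algebra_simps intro!: mult_left_mono mult_left_le)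
    finally show ?case by simp
  qed auto
  moreover have "B * (1 - hd ts) \<le> B" if "ts \<noteq> []"
    using that ts(2) assms(1) by (cases ts) (auto simp: mult_left_le)
  ultimately show "polygon_length (map \<gamma> ts) \<le> ennreal B"
    by (cases "ts = []") (auto intro: order_trans ennreal_leI)
qed

text \<open>Two points of a connected open set are joined inside it by a polynomial curve, which is
  Lipschitz on the unit interval and hence of finite length. Finiteness allows the quotient in
  \<open>inner_uniform\<close> to be evaluated in the reals.\<close>

lemma inner_dist_finite:
  assumes "open U" "connected U" "x \<in> U" "y \<in> U"
  shows "inner_dist U x y < top"
proof -
  obtain \<gamma> where \<gamma>: "polynomial_function \<gamma>" "path_image \<gamma> \<subseteq> U" "pathstart \<gamma> = x" "pathfinish \<gamma> = y"
    using connected_open_polynomial_connected[OF assms] by blast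
  obtain \<gamma>' where \<gamma>': "polynomial_function \<gamma>'" "\<And>t. (\<gamma> has_vector_derivative \<gamma>' t) (at t)"
    using has_vector_derivative_polynomial_function[OF \<gamma>(1)] by blast
  have "compact (\<gamma>' ` {0..1})"
    using \<gamma>'(1) by (intro compact_continuous_image continuous_on_polymonial_function) auto
  then have "bounded (\<gamma>' ` {0..1})" by (rule compact_imp_bounded)
  then obtain B where B: "0 < B" "\<And>t. t \<in> {0..1} \<Longrightarrow> norm (\<gamma>' t) \<le> B"
    unfolding bounded_pos by auto
  have "dist (\<gamma> s) (\<gamma> t) \<le> B * \<bar>s - t\<bar>" if "s \<in> {0..1}" "t \<in> {0..1}" for s t
  proof -
    have "norm (\<gamma> s - \<gamma> t) \<le> B * norm (s - t)"
    proof (rule differentiable_bound[of "{0..1}" _ "\<lambda>t h. h *\<^sub>R \<gamma>' t"])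
      show "(\<gamma> has_derivative (\<lambda>h. h *\<^sub>R \<gamma>' t)) (at t within {0..1})" for t
        using \<gamma>'(2)[of t] by (simp add: has_vector_derivative_def has_derivative_at_withinI)
      show "onorm (\<lambda>h. h *\<^sub>R \<gamma>' t) \<le> B" if "t \<in> {0..1}" for t
      proof (rule onorm_bound)
        fix h :: real
        show "norm (h *\<^sub>R \<gamma>' t) \<le> B * norm h"
          using mult_right_mono[OF B(2)[OF that], of "\<bar>h\<bar>"] by (simp add: mult.commute)
      qed (use B(1) in simp)
    qed (use that in auto)
    then show ?thesis by (simp add: dist_norm)
  qed
  then have "curve_length \<gamma> \<le> ennreal B" using B(1) by (intro curve_length_lipschitz) auto
  moreover have "\<gamma> \<in> curves_in U x y"
    using \<gamma> by (auto simp: curves_in_def intro: path_polynomial_function)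
  ultimately have "inner_dist U x y \<le> ennreal B"
    unfolding inner_dist_def by (meson INF_lower2)
  then show ?thesis using ennreal_less_top le_less_trans by blast
qed

text \<open>The ball is centred at a point of a uniform curve that is equidistant from two almost
  diametrically opposite points.\<close>

lemma inner_uniform_contains_ball:
  fixes V :: "'a::euclidean_space set"
  assumes V: "bounded_domain V" and iu: "inner_uniform C0 c0 V"
  obtains z \<rho> x where "0 < \<rho>" "ball z \<rho> \<subseteq> V" "V \<subseteq> cball x (8 * \<rho> / c0)"
proof -
  have op: "open V" "connected V" "bounded V" "V \<noteq> {}" using V by (auto simp: bounded_domain_def)
  have c0: "0 < c0" using iu by (simp add: inner_uniform_def)
  obtain x where x: "x \<in> V" using op(4) by blast
  have bdd: "bdd_above (dist x ` V)"
    using op(3) bounded_any_center[of V x] by (auto simp: bdd_above_def)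
  define s where "s = (SUP y\<in>V. dist x y)"
  have s_up: "dist x y \<le> s" if "y \<in> V" for y
    unfolding s_def by (rule cSUP_upper[OF that bdd])
  obtain e where e: "e > 0" "ball x e \<subseteq> V" using op(1) x openE by blast
  obtain b :: 'a where b: "b \<in> Basis" using nonempty_Basis by blast
  have "x + (e / 2) *\<^sub>R b \<in> V" using e b by (auto simp: dist_norm subset_eq)
  from s_up[OF this] have s: "0 < s" using e b by (simp add: dist_norm)
  \<comment> \<open>A point at more than half the largest distance from \<open>x\<close>; twice its
    distance D then bounds all distances from \<open>x\<close>, so \<open>V\<close> lies in the ball
    of radius 2 D around \<open>x\<close>.\<close>
  have "s / 2 < (SUP y\<in>V. dist x y)" using s by (simp add: s_def[symmetric])
  then obtain y where y: "y \<in> V" "s / 2 < dist x y"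
    using less_cSUP_iff[OF op(4) bdd] by blast
  define D where "D = dist x y"
  have D: "0 < D" "s \<le> 2 * D" using s y by (auto simp: D_def)
  obtain \<gamma> where \<gamma>: "\<gamma> \<in> curves_in V x y" and
    cone: "\<And>z. z \<in> path_image \<gamma> \<Longrightarrow> ennreal c0 * inner_dist V x z * inner_dist V y z / inner_dist V x y
            \<le> ennreal (boundary_dist V z)"
    using iu x y(1) unfolding inner_uniform_def by blast
  have g: "path \<gamma>" "path_image \<gamma> \<subseteq> V" "\<gamma> 0 = x" "\<gamma> 1 = y"
    using \<gamma> by (auto simp: curves_in_def pathstart_def pathfinish_def)
  \<comment> \<open>Continuity provides a point at Euclidean distance D/2 from \<open>x\<close>; by
    the triangle inequality it is at least as far from \<open>y\<close>.\<close>
  have "\<exists>t. 0 \<le> t \<and> t \<le> 1 \<and> dist x (\<gamma> t) = D / 2"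
    by (rule IVT') (use g D in \<open>auto simp: D_def path_def intro!: continuous_intros\<close>)
  then obtain t where t: "0 \<le> t" "t \<le> 1" "dist x (\<gamma> t) = D / 2" by blast
  define z where "z = \<gamma> t"
  have zi: "z \<in> path_image \<gamma>" using t by (auto simp: z_def path_image_def)
  then have z: "z \<in> V" using g by blast
  have xz: "dist x z = D / 2" by (simp add: z_def t)
  have "dist x y \<le> dist x z + dist z y" by (rule dist_triangle)
  then have yz: "D / 2 \<le> dist y z" using xz by (simp add: D_def dist_commute)
  obtain p q m where pq: "inner_dist V x z = ennreal p" "inner_dist V y z = ennreal q" "inner_dist V x y = ennreal m"
      "0 \<le> p" "0 \<le> q" "0 \<le> m"
    using inner_dist_finite[OF op(1,2) x z] inner_dist_finite[OF op(1,2) y(1) z] inner_dist_finite[OF op(1,2) x y(1)]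
    by (metis ennreal_cases less_irrefl infinity_ennreal_def)
  have p: "D / 2 \<le> p" using dist_le_inner_dist[of x z V] pq by (simp add: xz)
  have q: "D / 2 \<le> q" using dist_le_inner_dist[of y z V] pq yz by simp
  have m: "m \<le> p + q"
    using inner_dist_triangle[of V x y z] unfolding inner_dist_commute[of V z y] pq
    using pq by (simp add: ennreal_plus[symmetric] del: ennreal_plus)
  have m0: "D \<le> m" using dist_le_inner_dist[of x y V] pq by (simp add: D_def)
  \<comment> \<open>As m <= p + q, the quotient p q / m is at least p q / (p + q), and this is at
    least D/4 because p and q are both at least D/2.\<close>
  have "c0 * (D / 4) \<le> c0 * p * q / m"
  proof -
    have "D / 4 * m \<le> D / 4 * (p + q)" using m D by (intro mult_left_mono) auto
    also have "\<dots> = (D / 2) * p / 2 + (D / 2) * q / 2" by (simp add: algebra_simps)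
    also have "\<dots> \<le> q * p / 2 + p * q / 2"
      using p q pq by (intro add_mono divide_right_mono mult_right_mono) auto
    also have "\<dots> = p * q" by simp
    finally have "D / 4 \<le> p * q / m" using m0 D by (simp add: pos_le_divide_eq)
    then have "c0 * (D / 4) \<le> c0 * (p * q / m)" using c0 by (intro mult_left_mono) auto
    then show ?thesis by simp
  qed
  moreover have "ennreal (c0 * p * q / m) \<le> ennreal (boundary_dist V z)"
  proof -
    have "0 < m" using m0 D by linarith
    then have "ennreal (c0 * p * q / m) = ennreal c0 * ennreal p * ennreal q / ennreal m"
      using c0 pq by (simp add: ennreal_mult[symmetric] divide_ennreal)
    then show ?thesis using cone[OF zi] unfolding pq by simp
  qed
  then have "c0 * p * q / m \<le> boundary_dist V z" by (simp add: infdist_nonneg)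
  ultimately have bd: "c0 * D / 4 \<le> boundary_dist V z" by linarith
  have "ball z (c0 * D / 4) \<subseteq> V"
  proof (rule ccontr)
    \<comment> \<open>A ball meeting both \<open>V\<close> and its complement contains a frontier
      point, which would be too close to \<open>z\<close>.\<close>
    assume n: "\<not> ball z (c0 * D / 4) \<subseteq> V"
    have "z \<in> ball z (c0 * D / 4)" using c0 D by simp
    then have "ball z (c0 * D / 4) \<inter> V \<noteq> {}" using z by blast
    moreover have "ball z (c0 * D / 4) - V \<noteq> {}" using n by blast
    ultimately have "ball z (c0 * D / 4) \<inter> frontier V \<noteq> {}"
      by (intro connected_Int_frontier) auto
    then obtain q where "q \<in> frontier V" "dist z q < c0 * D / 4" by auto
    then show False using infdist_le[of q "frontier V" z] bd by linarith
  qed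
  moreover have "V \<subseteq> cball x (8 * (c0 * D / 4) / c0)"
    using s_up D c0 by force
  ultimately show thesis using that[of "c0 * D / 4"] c0 D by simp
qed

section \<open>Decay of the eigenfunction at the boundary of a planar domain\<close>

lemma integral_indicator_lebesgue_on_le:
  fixes A :: "'a::euclidean_space set"
  assumes "open U" "A \<in> sets borel" "bounded A"
  shows "integrable (lebesgue_on U) (indicator A :: 'a \<Rightarrow> real)"
    and "(LINT x|lebesgue_on U. indicator A x) \<le> measure lborel A"
proof -
  have fin: "emeasure lborel A < \<infinity>" "emeasure lborel (A \<inter> U) < \<infinity>"
    by (rule emeasure_bounded_finite[OF assms(3)], rule emeasure_bounded_finite[OF bounded_Int])
      (simp add: assms(3))
  have AU: "A \<inter> U \<in> sets borel" using assms by auto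
  have i: "integrable lborel (indicator (A \<inter> U) :: 'a \<Rightarrow> real)"
    using fin AU by (intro integrable_real_indicator) auto
  have m: "(indicator (A \<inter> U) :: 'a \<Rightarrow> real) \<in> borel_measurable borel" using AU by simp
  have z: "x \<notin> U \<Longrightarrow> indicator (A \<inter> U) x = (0::real)" for x by simp
  have eq: "indicator (A \<inter> U) x = (indicator A x :: real)" if "x \<in> space (lebesgue_on U)" for x
    using that by (auto simp: indicator_def)
  have i': "integrable (lebesgue_on U) (indicator (A \<inter> U) :: 'a \<Rightarrow> real)"
    using integral_lebesgue_on_eq_lborel(2)[OF m assms(1) z] i by simp
  show "integrable (lebesgue_on U) (indicator A :: 'a \<Rightarrow> real)"
    by (rule Bochner_Integration.integrable_cong[OF refl eq, THEN iffD1, OF _ i'])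
  have "(LINT x|lebesgue_on U. indicator A x) = (LINT x|lebesgue_on U. (indicator (A \<inter> U) x :: real))"
    by (rule Bochner_Integration.integral_cong[OF refl eq[symmetric]])
  also have "\<dots> = measure lborel (A \<inter> U)"
    using integral_lebesgue_on_eq_lborel(1)[OF m assms(1) z] AU by simp
  also have "\<dots> \<le> measure lborel A"
    using fin(1) AU assms(2) by (intro measure_mono_fmeasurable) (auto simp: fmeasurable_def)
  finally show "(LINT x|lebesgue_on U. indicator A x) \<le> measure lborel A" .
qed

lemma measure_ball_real2: "0 \<le> r \<Longrightarrow> measure lborel (ball (x::real^2) r) = unit_ball_vol 2 * r\<^sup>2"
  by (simp add: content_ball)

text \<open>Averaging the cutoffs of \<open>N\<close> consecutive dyadic annuli imitates a logarithmic cutoff: in the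
  plane each of them has bounded energy, so the average has energy of order \<open>1 / N\<close>.\<close>

lemma logarithmic_cutoff:
  obtains C where "C > 0"
    "\<And>(x::real^2) R N. 0 < R \<Longrightarrow> 1 \<le> N \<Longrightarrow>
      \<exists>\<eta>. smooth \<eta> \<and> (\<forall>y. 0 \<le> \<eta> y \<and> \<eta> y \<le> 1) \<and> (\<forall>y\<in>cball x R. \<eta> y = 1) \<and>
        (\<forall>y. y \<notin> ball x (2 ^ N * R) \<longrightarrow> \<eta> y = 0) \<and>
        (\<forall>U. open U \<longrightarrow> bounded U \<longrightarrow> (LINT y|lebesgue_on U. (norm (gradient \<eta> y))\<^sup>2) \<le> C / real N)"
proof -
  obtain C where C: "C > 0" "\<And>(z::real^2) s t x. 0 < s \<Longrightarrow> s < t \<Longrightarrow>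
      norm (gradient (annulus_cutoff z s t) x) \<le> C / (t - s)"
    using annulus_cutoff_gradient_bound by blast
  let ?\<omega> = "unit_ball_vol 2"
  have main: "\<exists>\<eta>. smooth \<eta> \<and> (\<forall>y. 0 \<le> \<eta> y \<and> \<eta> y \<le> 1) \<and> (\<forall>y\<in>cball x R. \<eta> y = 1) \<and>
        (\<forall>y. y \<notin> ball x (2 ^ N * R) \<longrightarrow> \<eta> y = 0) \<and>
        (\<forall>U. open U \<longrightarrow> bounded U \<longrightarrow> (LINT y|lebesgue_on U. (norm (gradient \<eta> y))\<^sup>2) \<le> (4 * C\<^sup>2 * ?\<omega>) / real N)"
    if R: "0 < R" and N: "1 \<le> N" for x :: "real^2" and R N
  proof -
    define \<theta> where "\<theta> k = annulus_cutoff x (2 ^ k * R) (2 ^ Suc k * R)" for k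
    have sR: "0 < 2 ^ k * R" "2 ^ k * R < 2 ^ Suc k * R" for k :: nat using R by auto
    note \<theta> = annulus_cutoff[OF sR, where z = x, folded \<theta>_def]
    define \<eta> where "\<eta> y = 1 / real N * (\<Sum>k<N. \<theta> k y)" for y
    have sm: "smooth \<eta>"
      unfolding \<eta>_def by (intro smooth_mult smooth_const smooth_sum \<theta>(1))
    have "(\<Sum>k<N. \<theta> k y) \<le> (\<Sum>k<N. 1)" "0 \<le> (\<Sum>k<N. \<theta> k y)" for y
      by (intro sum_mono sum_nonneg \<theta>(2,3))+
    then have rng: "0 \<le> \<eta> y \<and> \<eta> y \<le> 1" for y using N by (auto simp: \<eta>_def field_simps)
    have one: "\<eta> y = 1" if "y \<in> cball x R" for y
    proof -
      have "\<theta> k y = 1" for k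
      proof (rule \<theta>(4))
        have "dist x y \<le> 1 * R" using that by simp
        also have "\<dots> \<le> 2 ^ k * R" using R by (intro mult_right_mono) auto
        finally show "dist x y \<le> 2 ^ k * R" .
      qed
      then show ?thesis using N by (simp add: \<eta>_def)
    qed
    have zero: "\<eta> y = 0" if "y \<notin> ball x (2 ^ N * R)" for y
    proof -
      have "\<theta> k y = 0" if "k < N" for k
      proof (rule \<theta>(5))
        have "2 ^ Suc k * R \<le> 2 ^ N * R" using that R by (intro mult_right_mono power_increasing) auto
        then show "2 ^ Suc k * R \<le> dist x y" using \<open>y \<notin> _\<close> by simp
      qed
      then show ?thesis by (simp add: \<eta>_def)
    qed
    have grad: "gradient \<eta> y = (1 / real N) *\<^sub>R (\<Sum>k<N. gradient (\<theta> k) y)" for y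
    proof (rule gradient_eqI)
      have "((\<lambda>y. \<Sum>k<N. \<theta> k y) has_derivative (\<lambda>h. \<Sum>k<N. h \<bullet> gradient (\<theta> k) y)) (at y)"
        by (intro has_derivative_sum smooth_GDERIV[OF \<theta>(1), unfolded gderiv_def])
      from has_derivative_mult_right[OF this, of "1 / real N"]
      show "GDERIV \<eta> y :> (1 / real N) *\<^sub>R (\<Sum>k<N. gradient (\<theta> k) y)"
        by (simp add: gderiv_def \<eta>_def[abs_def] inner_sum_right)
    qed
    \<comment> \<open>The gradients of distinct dyadic cutoffs live on disjoint annuli. The energy
      of their sum is therefore the sum of their energies, and the prefactor 1/N^2 against N bounded
      terms leaves 1/N.\<close>
    have disj: "gradient (\<theta> i) y = 0" if ij: "i \<noteq> j" and nz: "gradient (\<theta> j) y \<noteq> 0" for i j y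
    proof -
      have j: "2 ^ j * R < dist x y" "dist x y < 2 ^ Suc j * R"
        using \<theta>(6)[of y j] \<theta>(7)[of j y] nz by (meson not_le)+
      show ?thesis
      proof (cases "i < j")
        case True
        then have "2 ^ Suc i * R \<le> 2 ^ j * R" using R by (intro mult_right_mono power_increasing) auto
        then show ?thesis using j(1) by (intro \<theta>(7)) linarith
      next
        case False
        then have "2 ^ Suc j * R \<le> 2 ^ i * R" using R ij by (intro mult_right_mono power_increasing) auto
        then show ?thesis using j(2) by (intro \<theta>(6)) linarith
      qed
    qed
    have sq: "(norm (\<Sum>k<N. gradient (\<theta> k) y))\<^sup>2 = (\<Sum>k<N. (norm (gradient (\<theta> k) y))\<^sup>2)" for y
    proof (cases "\<exists>j<N. gradient (\<theta> j) y \<noteq> 0")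
      case True
      then obtain j where j: "j < N" "gradient (\<theta> j) y \<noteq> 0" by blast
      then have "gradient (\<theta> i) y = 0" if "i \<noteq> j" for i using disj that by blast
      then have "(\<Sum>k<N. gradient (\<theta> k) y) = gradient (\<theta> j) y"
        "(\<Sum>k<N. (norm (gradient (\<theta> k) y))\<^sup>2) = (norm (gradient (\<theta> j) y))\<^sup>2"
        using j(1) by (simp_all add: sum.remove[of "{..<N}" j])
      then show ?thesis by simp
    qed auto
    have pk: "(norm (gradient (\<theta> k) y))\<^sup>2 \<le> (C / (2 ^ k * R))\<^sup>2 * indicator (ball x (2 ^ Suc k * R)) y" for k y
    proof (cases "y \<in> ball x (2 ^ Suc k * R)")
      case True
      have "norm (gradient (\<theta> k) y) \<le> C / (2 ^ Suc k * R - 2 ^ k * R)"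
        unfolding \<theta>_def by (rule C(2)[OF sR])
      also have "2 ^ Suc k * R - 2 ^ k * R = 2 ^ k * R" by simp
      finally have "(norm (gradient (\<theta> k) y))\<^sup>2 \<le> (C / (2 ^ k * R))\<^sup>2" by (intro power_mono) auto
      then show ?thesis using True by simp
    qed (use \<theta>(7)[of k y] in simp)
    have "(LINT y|lebesgue_on U. (norm (gradient \<eta> y))\<^sup>2) \<le> (4 * C\<^sup>2 * ?\<omega>) / real N"
      if U: "open U" "bounded U" for U
    proof -
      have ib: "integrable (lebesgue_on U) (indicator (ball x r) :: real^2 \<Rightarrow> real)"
        "(LINT y|lebesgue_on U. indicator (ball x r) y) \<le> measure lborel (ball x r)" for r
        using integral_indicator_lebesgue_on_le[OF U(1), of "ball x r"] by auto
      have "integrable (lebesgue_on U) (\<lambda>y. (norm (gradient \<eta> y))\<^sup>2)"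
      proof -
        obtain B where B: "B > 0" "\<And>x. x \<in> U \<Longrightarrow> \<bar>\<eta> x\<bar> \<le> B" "\<And>x. x \<in> U \<Longrightarrow> norm (gradient \<eta> x) \<le> B"
          using smooth_bounded_on[OF sm U(2)] by blast
        show ?thesis
          using square_integrable_scaled_vector[OF square_integrable_const[OF U, of 1] smooth_measurable(2)[OF sm] B(3)]
          by (simp add: square_integrable_def)
      qed
      then have "(LINT y|lebesgue_on U. (norm (gradient \<eta> y))\<^sup>2)
        \<le> (LINT y|lebesgue_on U. (1 / real N)\<^sup>2 * (\<Sum>k<N. (C / (2 ^ k * R))\<^sup>2 * indicator (ball x (2 ^ Suc k * R)) y))"
      proof (rule integral_mono)
        show "integrable (lebesgue_on U) (\<lambda>y. (1 / real N)\<^sup>2 * (\<Sum>k<N. (C / (2 ^ k * R))\<^sup>2 * indicator (ball x (2 ^ Suc k * R)) y))"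
          by (intro integrable_mult_right Bochner_Integration.integrable_sum ib)
        fix y
        have "(norm (gradient \<eta> y))\<^sup>2 = (1 / real N)\<^sup>2 * (\<Sum>k<N. (norm (gradient (\<theta> k) y))\<^sup>2)"
          unfolding grad norm_scaleR power_mult_distrib sq by simp
        also have "\<dots> \<le> (1 / real N)\<^sup>2 * (\<Sum>k<N. (C / (2 ^ k * R))\<^sup>2 * indicator (ball x (2 ^ Suc k * R)) y)"
          by (intro mult_left_mono sum_mono pk) auto
        finally show "(norm (gradient \<eta> y))\<^sup>2 \<le> (1 / real N)\<^sup>2 * (\<Sum>k<N. (C / (2 ^ k * R))\<^sup>2 * indicator (ball x (2 ^ Suc k * R)) y)" .
      qed
      also have "\<dots> = (1 / real N)\<^sup>2 * (\<Sum>k<N. (C / (2 ^ k * R))\<^sup>2 * (LINT y|lebesgue_on U. indicator (ball x (2 ^ Suc k * R)) y))"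
      proof -
        have "(LINT y|lebesgue_on U. (\<Sum>k<N. (C / (2 ^ k * R))\<^sup>2 * indicator (ball x (2 ^ Suc k * R)) y))
          = (\<Sum>k<N. LINT y|lebesgue_on U. (C / (2 ^ k * R))\<^sup>2 * indicator (ball x (2 ^ Suc k * R)) y)"
          by (rule Bochner_Integration.integral_sum) (intro integrable_mult_right ib(1))
        then show ?thesis by (simp only: integral_mult_right_zero)
      qed
      also have "\<dots> \<le> (1 / real N)\<^sup>2 * (\<Sum>k<N. 4 * C\<^sup>2 * ?\<omega>)"
      proof (intro mult_left_mono sum_mono)
        fix k
        \<comment> \<open>The squared gradient is of order 1 / (2^k R)^2 and the area of order (2^k
          R)^2: in dimension two the scale cancels.\<close>
        have "(C / (2 ^ k * R))\<^sup>2 * (LINT y|lebesgue_on U. indicator (ball x (2 ^ Suc k * R)) y)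
          \<le> (C / (2 ^ k * R))\<^sup>2 * (?\<omega> * (2 ^ Suc k * R)\<^sup>2)"
          using ib(2)[of "2 ^ Suc k * R"] R measure_ball_real2[of "2 ^ Suc k * R" x]
          by (intro mult_left_mono) auto
        also have "\<dots> = 4 * C\<^sup>2 * ?\<omega>" using R by (simp add: power_divide power_mult_distrib field_simps)
        finally show "(C / (2 ^ k * R))\<^sup>2 * (LINT y|lebesgue_on U. indicator (ball x (2 ^ Suc k * R)) y) \<le> 4 * C\<^sup>2 * ?\<omega>" .
      qed auto
      also have "\<dots> = (4 * C\<^sup>2 * ?\<omega>) / real N" using N by (simp add: power2_eq_square field_simps)
      finally show ?thesis .
    qed
    with sm rng one zero show ?thesis by blast
  qed
  show thesis
    by (rule that[of "4 * C\<^sup>2 * ?\<omega>"]) (use C(1) main unit_ball_vol_pos[of 2] in auto)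
qed

lemma norm_real2_le: "norm (z::real^2) \<le> \<bar>z $ 1\<bar> + \<bar>z $ 2\<bar>"
  using norm_le_l1_cart[of z] by (simp add: sum_2)

text \<open>The parameter \<open>N\<close> stays free. It trades the area term, where the cutoff is
  supported on a disc of radius 2^N * 8d, against the energy of the cutoff; the choice is made once
  the required smallness is known.\<close>

lemma planar_boundary_decay:
  assumes \<Lambda>: "1 \<le> \<Lambda>" and \<alpha>: "0 < \<alpha>" "\<alpha> \<le> 1"
  obtains C where "C > 0"
    "\<And>(a :: real^2 \<Rightarrow> real^2 \<Rightarrow> real^2 \<Rightarrow> real) U \<phi> x N.
      bounded_domain U \<Longrightarrow> exterior_ball_condition \<alpha> U \<Longrightarrow>
      uniformly_elliptic \<Lambda> a \<Longrightarrow> principal_eigenfunction a U \<phi> \<Longrightarrow> x \<in> U \<Longrightarrow> 1 \<le> N \<Longrightarrow>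
      0 < dirichlet_eigenvalue a U \<Longrightarrow> dirichlet_eigenvalue a U * (2 * boundary_dist U x)\<^sup>2 \<le> 1 \<Longrightarrow>
      (\<phi> x)\<^sup>2 \<le> C * dirichlet_eigenvalue a U *
        (4 ^ N * (dirichlet_eigenvalue a U * (boundary_dist U x)\<^sup>2) + 1 / real N)"
proof -
  obtain CD where CD: "CD > 0"
    "\<And>(a :: real^2 \<Rightarrow> real^2 \<Rightarrow> real^2 \<Rightarrow> real) U \<phi> x0 r.
      open U \<Longrightarrow> bounded U \<Longrightarrow> uniformly_elliptic \<Lambda> a \<Longrightarrow> principal_eigenfunction a U \<phi> \<Longrightarrow>
      0 < r \<Longrightarrow> dirichlet_eigenvalue a U * r\<^sup>2 \<le> 1 \<Longrightarrow> x0 \<in> U \<Longrightarrow>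
      (\<phi> x0)\<^sup>2 \<le> CD / r\<^sup>2 * (LINT x|lebesgue_on U. indicator (cball x0 r) x * (\<phi> x)\<^sup>2)"
    using De_Giorgi_local_bound[OF \<Lambda>] by blast
  obtain CL where CL: "CL > 0"
    "\<And>(x::real^2) R N. 0 < R \<Longrightarrow> 1 \<le> N \<Longrightarrow>
      \<exists>\<eta>. smooth \<eta> \<and> (\<forall>y. 0 \<le> \<eta> y \<and> \<eta> y \<le> 1) \<and> (\<forall>y\<in>cball x R. \<eta> y = 1) \<and>
        (\<forall>y. y \<notin> ball x (2 ^ N * R) \<longrightarrow> \<eta> y = 0) \<and>
        (\<forall>U. open U \<longrightarrow> bounded U \<longrightarrow> (LINT y|lebesgue_on U. (norm (gradient \<eta> y))\<^sup>2) \<le> CL / real N)"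
    using logarithmic_cutoff by blast
  let ?\<omega> = "unit_ball_vol 2"
  have \<omega>: "0 < ?\<omega>" by simp
  \<comment> \<open>1024 / \<alpha> is 1 / (2d)^2 times the Poincare constant for half sides 4d and
    \<alpha> d / 4. \<open>CD\<close> enters twice, at radius 2d and in the global bound;
    \<Lambda>^2 comes from the energy estimate, 64 times the area of the unit disc from the square
    of 8d, and \<open>CL\<close> from the cutoff.\<close>
  define K where "K = 1024 / \<alpha> * CD\<^sup>2 * \<Lambda>\<^sup>2 * (64 * ?\<omega> + CL)"
  have "0 < 64 * ?\<omega> + CL" using \<omega> CL(1) by (intro add_pos_pos mult_pos_pos) auto
  then have K: "K > 0"
    unfolding K_def using \<alpha> CD(1) \<Lambda> by (intro mult_pos_pos divide_pos_pos zero_less_power) auto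
  have "(\<phi> x)\<^sup>2 \<le> K * dirichlet_eigenvalue a U * (4 ^ N * (dirichlet_eigenvalue a U * (boundary_dist U x)\<^sup>2) + 1 / real N)"
    if dom: "bounded_domain U" and ext: "exterior_ball_condition \<alpha> U" and ell: "uniformly_elliptic \<Lambda> a"
      and \<phi>: "principal_eigenfunction a U \<phi>" and x: "x \<in> U" and N: "1 \<le> N"
      and ev: "0 < dirichlet_eigenvalue a U" and small: "dirichlet_eigenvalue a U * (2 * boundary_dist U x)\<^sup>2 \<le> 1"
    for a :: "real^2 \<Rightarrow> real^2 \<Rightarrow> real^2 \<Rightarrow> real" and U \<phi> x N
  proof -
    let ?ev = "dirichlet_eigenvalue a U"
    define d where "d = boundary_dist U x"
    have U: "open U" "bounded U" "U \<noteq> {}" using dom by (auto simp: bounded_domain_def)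
    have fr: "frontier U \<noteq> {}"
    proof -
      have "U \<noteq> UNIV" using U(2) not_bounded_UNIV by blast
      then show ?thesis using U(3) frontier_eq_empty by blast
    qed
    have d: "0 < d"
    proof -
      have "x \<notin> frontier U" using x U(1) by (simp add: frontier_def interior_open)
      then have "d \<noteq> 0" unfolding d_def using in_closed_iff_infdist_zero[OF frontier_closed fr, of x] by simp
      then show ?thesis unfolding d_def using infdist_nonneg[of x "frontier U"] by simp
    qed
    have \<phi>pos: "y \<in> U \<Longrightarrow> 0 < \<phi> y" for y using \<phi> by (simp add: principal_eigenfunction_def)
    have norm1: "(LINT y|lebesgue_on U. (\<phi> y)\<^sup>2) = 1" using \<phi> by (simp add: principal_eigenfunction_def)
    have sq\<phi>: "square_integrable U \<phi>"
      using \<phi> W012_imp_with_gradient by (auto simp: principal_eigenfunction_def W012_with_gradient_def)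
    have sup: "(\<phi> y)\<^sup>2 \<le> CD * ?ev" if "y \<in> U" for y
    proof -
      \<comment> \<open>The largest radius permitted by the local maximum principle. The mass of the
        squared eigenfunction on the disc is at most its total mass 1.\<close>
      define r where "r = 1 / sqrt ?ev"
      have r: "0 < r" "?ev * r\<^sup>2 \<le> 1" "1 / r\<^sup>2 = ?ev" using ev by (auto simp: r_def power_divide)
      have "(\<phi> y)\<^sup>2 \<le> CD / r\<^sup>2 * (LINT z|lebesgue_on U. indicator (cball y r) z * (\<phi> z)\<^sup>2)"
        by (rule CD(2)[OF U(1,2) ell \<phi> r(1,2) that])
      also have "\<dots> \<le> CD / r\<^sup>2 * (LINT z|lebesgue_on U. (\<phi> z)\<^sup>2)"
        using CD(1) indicator_square_integrable[OF sq\<phi>, of "cball y r"] sq\<phi>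
        by (intro mult_left_mono integral_mono) (auto simp: square_integrable_def indicator_def)
      also have "\<dots> = CD * (1 / r\<^sup>2)" by (simp add: norm1)
      finally show ?thesis by (simp only: r(3))
    qed
    obtain w where w: "ball w (\<alpha> * d) \<subseteq> ball x (2 * d) - U"
      using ext x unfolding exterior_ball_condition_def d_def by blast
    \<comment> \<open>Points of the square with this half side are within 2 l = \<alpha> d / 2 of
      \<open>w\<close>, so the square fits in the exterior ball.\<close>
    define l where "l = \<alpha> * d / 4"
    have l: "0 < l" "l \<le> 4 * d" "l \<le> d" using \<alpha> d mult_right_mono[OF \<alpha>(2), of d] by (auto simp: l_def)
    have sub1: "square_around w l \<subseteq> ball w (\<alpha> * d)"
    proof
      fix z assume "z \<in> square_around w l"
      then have "norm (z - w) \<le> l + l" using norm_real2_le[of "z - w"] by (simp add: square_around_def)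
      also have "\<dots> < \<alpha> * d" using \<alpha> d by (simp add: l_def)
      finally show "z \<in> ball w (\<alpha> * d)" by (simp add: dist_norm norm_minus_commute)
    qed
    have sub2: "square_around w l \<subseteq> square_around x (4 * d)"
    proof
      fix z assume "z \<in> square_around w l"
      then have "dist x z < 2 * d" using sub1 w by auto
      then have "norm (z - x) < 2 * d" by (simp add: dist_norm norm_minus_commute)
      then have "\<bar>(z - x) $ 1\<bar> < 2 * d" "\<bar>(z - x) $ 2\<bar> < 2 * d"
        using component_le_norm_cart[of "z - x"] le_less_trans by blast+
      then show "z \<in> square_around x (4 * d)" using d by (simp add: square_around_def)
    qed
    have disj: "square_around w l \<inter> U = {}" using sub1 w by blast
    have Qball: "square_around x (4 * d) \<subseteq> cball x (8 * d)"
    proof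
      fix z assume "z \<in> square_around x (4 * d)"
      then have "norm (z - x) \<le> 4 * d + 4 * d" using norm_real2_le[of "z - x"] by (simp add: square_around_def)
      then show "z \<in> cball x (8 * d)" by (simp add: dist_norm norm_minus_commute)
    qed
    have ballQ: "cball x (2 * d) \<subseteq> square_around x (4 * d)"
    proof
      fix z assume "z \<in> cball x (2 * d)"
      then have "norm (z - x) \<le> 2 * d" by (simp add: dist_norm norm_minus_commute)
      then have "\<bar>(z - x) $ 1\<bar> \<le> 2 * d" "\<bar>(z - x) $ 2\<bar> \<le> 2 * d"
        using component_le_norm_cart[of "z - x"] order_trans by blast+
      then show "z \<in> square_around x (4 * d)" using d by (simp add: square_around_def)
    qed
    \<comment> \<open>The square of half side 4d contains the disc of radius 2d around
      \<open>x\<close>, and with it the exterior square. It lies in the disc of radius 8d, where the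
      cutoff is 1, so multiplying by the cutoff changes nothing in the mean to be estimated.\<close>
    have "0 < 8 * d" using d by simp
    from CL(2)[OF this N, of x]
    obtain \<eta> where cut: "smooth \<eta>" "\<forall>y. 0 \<le> \<eta> y \<and> \<eta> y \<le> 1" "\<forall>y\<in>cball x (8 * d). \<eta> y = 1"
        "\<forall>y. y \<notin> ball x (2 ^ N * (8 * d)) \<longrightarrow> \<eta> y = 0"
        "\<forall>U. open U \<longrightarrow> bounded U \<longrightarrow> (LINT y|lebesgue_on U. (norm (gradient \<eta> y))\<^sup>2) \<le> CL / real N"
      by blast
    then have \<eta>: "smooth \<eta>" "\<And>y. 0 \<le> \<eta> y \<and> \<eta> y \<le> 1" "\<And>y. y \<in> cball x (8 * d) \<Longrightarrow> \<eta> y = 1"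
        "\<And>y. y \<notin> ball x (2 ^ N * (8 * d)) \<Longrightarrow> \<eta> y = 0"
        "(LINT y|lebesgue_on U. (norm (gradient \<eta> y))\<^sup>2) \<le> CL / real N"
      using U(1,2) by blast+
    obtain g where g: "W012_with_gradient U (\<lambda>y. \<eta> y * max (\<phi> y - 0) 0) g"
      and "\<And>y. y \<in> U \<Longrightarrow> \<phi> y \<le> 0 \<Longrightarrow> g y = 0"
      and "\<And>y. y \<in> U \<Longrightarrow> \<eta> y = 0 \<Longrightarrow> gradient \<eta> y = 0 \<Longrightarrow> g y = 0"
      and i1: "integrable (lebesgue_on U) (\<lambda>y. (\<eta> y)\<^sup>2 * (\<phi> y * max (\<phi> y - 0) 0))"
      and i2: "integrable (lebesgue_on U) (\<lambda>y. (max (\<phi> y - 0) 0)\<^sup>2 * (norm (gradient \<eta> y))\<^sup>2)"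
      and gle: "(LINT y|lebesgue_on U. (norm (g y))\<^sup>2) \<le>
        \<Lambda> * (?ev * (LINT y|lebesgue_on U. (\<eta> y)\<^sup>2 * (\<phi> y * max (\<phi> y - 0) 0))
          + \<Lambda> * (LINT y|lebesgue_on U. (max (\<phi> y - 0) 0)\<^sup>2 * (norm (gradient \<eta> y))\<^sup>2))"
      by (rule Caccioppoli[OF U(1,2) ell \<Lambda> \<phi> order_refl \<eta>(1)]) blast
    have mx: "max (\<phi> y - 0) 0 = \<phi> y" if "y \<in> U" for y using \<phi>pos[OF that] by simp
    have sqw: "square_integrable U (\<lambda>y. \<eta> y * max (\<phi> y - 0) 0)"
      using g by (simp add: W012_with_gradient_def)
    let ?S = "CD * ?ev"
    have S: "0 < ?S" using CD(1) ev by simp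
    let ?R = "2 ^ N * (8 * d)"
    have I1: "(LINT y|lebesgue_on U. (\<eta> y)\<^sup>2 * (\<phi> y * max (\<phi> y - 0) 0)) \<le> ?S * (?\<omega> * ?R\<^sup>2)"
    proof -
      note ib = integral_indicator_lebesgue_on_le[OF U(1), of "ball x ?R"]
      have "(LINT y|lebesgue_on U. (\<eta> y)\<^sup>2 * (\<phi> y * max (\<phi> y - 0) 0)) \<le> (LINT y|lebesgue_on U. ?S * indicator (ball x ?R) y)"
      proof (rule integral_mono[OF i1])
        show "integrable (lebesgue_on U) (\<lambda>y. ?S * indicator (ball x ?R) y)" using ib(1) by simp
        fix y assume "y \<in> space (lebesgue_on U)"
        then have y: "y \<in> U" by simp
        show "(\<eta> y)\<^sup>2 * (\<phi> y * max (\<phi> y - 0) 0) \<le> ?S * indicator (ball x ?R) y"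
        proof (cases "y \<in> ball x ?R")
          case True
          have "(\<eta> y)\<^sup>2 * (\<phi> y)\<^sup>2 \<le> 1 * ?S"
            using \<eta>(2)[of y] sup[OF y] by (intro mult_mono power_le_one) auto
          then show ?thesis using True unfolding mx[OF y] by (simp add: power2_eq_square)
        qed (use \<eta>(4)[of y] in simp)
      qed
      also have "\<dots> = ?S * (LINT y|lebesgue_on U. indicator (ball x ?R) y)" by simp
      also have "\<dots> \<le> ?S * (?\<omega> * ?R\<^sup>2)"
        using ib(2) d S measure_ball_real2[of ?R x] by (intro mult_left_mono) auto
      finally show ?thesis .
    qed
    have I2: "(LINT y|lebesgue_on U. (max (\<phi> y - 0) 0)\<^sup>2 * (norm (gradient \<eta> y))\<^sup>2) \<le> ?S * (CL / real N)"
    proof -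
      obtain B where B: "B > 0" "\<And>x. x \<in> U \<Longrightarrow> \<bar>\<eta> x\<bar> \<le> B" "\<And>x. x \<in> U \<Longrightarrow> norm (gradient \<eta> x) \<le> B"
        using smooth_bounded_on[OF \<eta>(1) U(2)] by blast
      have ig: "integrable (lebesgue_on U) (\<lambda>y. (norm (gradient \<eta> y))\<^sup>2)"
        using square_integrable_scaled_vector[OF square_integrable_const[OF U(1,2), of 1] smooth_measurable(2)[OF \<eta>(1)] B(3)]
        by (simp add: square_integrable_def)
      have "(LINT y|lebesgue_on U. (max (\<phi> y - 0) 0)\<^sup>2 * (norm (gradient \<eta> y))\<^sup>2) \<le> (LINT y|lebesgue_on U. ?S * (norm (gradient \<eta> y))\<^sup>2)"
      proof (rule integral_mono[OF i2])
        show "integrable (lebesgue_on U) (\<lambda>y. ?S * (norm (gradient \<eta> y))\<^sup>2)" using ig by simp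
        fix y assume "y \<in> space (lebesgue_on U)"
        then have y: "y \<in> U" by simp
        show "(max (\<phi> y - 0) 0)\<^sup>2 * (norm (gradient \<eta> y))\<^sup>2 \<le> ?S * (norm (gradient \<eta> y))\<^sup>2"
          unfolding mx[OF y] using sup[OF y] by (intro mult_right_mono) auto
      qed
      also have "\<dots> = ?S * (LINT y|lebesgue_on U. (norm (gradient \<eta> y))\<^sup>2)" by simp
      also have "\<dots> \<le> ?S * (CL / real N)" using \<eta>(5) S by (intro mult_left_mono) auto
      finally show ?thesis .
    qed
    have G: "(LINT y|lebesgue_on U. (norm (g y))\<^sup>2)
        \<le> \<Lambda>\<^sup>2 * ?S * ((64 * ?\<omega> + CL) * (4 ^ N * (?ev * d\<^sup>2) + 1 / real N))"
    proof -
      have "(LINT y|lebesgue_on U. (norm (g y))\<^sup>2) \<le> \<Lambda> * (?ev * (?S * (?\<omega> * ?R\<^sup>2)) + \<Lambda> * (?S * (CL / real N)))"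
        by (rule order_trans[OF gle]) (use I1 I2 \<Lambda> ev in \<open>intro mult_left_mono add_mono; simp\<close>)
      \<comment> \<open>A factor \<Lambda> >= 1 is inserted in the eigenvalue term, so that
        \<Lambda>^2 can be taken out of both terms.\<close>
      also have "\<dots> \<le> \<Lambda> * (\<Lambda> * (?ev * (?S * (?\<omega> * ?R\<^sup>2))) + \<Lambda> * (?S * (CL / real N)))"
      proof (rule mult_left_mono)
        have "0 \<le> ?ev * (?S * (?\<omega> * ?R\<^sup>2))"
          using ev CD(1) \<omega> by (intro mult_nonneg_nonneg) auto
        from mult_right_mono[OF \<Lambda> this]
        show "?ev * (?S * (?\<omega> * ?R\<^sup>2)) + \<Lambda> * (?S * (CL / real N))
            \<le> \<Lambda> * (?ev * (?S * (?\<omega> * ?R\<^sup>2))) + \<Lambda> * (?S * (CL / real N))" by simp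
      qed (use \<Lambda> in simp)
      also have "\<dots> = \<Lambda>\<^sup>2 * ?S * (64 * ?\<omega> * (4 ^ N * (?ev * d\<^sup>2)) + CL * (1 / real N))"
      proof -
        have "(2::real) ^ N * 2 ^ N = 4 ^ N" by (simp add: power_mult_distrib[symmetric])
        then have R: "?R\<^sup>2 = 4 ^ N * 64 * d\<^sup>2" by (simp add: power2_eq_square mult_ac)
        show ?thesis unfolding R by (simp add: power2_eq_square algebra_simps)
      qed
      also have "\<dots> \<le> \<Lambda>\<^sup>2 * ?S * ((64 * ?\<omega> + CL) * (4 ^ N * (?ev * d\<^sup>2)) + (64 * ?\<omega> + CL) * (1 / real N))"
        using ev CL(1) \<omega> S by (intro mult_left_mono add_mono mult_right_mono) auto
      also have "\<dots> = \<Lambda>\<^sup>2 * ?S * ((64 * ?\<omega> + CL) * (4 ^ N * (?ev * d\<^sup>2) + 1 / real N))"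
        by (simp add: distrib_left)
      finally show ?thesis .
    qed
    have P: "(LINT y|lebesgue_on U. indicator (square_around x (4 * d)) y * (\<eta> y * max (\<phi> y - 0) 0)\<^sup>2)
        \<le> 16 * (4 * d) ^ 3 / l * (LINT y|lebesgue_on U. (norm (g y))\<^sup>2)"
      by (rule Poincare_plane[OF U(1) g l(1,2) sub2 disj])
    have "(\<phi> x)\<^sup>2 \<le> CD / (2 * d)\<^sup>2 * (LINT y|lebesgue_on U. indicator (cball x (2 * d)) y * (\<phi> y)\<^sup>2)"
      using small d by (intro CD(2)[OF U(1,2) ell \<phi> _ _ x]) (auto simp: d_def)
    also have "\<dots> \<le> CD / (2 * d)\<^sup>2 * (LINT y|lebesgue_on U. indicator (square_around x (4 * d)) y * (\<eta> y * max (\<phi> y - 0) 0)\<^sup>2)"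
    proof (intro mult_left_mono integral_mono)
      show "integrable (lebesgue_on U) (\<lambda>y. indicator (cball x (2 * d)) y * (\<phi> y)\<^sup>2)"
        using indicator_square_integrable[OF sq\<phi>, of "cball x (2 * d)"] by simp
      show "integrable (lebesgue_on U) (\<lambda>y. indicator (square_around x (4 * d)) y * (\<eta> y * max (\<phi> y - 0) 0)\<^sup>2)"
        using indicator_square_integrable[OF sqw borel_closed[OF square_around_closed]] by simp
      fix y assume "y \<in> space (lebesgue_on U)"
      then have y: "y \<in> U" by simp
      show "indicator (cball x (2 * d)) y * (\<phi> y)\<^sup>2 \<le> indicator (square_around x (4 * d)) y * (\<eta> y * max (\<phi> y - 0) 0)\<^sup>2"
        unfolding mx[OF y] using ballQ Qball \<eta>(3)[of y] by (auto simp: indicator_def)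
    qed (use CD(1) in simp)
    also have "\<dots> \<le> CD / (2 * d)\<^sup>2 * (16 * (4 * d) ^ 3 / l *
        (\<Lambda>\<^sup>2 * ?S * ((64 * ?\<omega> + CL) * (4 ^ N * (?ev * d\<^sup>2) + 1 / real N))))"
    proof (intro mult_left_mono order_trans[OF P] G)
      show "0 \<le> 16 * (4 * d) ^ 3 / l" using d l(1) by simp
      show "0 \<le> CD / (2 * d)\<^sup>2" using CD(1) by simp
    qed
    also have "\<dots> = (CD / (2 * d)\<^sup>2 * (16 * (4 * d) ^ 3 / l)) * (\<Lambda>\<^sup>2 * CD * (64 * ?\<omega> + CL)) * ?ev *
        (4 ^ N * (?ev * d\<^sup>2) + 1 / real N)"
    proof -
      have "A * (B * (L * (C * e) * (W * X))) = (A * B) * (L * C * W) * e * X" for A B L C e W X :: real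
        by (simp add: mult_ac)
      then show ?thesis .
    qed
    also have "CD / (2 * d)\<^sup>2 * (16 * (4 * d) ^ 3 / l) = 1024 / \<alpha> * CD"
      using d \<alpha> by (simp add: l_def power2_eq_square power3_eq_cube field_simps)
    also have "1024 / \<alpha> * CD * (\<Lambda>\<^sup>2 * CD * (64 * ?\<omega> + CL)) = K"
      by (simp add: K_def power2_eq_square mult_ac)
    finally show ?thesis unfolding d_def .
  qed
  with K that show thesis by blast
qed

text \<open>The hypothesis on \<open>xU\<close> and the bound on the eigenvalue times the area give
  a lower bound for \<phi>^2 proportional to the eigenvalue, and the decay estimate gives an upper
  bound proportional to it as well. The eigenvalue cancels, and a condition on its product with the
  squared distance remains.\<close>

lemma planar_boundary_dist_ge:
  fixes c0 \<alpha> \<beta> \<Lambda> M :: real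
  assumes c0: "0 < c0" and \<alpha>: "0 < \<alpha>" "\<alpha> \<le> 1" and \<beta>: "0 < \<beta>" and \<Lambda>: "1 \<le> \<Lambda>"
  shows "\<exists>K>0. \<forall>(a :: real^2 \<Rightarrow> real^2 \<Rightarrow> real^2 \<Rightarrow> real) (C0 :: real)
            (f :: real \<Rightarrow> real) (g :: real \<Rightarrow> real)
            (V :: (real^2) set) (Vc :: real \<Rightarrow> (real^2) set) (c :: real)
            (U :: (real^2) set) (\<phi> :: real^2 \<Rightarrow> real) (xU :: real^2).
          uniformly_elliptic \<Lambda> a \<and>
          bounded_domain V \<and> inner_uniform C0 c0 V \<and>
          inner_uniform_family C0 c0 f g V Vc \<and>
          1 \<le> c \<and> f c \<le> M \<and>
          bounded_domain U \<and> exterior_ball_condition \<alpha> U \<and> V \<subseteq> U \<and> U \<subseteq> Vc c \<and>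
          principal_eigenfunction a U \<phi> \<and>
          xU \<in> U \<and> \<phi> xU \<ge> \<beta> / sqrt (measure lebesgue U) \<longrightarrow>
          boundary_dist U xU \<ge> K * (1 / sqrt (dirichlet_eigenvalue a U))"
proof -
  obtain CE where CE: "CE > 0"
    "\<And>(a::real^2 \<Rightarrow> real^2 \<Rightarrow> real^2 \<Rightarrow> real) U \<Lambda> z \<rho>. open U \<Longrightarrow> uniformly_elliptic \<Lambda> a \<Longrightarrow> 1 \<le> \<Lambda> \<Longrightarrow>
      0 < \<rho> \<Longrightarrow> ball z \<rho> \<subseteq> U \<Longrightarrow> dirichlet_eigenvalue a U \<le> CE * \<Lambda> / \<rho>\<^sup>2"
    using dirichlet_eigenvalue_le_ball by blast
  obtain CB where CB: "CB > 0"
    "\<And>(a :: real^2 \<Rightarrow> real^2 \<Rightarrow> real^2 \<Rightarrow> real) U \<phi> x N.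
      bounded_domain U \<Longrightarrow> exterior_ball_condition \<alpha> U \<Longrightarrow>
      uniformly_elliptic \<Lambda> a \<Longrightarrow> principal_eigenfunction a U \<phi> \<Longrightarrow> x \<in> U \<Longrightarrow> 1 \<le> N \<Longrightarrow>
      0 < dirichlet_eigenvalue a U \<Longrightarrow> dirichlet_eigenvalue a U * (2 * boundary_dist U x)\<^sup>2 \<le> 1 \<Longrightarrow>
      (\<phi> x)\<^sup>2 \<le> CB * dirichlet_eigenvalue a U *
        (4 ^ N * (dirichlet_eigenvalue a U * (boundary_dist U x)\<^sup>2) + 1 / real N)"
    using planar_boundary_decay[OF \<Lambda> \<alpha>] by blast
  let ?\<omega> = "unit_ball_vol 2"
  have \<omega>: "0 < ?\<omega>" by simp
  \<comment> \<open>The product of the eigenvalue bound CE \<Lambda> / \<rho>^2 and the area bound M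
    times the area of a disc of radius 8\<rho>/c0; \<rho> cancels. \<open>max M 1\<close> keeps it
    positive for every real \<open>M\<close>.\<close>
  define K2 where "K2 = CE * \<Lambda> * (max M 1 * (64 * ?\<omega> / c0\<^sup>2))"
  have K2: "0 < K2" using CE(1) \<Lambda> \<omega> c0 by (simp add: K2_def)
  \<comment> \<open>What is left of the lower bound \<beta>^2 / K2 times the eigenvalue after
    division by \<open>CB\<close> times the eigenvalue. Half of it will absorb 1/N.\<close>
  define \<kappa> where "\<kappa> = \<beta>\<^sup>2 / (K2 * CB)"
  have \<kappa>: "0 < \<kappa>" using \<beta> K2 CB(1) by (simp add: \<kappa>_def)
  obtain n :: nat where n: "2 / \<kappa> \<le> real n" using real_arch_simple by blast
  obtain N :: nat where N: "1 \<le> N" "1 / real N \<le> \<kappa> / 2"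
  proof
    have "1 / real (Suc n) \<le> 1 / (2 / \<kappa>)"
      using n \<kappa> by (intro divide_left_mono mult_pos_pos) auto
    then show "1 / real (Suc n) \<le> \<kappa> / 2" by simp
  qed simp
  \<comment> \<open>The entry 1/4 settles the case where the radius 2d is too large for the decay
    estimate; the other entry is what that estimate leaves after 1/N has been absorbed.\<close>
  define K where "K = sqrt (min (1 / 4) (\<kappa> / (2 * 4 ^ N)))"
  have K: "0 < K" "K\<^sup>2 = min (1 / 4) (\<kappa> / (2 * 4 ^ N))" using \<kappa> by (auto simp: K_def)
  have "K * (1 / sqrt (dirichlet_eigenvalue a U)) \<le> boundary_dist U x"
    if ell: "uniformly_elliptic \<Lambda> a" and V: "bounded_domain V" "inner_uniform C0 c0 V"
      and fam: "inner_uniform_family C0 c0 f g V Vc" and c: "1 \<le> c" "f c \<le> M"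
      and U: "bounded_domain U" "exterior_ball_condition \<alpha> U" "V \<subseteq> U" "U \<subseteq> Vc c"
      and \<phi>: "principal_eigenfunction a U \<phi>" and x: "x \<in> U" and big: "\<phi> x \<ge> \<beta> / sqrt (measure lebesgue U)"
    for a :: "real^2 \<Rightarrow> real^2 \<Rightarrow> real^2 \<Rightarrow> real" and C0 f g V Vc c U \<phi> x
  proof -
    let ?ev = "dirichlet_eigenvalue a U" and ?d = "boundary_dist U x"
    have op: "open U" "bounded U" "U \<noteq> {}" using U(1) by (auto simp: bounded_domain_def)
    have "0 \<le> ?ev" by (rule principal_eigenfunction_energy(2)[OF op(1) ell \<Lambda> \<phi>])
    then consider "?ev = 0" | "0 < ?ev" by linarith
    then show ?thesis
    proof cases
      \<comment> \<open>Here 1 / sqrt 0 = 1 / 0 = 0, so only the nonnegativity of the distance is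
        claimed.\<close>
      case 1
      then show ?thesis by (simp add: infdist_nonneg)
    next
      case 2
      obtain z \<rho> y where \<rho>: "0 < \<rho>" "ball z \<rho> \<subseteq> V" "V \<subseteq> cball y (8 * \<rho> / c0)"
        by (rule inner_uniform_contains_ball[OF V]) blast
      have ev: "?ev \<le> CE * \<Lambda> / \<rho>\<^sup>2"
        by (rule CE(2)[OF op(1) ell \<Lambda> \<rho>(1)]) (use \<rho>(2) U(3) in blast)
      have Vo: "open V" "bounded V" using V(1) by (auto simp: bounded_domain_def)
      have Vc: "bounded_domain (Vc c)" "measure lebesgue (Vc c) = f c * measure lebesgue V"
        using fam c(1) by (auto simp: inner_uniform_family_def)
      have mV: "measure lebesgue V \<le> ?\<omega> * (8 * \<rho> / c0)\<^sup>2"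
      proof -
        have "measure lebesgue V \<le> measure lebesgue (cball y (8 * \<rho> / c0))"
          using Vo(1) \<rho>(3) by (intro measure_mono_fmeasurable) auto
        also have "\<dots> = ?\<omega> * (8 * \<rho> / c0)\<^sup>2"
          using content_cball[of "8 * \<rho> / c0" y] \<rho>(1) c0 by simp
        finally show ?thesis .
      qed
      have "measure lebesgue U \<le> measure lebesgue (Vc c)"
        using U(4) op(1) Vc(1)
        by (intro measure_mono_fmeasurable) (auto simp: bounded_domain_def intro: lmeasurable_open)
      also have "\<dots> \<le> max M 1 * (?\<omega> * (8 * \<rho> / c0)\<^sup>2)"
        unfolding Vc(2) using c(2) mV by (intro mult_mono) auto
      finally have mU: "measure lebesgue U \<le> max M 1 * (64 * ?\<omega> / c0\<^sup>2) * \<rho>\<^sup>2"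
        by (simp add: power_divide power_mult_distrib mult_ac)
      have mU0: "0 < measure lebesgue U"
      proof -
        have "0 < measure lebesgue (ball z \<rho>)" using content_ball_pos[OF \<rho>(1), of z] by simp
        also have "\<dots> \<le> measure lebesgue U"
          using \<rho>(2) U(3) op by (intro measure_mono_fmeasurable) (auto intro: lmeasurable_open)
        finally show ?thesis .
      qed
      have "?ev * measure lebesgue U \<le> (CE * \<Lambda> / \<rho>\<^sup>2) * (max M 1 * (64 * ?\<omega> / c0\<^sup>2) * \<rho>\<^sup>2)"
        using ev mU 2 mU0 \<rho>(1) CE(1) \<Lambda> by (intro mult_mono) auto
      also have "\<dots> = K2" using \<rho>(1) by (simp add: K2_def)
      finally have evU: "?ev * measure lebesgue U \<le> K2" .
      have "\<beta>\<^sup>2 * ?ev / K2 \<le> \<beta>\<^sup>2 / measure lebesgue U"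
        using mult_right_mono[OF evU zero_le_power2[of \<beta>]] mU0 K2 by (simp add: field_simps)
      also have "\<dots> = (\<beta> / sqrt (measure lebesgue U))\<^sup>2" using mU0 by (simp add: power_divide)
      also have "\<dots> \<le> (\<phi> x)\<^sup>2" using big \<beta> mU0 by (intro power_mono) auto
      finally have lower: "\<beta>\<^sup>2 * ?ev / K2 \<le> (\<phi> x)\<^sup>2" .
      have "K\<^sup>2 \<le> ?ev * ?d\<^sup>2"
      proof (cases "?ev * (2 * ?d)\<^sup>2 \<le> 1")
        case False
        then have "1 / 4 \<le> ?ev * ?d\<^sup>2" by (simp add: power_mult_distrib)
        then show ?thesis unfolding K(2) by simp
      next
        case True
        have "\<beta>\<^sup>2 * ?ev / K2 \<le> CB * ?ev * (4 ^ N * (?ev * ?d\<^sup>2) + 1 / real N)"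
          using lower CB(2)[OF U(1,2) ell \<phi> x N(1) 2 True] by linarith
        then have "(CB * ?ev) * \<kappa> \<le> (CB * ?ev) * (4 ^ N * (?ev * ?d\<^sup>2) + 1 / real N)"
          using CB(1) by (simp add: \<kappa>_def mult.commute[of "\<beta>\<^sup>2"])
        then have "\<kappa> \<le> 4 ^ N * (?ev * ?d\<^sup>2) + 1 / real N" using CB(1) 2 by simp
        then have "\<kappa> / 2 \<le> 4 ^ N * (?ev * ?d\<^sup>2)" using N(2) by linarith
        then have "\<kappa> / (2 * 4 ^ N) \<le> ?ev * ?d\<^sup>2" by (simp add: field_simps)
        then show ?thesis unfolding K(2) by simp
      qed
      then have "(K * (1 / sqrt ?ev))\<^sup>2 \<le> ?d\<^sup>2"
        using 2 by (simp add: power_mult_distrib power_divide field_simps)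
      then show ?thesis by (rule power2_le_imp_le) (rule infdist_nonneg)
    qed
  qed
  with K(1) show ?thesis by blast
qed

theorem theorem5p3:
  shows
    "(\<forall>c0 \<alpha> \<beta> \<Lambda> M :: real.
        0 < c0 \<and> c0 \<le> 1 \<and> 0 < \<alpha> \<and> \<alpha> \<le> 1 \<and> 0 < \<beta> \<and> 1 \<le> \<Lambda> \<longrightarrow>
        (\<exists>K>0. \<forall>(a :: real^2 \<Rightarrow> real^2 \<Rightarrow> real^2 \<Rightarrow> real) (C0 :: real)
            (f :: real \<Rightarrow> real) (g :: real \<Rightarrow> real)
            (V :: (real^2) set) (Vc :: real \<Rightarrow> (real^2) set) (c :: real)
            (U :: (real^2) set) (\<phi> :: real^2 \<Rightarrow> real) (xU :: real^2).
          uniformly_elliptic \<Lambda> a \<and>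
          bounded_domain V \<and> inner_uniform C0 c0 V \<and>
          inner_uniform_family C0 c0 f g V Vc \<and>
          1 \<le> c \<and> f c \<le> M \<and>
          bounded_domain U \<and> exterior_ball_condition \<alpha> U \<and> V \<subseteq> U \<and> U \<subseteq> Vc c \<and>
          principal_eigenfunction a U \<phi> \<and>
          xU \<in> U \<and> \<phi> xU \<ge> \<beta> / sqrt (measure lebesgue U) \<longrightarrow>
          boundary_dist U xU \<ge> K * (1 / sqrt (dirichlet_eigenvalue a U))))
     \<and>
     (\<forall>\<beta> \<Lambda> :: real.
        0 < \<beta> \<and> 1 \<le> \<Lambda> \<longrightarrow>
        (\<exists>K>0. \<forall>(a :: real \<Rightarrow> real \<Rightarrow> real \<Rightarrow> real) (u1 :: real) (u2 :: real)
            (\<phi> :: real \<Rightarrow> real) (xU :: real).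
          uniformly_elliptic \<Lambda> a \<and> u1 < u2 \<and>
          principal_eigenfunction a {u1<..<u2} \<phi> \<and>
          xU \<in> {u1<..<u2} \<and> \<phi> xU \<ge> \<beta> / sqrt (measure lebesgue {u1<..<u2}) \<longrightarrow>
          boundary_dist {u1<..<u2} xU \<ge> K * (u2 - u1)))"
proof (intro conjI allI impI, goal_cases)
  case 1
  then show ?case by (intro planar_boundary_dist_ge) auto
next
  case 2
  then show ?case by (intro interval_boundary_dist_ge) auto
qed

end
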